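(* Let $(\mathcal{T},\mathcal{E},(\boldsymbol{x}_K)_{K\in\mathcal{T}})$ be an admissible mesh of $\Omega$ satisfying the regularity conditions (R1)--(R4) with parameters $\zeta,\ell^\star,\tau_\star,\tau^\star$, let $\Delta t=T/N$, and let $C_{FI}$ be the constant of the discrete entropy estimate recalled in the context. Assume that the following inverse CFL condition holds: there exists $\gamma>1$ such that $$\frac{\Delta t}{m_K}\ \ge\ \gamma\,\frac{C_{FI}}{\tau_\star^2}\qquad\text{for all } K\in\mathcal{T}.$$ Then there exists at least one solution $(\boldsymbol{c}^n,\boldsymbol{\mu}^n)_{1\le n\le N}$ to the scheme (S0)--(S4). Moreover, this solution satisfies: (i) mass conservation: $\sum_{K\in\mathcal{T}} m_K c_{i,K}^n=\int_\Omega c_i^0\,d\boldsymbol{x}$ for all $n\ge 0$ and $i\in\{1,2\}$; (ii) positivity: $0<c_{i,K}^n<1$ for all $K\in\mathcal{T}$, $i\in\{1,2\}$, $n\ge1$; (iii) energy decay: for all $n\ge1$, $$\frac{\mathfrak{E}_{\mathcal{T}}(\boldsymbol{c}^n)-\mathfrak{E}_{\mathcal{T}}(\boldsymbol{c}^{n-1})}{\Delta t}+\mathfrak{D}_{\mathcal{T}}(\boldsymbol{c}^n,\boldsymbol{\mu}^n)\le 0,$$ where $$\mathfrak{E}_{\mathcal{T}}(\boldsymbol{c}^n)=\frac{\alpha}{2}\sum_{\sigma=K|L\in\mathcal{E}_{\rm int}}\tau_\sigma(c_{1,K}^n-c_{1,L}^n)^2+\sum_{K\in\mathcal{T}}m_K\Big\{\kappa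 c_{1,K}^nc_{2,K}^n+\sum_{i\in\{1,2\}}\big(c_{i,K}^n\Psi_{i,K}+\theta_{i,\mathcal{T}}\eta_iH(c_{i,K}^n)\big)\Big\}$$ and $$\mathfrak{D}_{\mathcal{T}}(\boldsymbol{c}^n,\boldsymbol{\mu}^n)=\sum_{i\in\{1,2\}}\sum_{\sigma=K|L\in\mathcal{E}_{\rm int}}\tau_\sigma\frac{c_{i,\sigma}^n}{\eta_i}\Big(\mu_{i,K}^n+\Psi_{i,K}-\mu_{i,L}^n-\Psi_{i,L}+\theta_{i,\mathcal{T}}\eta_i\big(\log c_{i,K}^n-\log c_{i,L}^n\big)\Big)^2.$$
   Context: **Data.** $\Omega\subset\mathbb{R}^2$ is a bounded connected polygonal open set, $T>0$, $\alpha,\kappa,\rho>0$, and for $i\in\{1,2\}$: $\eta_i>0$, $\theta_i\ge0$, $\Psi_i\in H^1(\Omega)$, $c_i^0\in H^1(\Omega)$ with $c_i^0\ge0$, $c_1^0+c_2^0=1$ in $\Omega$, $\int_\Omega c_i^0\,d\boldsymbol{x}>0$. $H(c)=c\log c-c+1$ for $c\ge 0$ (with $H(0)=1$). **Admissible mesh.** A triplet $(\mathcal{T},\mathcal{E},(\boldsymbol{x}_K)_{K\in\mathcal{T}})$ such that: (i) each cell $K\in\mathcal{T}$ is non-empty, open, polygonal, convex; cells are pairwise disjoint and $\bigcup_K\overline K=\overline\Omega$; $m_K$ is the area of $K$. (ii) Each edge $\sigma\in\mathcal{E}$ is closed, contained in a line, with length $m_\sigma>0$; distinct edges intersect in a set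 of zero 1-dimensional Hausdorff measure; for each $K$ there is $\mathcal{E}_K\subset\mathcal{E}$ with $\partial K=\bigcup_{\sigma\in\mathcal{E}_K}\sigma$, and $\bigcup_K\mathcal{E}_K=\mathcal{E}$; for $K\ne L$, $\overline K\cap\overline L$ is either a single edge denoted $K|L$ or has zero 1-dimensional measure. (iii) The centers $\boldsymbol{x}_K\in K$ are pairwise distinct, and if $K,L$ share an edge $K|L$, then $\boldsymbol{n}_{KL}=\frac{\boldsymbol{x}_L-\boldsymbol{x}_K}{|\boldsymbol{x}_K-\boldsymbol{x}_L|}$ is orthogonal to $K|L$. (iv) For $\sigma=K|L$, the line joining $\boldsymbol{x}_K$ and $\boldsymbol{x}_L$ crosses $\sigma$ at its midpoint $\boldsymbol{x}_\sigma$. Notation: $h_K=\mathrm{diam}(K)$, $h_{\mathcal{T}}=\max_Kh_K$; for $\sigma=K|L$, $d_\sigma=|\boldsymbol{x}_K-\boldsymbol{x}_L|$, $d_{K\sigma}=|\boldsymbol{x}_K-\boldsymbol{x}_\sigma|$, $\tau_\sigma=m_\sigma/d_\sigma$; $\mathcal{E}_{K,\rm int}$ is the set of $\sigma\in\mathcal{E}_K$ of the form $K|L$, and $\mathcal{E}_{\rm int}=\bigcup_K\mathcal{E}_{K,\rm int}$. **Regularity conditions**, with parameters $\zeta>1$, $\ell^\star\ge3$, $0<\tau_\star\le\tau^\star$: (R1) $d_{K\sigma}\ge d_\sigma/\zeta$ for all $K$, $\sigma\in\mathcal{E}_{K,\rm int}$; (R2) $m_K\ge h_K^2/\zeta$ for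 all $K$; (R3) $\#\mathcal{E}_K\le\ell^\star$ for all $K$; (R4) $\tau_\star\le\tau_\sigma\le\tau^\star$ for all $\sigma\in\mathcal{E}_{\rm int}$. **Scheme.** $\Delta t=T/N$ with $N\ge 1$ an integer, $t^n=n\Delta t$, $\Psi_{i,K}=\frac1{m_K}\int_K\Psi_i$, $\theta_{i,\mathcal{T}}=\max(\theta_i,\rho h_{\mathcal{T}})$. A solution is a family $\boldsymbol{c}^n=(c_{1,K}^n,c_{2,K}^n)_K$, $\boldsymbol{\mu}^n=(\mu_{1,K}^n,\mu_{2,K}^n)_K$, $1\le n\le N$, such that, with (S0) $c_{i,K}^0=\frac1{m_K}\int_Kc_i^0\,d\boldsymbol{x}$, there holds for all $n\in\{1,\dots,N\}$, $K\in\mathcal{T}$, $i\in\{1,2\}$: (S1) $m_K\frac{c_{i,K}^n-c_{i,K}^{n-1}}{\Delta t}+\sum_{\sigma=K|L\in\mathcal{E}_{K,\rm int}}\tau_\sigma\Big[\frac{c_{i,\sigma}^n}{\eta_i}(\mu_{i,K}^n+\Psi_{i,K}-\mu_{i,L}^n-\Psi_{i,L})+\theta_{i,\mathcal{T}}(c_{i,K}^n-c_{i,L}^n)\Big]=0$; (S2) $\mu_{1,K}^n-\mu_{2,K}^n=\frac{\alpha}{m_K}\sum_{\sigma=K|L\in\mathcal{E}_{K,\rm int}}\tau_\sigma(c_{1,K}^n-c_{1,L}^n)+\kappa(1-2c_{1,K}^{n-1})$; (S3) $c_{1,K}^n+c_{2,K}^n=1$; (S4) $\sum_{K}m_K\overline\mu_K^n=0$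 with $\overline\mu_K^n=c_{1,K}^n\mu_{1,K}^n+c_{2,K}^n\mu_{2,K}^n$. Here, for $\sigma=K|L$, $c_{i,\sigma}^n=c_{i,K}^n$ if $c_{i,K}^n=c_{i,L}^n\ge0$; $c_{i,\sigma}^n=0$ if $\min(c_{i,K}^n,c_{i,L}^n)\le0$; and $c_{i,\sigma}^n=\frac{c_{i,K}^n-c_{i,L}^n}{\log c_{i,K}^n-\log c_{i,L}^n}$ otherwise. **The constant $C_{FI}$.** It is a constant depending only on $\Omega,\alpha,\kappa,T,\Psi_i,\eta_i,\theta_i,\rho,c_1^0$ and the mesh regularity parameters (not on the mesh or on $\Delta t$ otherwise), such that every solution to the scheme satisfies the discrete entropy estimate $$\sum_{n=1}^N\Delta t\sum_{K}m_K\Big(\frac1{m_K}\sum_{\sigma=K|L\in\mathcal{E}_{K,\rm int}}\tau_\sigma(c_{1,K}^n-c_{1,L}^n)\Big)^2+\sum_{n=1}^N\Delta t\sum_{i\in\{1,2\}}\eta_i\theta_{i,\mathcal{T}}\sum_{\sigma=K|L\in\mathcal{E}_{\rm int}}\tau_\sigma(c_{i,K}^n-c_{i,L}^n)(\log c_{i,K}^n-\log c_{i,L}^n)\le C_{FI}.$$ *)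

theory Defs
  imports "HOL-Analysis.Analysis"
begin

type_synonym pt = "real^2"

primrec Ck :: "nat \<Rightarrow> (pt \<Rightarrow> real) \<Rightarrow> bool" where
  "Ck 0 f \<longleftrightarrow> continuous_on UNIV f"
| "Ck (Suc k) f \<longleftrightarrow> (\<exists>g. (\<forall>x. GDERIV f x :> g x) \<and> (\<forall>j. Ck k (\<lambda>x. g x $ j)))"

definition test_function :: "pt set \<Rightarrow> (pt \<Rightarrow> real) \<Rightarrow> bool" where
  "test_function \<Omega> \<phi> \<longleftrightarrow>
     (\<forall>k. Ck k \<phi>) \<and> compact (closure {x. \<phi> x \<noteq> 0}) \<and> closure {x. \<phi> x \<noteq> 0} \<subseteq> \<Omega>"

definition L2_on :: "pt set \<Rightarrow> (pt \<Rightarrow> 'b::euclidean_space) \<Rightarrow> bool" where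
  "L2_on \<Omega> u \<longleftrightarrow>
     set_borel_measurable lebesgue \<Omega> u \<and> set_integrable lebesgue \<Omega> (\<lambda>x. (norm (u x))\<^sup>2)"

definition weak_gradient :: "pt set \<Rightarrow> (pt \<Rightarrow> real) \<Rightarrow> (pt \<Rightarrow> pt) \<Rightarrow> bool" where
  "weak_gradient \<Omega> u g \<longleftrightarrow>
     (\<forall>\<phi> D. test_function \<Omega> \<phi> \<longrightarrow> (\<forall>x. GDERIV \<phi> x :> D x) \<longrightarrow>
        (LINT x:\<Omega>|lebesgue. u x *\<^sub>R D x) = - (LINT x:\<Omega>|lebesgue. \<phi> x *\<^sub>R g x))"

text \<open>Elements of the Sobolev space are represented by arbitrary representatives of their classes
  modulo equality almost everywhere; values outside \<^term>\<open>\<Omega>\<close> are irrelevant.\<close>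

definition H1 :: "pt set \<Rightarrow> (pt \<Rightarrow> real) set" where
  "H1 \<Omega> = {u. L2_on \<Omega> u \<and> (\<exists>g. L2_on \<Omega> g \<and> weak_gradient \<Omega> u g)}"

definition polygonal :: "pt set \<Rightarrow> bool" where
  "polygonal S \<longleftrightarrow> bounded S \<and>
     (\<exists>F. finite F \<and> frontier S = (\<Union>(a, b)\<in>F. closed_segment a b))"

text \<open>No normalisation factor is needed in dimension one: the measure of a segment is its
  length.\<close>

definition hausdorff1 :: "pt set \<Rightarrow> ennreal" where
  "hausdorff1 A = (SUP \<delta>\<in>{0::real<..}.
     INF U\<in>{U :: nat \<Rightarrow> pt set. A \<subseteq> (\<Union>j. U j) \<and> (\<forall>j. bounded (U j) \<and> diameter (U j) \<le> \<delta>)}.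
       (\<Sum>j. ennreal (diameter (U j))))"

definition edge_length :: "pt set \<Rightarrow> real" where
  "edge_length \<sigma> = enn2real (hausdorff1 \<sigma>)"

text \<open>The field \<open>cell_edges\<close> records the sets \<open>\<E>\<^sub>K\<close>, whose existence is part
  of the definition of a mesh.\<close>

record mesh =
  cells :: "pt set set"
  edges :: "pt set set"
  cell_edges :: "pt set \<Rightarrow> pt set set"
  centre :: "pt set \<Rightarrow> pt"

abbreviation area :: "pt set \<Rightarrow> real" where
  "area K \<equiv> measure lebesgue K"

definition common_edge :: "pt set \<Rightarrow> pt set \<Rightarrow> pt set" where
  "common_edge K L = closure K \<inter> closure L"

definition share_edge :: "mesh \<Rightarrow> pt set \<Rightarrow> pt set \<Rightarrow> bool" where
  "share_edge M K L \<longleftrightarrow>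
     K \<in> cells M \<and> L \<in> cells M \<and> K \<noteq> L \<and> common_edge K L \<in> edges M"

definition normal :: "mesh \<Rightarrow> pt set \<Rightarrow> pt set \<Rightarrow> pt" where
  "normal M K L = (centre M L - centre M K) /\<^sub>R norm (centre M K - centre M L)"

definition edge_midpoint :: "pt set \<Rightarrow> pt" where
  "edge_midpoint \<sigma> = (THE m. \<exists>a b. \<sigma> = closed_segment a b \<and> m = midpoint a b)"

text \<open>An edge shared by two cells is compact, convex and contained in a line, hence a segment, so
  its midpoint is well defined.\<close>

definition admissible_mesh :: "pt set \<Rightarrow> mesh \<Rightarrow> bool" where
  "admissible_mesh \<Omega> M \<longleftrightarrow>
     finite (cells M) \<and> finite (edges M) \<and>
     (\<forall>K\<in>cells M. K \<noteq> {} \<and> open K \<and> polygonal K \<and> convex K) \<and>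
     pairwise disjnt (cells M) \<and>
     (\<Union>K\<in>cells M. closure K) = closure \<Omega> \<and>
     (\<forall>\<sigma>\<in>edges M. closed \<sigma> \<and> collinear \<sigma> \<and> edge_length \<sigma> > 0) \<and>
     (\<forall>\<sigma>\<in>edges M. \<forall>\<sigma>'\<in>edges M. \<sigma> \<noteq> \<sigma>' \<longrightarrow> hausdorff1 (\<sigma> \<inter> \<sigma>') = 0) \<and>
     (\<forall>K\<in>cells M. cell_edges M K \<subseteq> edges M \<and> frontier K = \<Union>(cell_edges M K)) \<and>
     (\<Union>K\<in>cells M. cell_edges M K) = edges M \<and>
     (\<forall>K\<in>cells M. \<forall>L\<in>cells M. K \<noteq> L \<longrightarrow>
        closure K \<inter> closure L \<in> edges M \<or> hausdorff1 (closure K \<inter> closure L) = 0) \<and>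
     (\<forall>K\<in>cells M. centre M K \<in> K) \<and> inj_on (centre M) (cells M) \<and>
     (\<forall>K L. share_edge M K L \<longrightarrow>
        (\<forall>p\<in>common_edge K L. \<forall>q\<in>common_edge K L. normal M K L \<bullet> (p - q) = 0)) \<and>
     (\<forall>K L. share_edge M K L \<longrightarrow>
        affine hull {centre M K, centre M L} \<inter> common_edge K L
          = {edge_midpoint (common_edge K L)})"

definition int_edges_of :: "mesh \<Rightarrow> pt set \<Rightarrow> pt set set" where
  "int_edges_of M K =
     {\<sigma> \<in> cell_edges M K. \<exists>L\<in>cells M. L \<noteq> K \<and> \<sigma> = common_edge K L}"

definition int_edges :: "mesh \<Rightarrow> pt set set" where
  "int_edges M = (\<Union>K\<in>cells M. int_edges_of M K)"

text \<open>The two cells adjacent to an interior edge are unique. Hence \<open>opposite M K \<sigma>\<close> is the cell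
  \<open>L\<close> with \<open>\<sigma> = K|L\<close>, and \<open>side_cell\<close> only fixes in which order the two cells of an edge are
  listed; everything summed over \<open>int_edges\<close> below is symmetric in the two cells.\<close>

definition opposite :: "mesh \<Rightarrow> pt set \<Rightarrow> pt set \<Rightarrow> pt set" where
  "opposite M K \<sigma> = (THE L. L \<in> cells M \<and> L \<noteq> K \<and> \<sigma> = common_edge K L)"

definition side_cell :: "mesh \<Rightarrow> pt set \<Rightarrow> pt set" where
  "side_cell M \<sigma> = (SOME K. K \<in> cells M \<and> \<sigma> \<in> int_edges_of M K)"

definition d_edge :: "mesh \<Rightarrow> pt set \<Rightarrow> real" where
  "d_edge M \<sigma> = dist (centre M (side_cell M \<sigma>)) (centre M (opposite M (side_cell M \<sigma>) \<sigma>))"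

definition d_cell_edge :: "mesh \<Rightarrow> pt set \<Rightarrow> pt set \<Rightarrow> real" where
  "d_cell_edge M K \<sigma> = dist (centre M K) (edge_midpoint \<sigma>)"

definition transmissibility :: "mesh \<Rightarrow> pt set \<Rightarrow> real" where
  "transmissibility M \<sigma> = edge_length \<sigma> / d_edge M \<sigma>"

definition sum_cell_edges :: "mesh \<Rightarrow> pt set \<Rightarrow> (pt set \<Rightarrow> pt set \<Rightarrow> real) \<Rightarrow> real" where
  "sum_cell_edges M K f =
     (\<Sum>\<sigma>\<in>int_edges_of M K. transmissibility M \<sigma> * f K (opposite M K \<sigma>))"

definition sum_int_edges :: "mesh \<Rightarrow> (pt set \<Rightarrow> pt set \<Rightarrow> real) \<Rightarrow> real" where
  "sum_int_edges M f =
     (\<Sum>\<sigma>\<in>int_edges M. transmissibility M \<sigma> * f (side_cell M \<sigma>) (opposite M (side_cell M \<sigma>) \<sigma>))"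

definition mesh_size :: "mesh \<Rightarrow> real" where
  "mesh_size M = Max (diameter ` cells M)"

definition regular_mesh :: "real \<Rightarrow> nat \<Rightarrow> real \<Rightarrow> real \<Rightarrow> mesh \<Rightarrow> bool" where
  "regular_mesh \<zeta> l \<tau>lo \<tau>hi M \<longleftrightarrow>
     (\<forall>K\<in>cells M. \<forall>\<sigma>\<in>int_edges_of M K. d_cell_edge M K \<sigma> \<ge> d_edge M \<sigma> / \<zeta>) \<and>
     (\<forall>K\<in>cells M. area K \<ge> (diameter K)\<^sup>2 / \<zeta>) \<and>
     (\<forall>K\<in>cells M. card (cell_edges M K) \<le> l) \<and>
     (\<forall>\<sigma>\<in>int_edges M. \<tau>lo \<le> transmissibility M \<sigma> \<and> transmissibility M \<sigma> \<le> \<tau>hi)"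

text \<open>The phases are the indices \<open>i \<in> {1, 2}\<close>; values at other indices are irrelevant.\<close>

record ch_data =
  dom :: "pt set"
  tfin :: real
  alpha :: real
  kappa :: real
  rho :: real
  eta :: "nat \<Rightarrow> real"
  theta :: "nat \<Rightarrow> real"
  Psi :: "nat \<Rightarrow> pt \<Rightarrow> real"
  cinit :: "nat \<Rightarrow> pt \<Rightarrow> real"

definition valid_data :: "ch_data \<Rightarrow> bool" where
  "valid_data D \<longleftrightarrow>
     open (dom D) \<and> bounded (dom D) \<and> connected (dom D) \<and> polygonal (dom D) \<and>
     tfin D > 0 \<and> alpha D > 0 \<and> kappa D > 0 \<and> rho D > 0 \<and>
     (\<forall>i\<in>{1, 2}. eta D i > 0 \<and> theta D i \<ge> 0 \<and>
        Psi D i \<in> H1 (dom D) \<and> cinit D i \<in> H1 (dom D) \<and>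
        (AE x\<in>dom D in lebesgue. cinit D i x \<ge> 0) \<and>
        (LINT x:dom D|lebesgue. cinit D i x) > 0) \<and>
     (AE x\<in>dom D in lebesgue. cinit D 1 x + cinit D 2 x = 1)"

text \<open>Cells are contained in \<open>\<Omega>\<close> up to a subset of the boundary of \<open>\<Omega>\<close>, which is a null set, so
  these averages only depend on the function in \<open>\<Omega>\<close>.\<close>

definition cell_average :: "(pt \<Rightarrow> real) \<Rightarrow> pt set \<Rightarrow> real" where
  "cell_average f K = (LINT x:K|lebesgue. f x) / area K"

definition time_step :: "ch_data \<Rightarrow> nat \<Rightarrow> real" where
  "time_step D N = tfin D / real N"

definition theta_mesh :: "ch_data \<Rightarrow> mesh \<Rightarrow> nat \<Rightarrow> real" where
  "theta_mesh D M i = max (theta D i) (rho D * mesh_size M)"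

definition Psi_cell :: "ch_data \<Rightarrow> nat \<Rightarrow> pt set \<Rightarrow> real" where
  "Psi_cell D i K = cell_average (Psi D i) K"

definition edge_conc :: "real \<Rightarrow> real \<Rightarrow> real" where
  "edge_conc a b =
     (if a = b \<and> a \<ge> 0 then a
      else if min a b \<le> 0 then 0
      else (a - b) / (ln a - ln b))"

text \<open>A discrete unknown maps a time index, a phase and a cell to a value. The chemical potentials
  carry no condition at time index \<open>0\<close>.\<close>

type_synonym unknown = "nat \<Rightarrow> nat \<Rightarrow> pt set \<Rightarrow> real"

definition is_solution :: "ch_data \<Rightarrow> mesh \<Rightarrow> nat \<Rightarrow> unknown \<Rightarrow> unknown \<Rightarrow> bool" where
  "is_solution D M N c \<mu> \<longleftrightarrow>
     (\<forall>i\<in>{1, 2}. \<forall>K\<in>cells M. c 0 i K = cell_average (cinit D i) K) \<and>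
     (\<forall>n\<in>{1..N}. \<forall>K\<in>cells M. \<forall>i\<in>{1, 2}.
        area K * ((c n i K - c (n - 1) i K) / time_step D N)
        + sum_cell_edges M K (\<lambda>K L.
            edge_conc (c n i K) (c n i L) / eta D i
              * (\<mu> n i K + Psi_cell D i K - \<mu> n i L - Psi_cell D i L)
            + theta_mesh D M i * (c n i K - c n i L)) = 0) \<and>
     (\<forall>n\<in>{1..N}. \<forall>K\<in>cells M.
        \<mu> n 1 K - \<mu> n 2 K
          = alpha D / area K * sum_cell_edges M K (\<lambda>K L. c n 1 K - c n 1 L)
            + kappa D * (1 - 2 * c (n - 1) 1 K)) \<and>
     (\<forall>n\<in>{1..N}. \<forall>K\<in>cells M. c n 1 K + c n 2 K = 1) \<and>
     (\<forall>n\<in>{1..N}. (\<Sum>K\<in>cells M. area K * (c n 1 K * \<mu> n 1 K + c n 2 K * \<mu> n 2 K)) = 0)"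

definition entropy_lhs :: "ch_data \<Rightarrow> mesh \<Rightarrow> nat \<Rightarrow> unknown \<Rightarrow> real" where
  "entropy_lhs D M N c =
     (\<Sum>n=1..N. time_step D N * (\<Sum>K\<in>cells M.
        area K * (1 / area K * sum_cell_edges M K (\<lambda>K L. c n 1 K - c n 1 L))\<^sup>2))
     + (\<Sum>n=1..N. time_step D N * (\<Sum>i\<in>{1, 2}.
        eta D i * theta_mesh D M i *
          sum_int_edges M (\<lambda>K L. (c n i K - c n i L) * (ln (c n i K) - ln (c n i L)))))"

text \<open>A constant in the discrete entropy estimate: the bound is uniform over all admissible meshes
  with the given regularity parameters and over all time steps.\<close>

definition entropy_constant ::
    "ch_data \<Rightarrow> real \<Rightarrow> nat \<Rightarrow> real \<Rightarrow> real \<Rightarrow> real \<Rightarrow> bool" where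
  "entropy_constant D \<zeta> l \<tau>lo \<tau>hi C \<longleftrightarrow>
     (\<forall>M N c \<mu>. admissible_mesh (dom D) M \<longrightarrow> regular_mesh \<zeta> l \<tau>lo \<tau>hi M \<longrightarrow> N \<ge> 1 \<longrightarrow>
        is_solution D M N c \<mu> \<longrightarrow> entropy_lhs D M N c \<le> C)"

text \<open>As \<^term>\<open>0 * ln 0 = (0::real)\<close>, this formula gives the required value \<open>1\<close> at \<open>0\<close>.\<close>

definition H_ent :: "real \<Rightarrow> real" where
  "H_ent s = s * ln s - s + 1"

definition energy :: "ch_data \<Rightarrow> mesh \<Rightarrow> (nat \<Rightarrow> pt set \<Rightarrow> real) \<Rightarrow> real" where
  "energy D M c =
     alpha D / 2 * sum_int_edges M (\<lambda>K L. (c 1 K - c 1 L)\<^sup>2)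
     + (\<Sum>K\<in>cells M. area K *
          (kappa D * c 1 K * c 2 K
           + (\<Sum>i\<in>{1, 2}. c i K * Psi_cell D i K + theta_mesh D M i * eta D i * H_ent (c i K))))"

definition dissipation ::
    "ch_data \<Rightarrow> mesh \<Rightarrow> (nat \<Rightarrow> pt set \<Rightarrow> real) \<Rightarrow> (nat \<Rightarrow> pt set \<Rightarrow> real) \<Rightarrow> real" where
  "dissipation D M c \<mu> =
     (\<Sum>i\<in>{1, 2}. sum_int_edges M (\<lambda>K L.
        edge_conc (c i K) (c i L) / eta D i *
          (\<mu> i K + Psi_cell D i K - \<mu> i L - Psi_cell D i L
           + theta_mesh D M i * eta D i * (ln (c i K) - ln (c i L)))\<^sup>2))"

end

theory Submission
  imports Defs
begin

text \<open>
  One time step is recast with the generalised potentials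
  \<open>p\<^sub>i = \<mu>\<^sub>i + \<Psi>\<^sub>i + \<theta>\<^sub>i \<eta>\<^sub>i log c\<^sub>i\<close>. Because the edge concentration is the
  logarithmic mean, \<open>c\<^sub>\<sigma> (log c\<^sub>K - log c\<^sub>L) = c\<^sub>K - c\<^sub>L\<close>, so drift and diffusion merge into the single flux
  \<open>\<tau>\<^sub>\<sigma> c\<^sub>\<sigma> (p\<^sub>K - p\<^sub>L) / \<eta>\<close>. The step becomes two weighted graph Laplace equations for \<open>p\<^sub>1\<close> and
  \<open>p\<^sub>2\<close> with opposite right hand sides, coupled by \<open>p\<^sub>1 - p\<^sub>2 = F'(c\<^sub>1)\<close>, where \<open>F'\<close> is the derivative of a
  free energy whose concave part is taken at the old time level. Testing the three
  equations with \<open>p\<^sub>1\<close>, \<open>p\<^sub>2\<close> and the increment of \<open>c\<^sub>1\<close> bounds the dissipation and the increment.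

  Positivity comes from the dissipation, because the diffusion coefficient of the scheme is
  \<open>max \<theta>\<^sub>i (\<rho> h) > 0\<close>. If \<open>c\<^sub>1\<close> tends to \<open>0\<close> at some cell, then, as the mass is positive and the mesh is
  connected, it does so at a cell \<open>K\<close> with a neighbour \<open>L\<close> where \<open>c\<^sub>1\<close> keeps a gap above.
  The mobilities on that edge vanish at most like \<open>1 / \<bar>log c\<^sub>1\<^sub>,\<^sub>K\<bar>\<close> and \<open>1 / \<bar>log c\<^sub>2\<^sub>,\<^sub>L\<bar>\<close>. Hence the
  bounded dissipation allows jumps of \<open>p\<^sub>1\<close> and \<open>p\<^sub>2\<close> of the order of the square roots of
  these logarithms only, while \<open>p\<^sub>1 - p\<^sub>2\<close> jumps by the logarithms themselves: a contradiction. This is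
  \<open>gap_controls_logs\<close>; it also covers edges on which both concentrations degenerate.

  The existence argument regularises the step: concentrations are clamped to \<open>[\<epsilon>, 1 - \<epsilon>]\<close> in the
  mobilities and in the logarithms, and a term \<open>\<epsilon> p\<^sub>i\<close> is added. The regularised
  step is a continuous field that points outwards on a large cube, so it has a zero
  (\<open>zero_of_outward_field\<close>, a form of the Brouwer fixed point theorem). All estimates are uniform in \<open>\<epsilon>\<close>,
  a subsequence converges, and its limit solves the step (\<open>step_exists\<close>).

  The remaining parts are the geometry of admissible meshes (an interior edge has exactly two cells, the
  adjacency graph is connected), which turns sums over edges into double sums over cells, and the
  convexity inequalities that turn the balance of one step into decay of the energy.
\<close>

section \<open>Zeros of continuous fields on a cube\<close>

text \<open>The unknown of a time step has three components per cell, so its dimension varies with the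
  mesh and is not given by a type. Vectors are therefore functions of which only the values on a
  finite index set matter, and continuity is expressed by convergence of these coordinates.\<close>

definition coord_continuous :: "'i set \<Rightarrow> (('i \<Rightarrow> real) \<Rightarrow> 'i \<Rightarrow> real) \<Rightarrow> bool" where
  "coord_continuous I F \<longleftrightarrow>
     (\<forall>X x. (\<forall>i\<in>I. (\<lambda>k. X k i) \<longlonglongrightarrow> x i) \<longrightarrow>
        (\<forall>i\<in>I. (\<lambda>k. F (X k) i) \<longlonglongrightarrow> F x i))"

lemma coord_continuousD:
  assumes "coord_continuous I F" "\<And>i. i \<in> I \<Longrightarrow> (\<lambda>k. X k i) \<longlonglongrightarrow> x i" "i \<in> I"
  shows "(\<lambda>k. F (X k) i) \<longlonglongrightarrow> F x i"
  using assms unfolding coord_continuous_def by blast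

lemma bounded_coords_subseq:
  fixes X :: "nat \<Rightarrow> 'i \<Rightarrow> real"
  assumes "finite I" "\<And>i. i \<in> I \<Longrightarrow> Bseq (\<lambda>k. X k i)"
  obtains r x where "strict_mono r" "\<And>i. i \<in> I \<Longrightarrow> (\<lambda>k. X (r k) i) \<longlonglongrightarrow> x i"
proof -
  have "\<exists>r x. strict_mono (r :: nat \<Rightarrow> nat) \<and> (\<forall>i\<in>I. (\<lambda>k. X (r k) i) \<longlonglongrightarrow> x i)"
    using assms
  proof (induction I)
    case empty
    show ?case by (rule exI[of _ id]) (auto simp: strict_mono_def)
  next
    case (insert j J)
    then obtain r x where r: "strict_mono (r :: nat \<Rightarrow> nat)"
      and x: "\<And>i. i \<in> J \<Longrightarrow> (\<lambda>k. X (r k) i) \<longlonglongrightarrow> x i"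
      by (metis insertCI)
    have "bounded (range (\<lambda>k. X (r k) j))"
      using Bseq_subseq[OF insert.prems[of j], of r] by (simp add: Bseq_eq_bounded)
    then obtain l s where s: "strict_mono (s :: nat \<Rightarrow> nat)"
      and l: "((\<lambda>k. X (r k) j) \<circ> s) \<longlonglongrightarrow> l"
      using bounded_imp_convergent_subsequence by blast
    have "(\<lambda>k. X ((r \<circ> s) k) i) \<longlonglongrightarrow> (x(j := l)) i" if "i \<in> insert j J" for i
    proof (cases "i = j")
      case True
      then show ?thesis using l by (simp add: o_def)
    next
      case False
      then show ?thesis using LIMSEQ_subseq_LIMSEQ[OF x s, of i] that by (simp add: o_def)
    qed
    with r s show ?case by (intro exI[of _ "r \<circ> s"] exI[of _ "x(j := l)"]) (auto simp: strict_mono_def)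
  qed
  then show ?thesis using that by blast
qed

text \<open>Divide the cube into a grid of \<open>p\<close> steps per coordinate and label a grid point in direction
  \<open>i\<close> by the sign of \<open>f\<^sub>i\<close>. Kuhn's combinatorial lemma gives a small grid cube in which every label
  takes both values. Along a convergent subsequence of these cubes as \<open>p\<close> grows, both sign
  conditions survive in the limit.\<close>

lemma poincare_miranda:
  fixes f :: "('i \<Rightarrow> real) \<Rightarrow> 'i \<Rightarrow> real"
  assumes fin: "finite I" and R: "R > 0" and cont: "coord_continuous I f"
    and lo: "\<And>x i. i \<in> I \<Longrightarrow> (\<And>j. j \<in> I \<Longrightarrow> \<bar>x j\<bar> \<le> R) \<Longrightarrow> x i = - R \<Longrightarrow> f x i \<le> 0"
    and hi: "\<And>x i. i \<in> I \<Longrightarrow> (\<And>j. j \<in> I \<Longrightarrow> \<bar>x j\<bar> \<le> R) \<Longrightarrow> x i = R \<Longrightarrow> f x i \<ge> 0"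
  obtains x where "\<And>i. i \<in> I \<Longrightarrow> \<bar>x i\<bar> \<le> R" "\<And>i. i \<in> I \<Longrightarrow> f x i = 0"
proof -
  define n where "n = card I"
  obtain h where h: "bij_betw h I {..<n}"
    using ex_bij_betw_finite_nat[OF fin] by (auto simp: n_def atLeast0LessThan)
  define e where "e = inv_into I h"
  have e: "bij_betw e {..<n} I" unfolding e_def by (rule bij_betw_inv_into[OF h])
  have eI: "e j \<in> I" if "j < n" for j using e that by (auto simp: bij_betw_def)
  have hI: "h i < n" if "i \<in> I" for i using h that by (auto simp: bij_betw_def)
  have he: "h (e j) = j" if "j < n" for j
    using that h unfolding e_def by (simp add: bij_betw_inv_into_right)
  have eh: "e (h i) = i" if "i \<in> I" for i
    using that h unfolding e_def by (simp add: bij_betw_inv_into_left)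
  define P where "P p y i = - R + 2 * R * (real (y (h i)) / real p)" for p :: nat
      and y :: "nat \<Rightarrow> nat" and i
  have Pin: "\<bar>P p y i\<bar> \<le> R" if "p > 0" "\<forall>j<n. y j \<le> p" "i \<in> I" for p y i
  proof -
    have q: "real (y (h i)) / real p \<le> 1" "0 \<le> real (y (h i)) / real p"
      using that hI[of i] by (auto simp: divide_simps)
    then have "2 * R * (real (y (h i)) / real p) \<le> 2 * R * 1" "0 \<le> 2 * R * (real (y (h i)) / real p)"
      using R by (auto simp only: intro!: mult_left_mono mult_nonneg_nonneg)
    then show ?thesis unfolding P_def by linarith
  qed
  \<comment> \<open>On the two faces the label is prescribed; the sign conditions on \<open>f\<close> there keep it consistent.\<close>
  define lab where "lab p y j =
    (if y j = p \<or> (f (P p y) (e j) > 0 \<and> y j \<noteq> 0) then 1 else (0::nat))" for p y j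
  have lab0: "f (P p y) (e j) \<le> 0" if "p > 0" "\<forall>j<n. y j \<le> p" "j < n" "lab p y j = 0" for p y j
  proof (cases "y j = 0")
    case True
    then have "P p y (e j) = - R" using that he by (simp add: P_def)
    then show ?thesis using lo[OF eI[OF that(3)] Pin[OF that(1,2)]] by simp
  next
    case False
    then show ?thesis using that(4) by (auto simp: lab_def split: if_splits)
  qed
  have lab1: "f (P p y) (e j) \<ge> 0" if "p > 0" "\<forall>j<n. y j \<le> p" "j < n" "lab p y j \<noteq> 0" for p y j
  proof (cases "y j = p")
    case True
    then have "P p y (e j) = R" using that he by (simp add: P_def)
    then show ?thesis using hi[OF eI[OF that(3)] Pin[OF that(1,2)]] by simp
  next
    case False
    then show ?thesis using that(4) by (auto simp: lab_def split: if_splits)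
  qed
  define adj where "adj q r \<longleftrightarrow> (\<forall>j<n. q j \<le> r j \<and> r j \<le> q j + 1)" for q r :: "nat \<Rightarrow> nat"
  have ex: "\<exists>q. (\<forall>j<n. q j < p) \<and>
     (\<forall>j<n. \<exists>r s. adj q r \<and> adj q s \<and> f (P p r) (e j) \<le> 0 \<and> f (P p s) (e j) \<ge> 0)"
    if p: "p > 0" for p
  proof -
    have l: "\<forall>x. (\<forall>i<n. x i \<le> p) \<longrightarrow> (\<forall>i<n. lab p x i = 0 \<or> lab p x i = 1)"
      "\<forall>x. (\<forall>i<n. x i \<le> p) \<longrightarrow> (\<forall>i<n. x i = 0 \<longrightarrow> lab p x i = 0)"
      "\<forall>x. (\<forall>i<n. x i \<le> p) \<longrightarrow> (\<forall>i<n. x i = p \<longrightarrow> lab p x i = 1)"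
      using p by (auto simp: lab_def)
    obtain q where q: "\<forall>i<n. q i < p" and
      rs: "\<forall>i<n. \<exists>r s. adj q r \<and> adj q s \<and> lab p r i \<noteq> lab p s i"
      unfolding adj_def by (rule kuhn_lemma[OF p l])
    have adj_le: "\<forall>j<n. r j \<le> p" if "adj q r" for r
    proof (intro allI impI)
      fix j assume "j < n"
      then have "r j \<le> q j + 1" "q j < p" using that q by (auto simp: adj_def)
      then show "r j \<le> p" by linarith
    qed
    have "\<exists>r s. adj q r \<and> adj q s \<and> f (P p r) (e j) \<le> 0 \<and> f (P p s) (e j) \<ge> 0" if jn: "j < n" for j
    proof -
      from rs jn obtain r s where rs: "adj q r" "adj q s" "lab p r j \<noteq> lab p s j" by metis
      show ?thesis
      proof (cases "lab p r j = 0")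
        case True
        then show ?thesis
          using rs lab0[OF p adj_le[OF rs(1)] jn] lab1[OF p adj_le[OF rs(2)] jn] by metis
      next
        case False
        then have "lab p s j = 0" using rs(3) by (auto simp: lab_def split: if_splits)
        then show ?thesis
          using False rs lab0[OF p adj_le[OF rs(2)] jn] lab1[OF p adj_le[OF rs(1)] jn] by metis
      qed
    qed
    with q show ?thesis by auto
  qed
  have "\<forall>k. \<exists>q. (\<forall>j<n. q j < Suc k) \<and>
     (\<forall>j<n. \<exists>r s. adj q r \<and> adj q s \<and> f (P (Suc k) r) (e j) \<le> 0 \<and> f (P (Suc k) s) (e j) \<ge> 0)"
    by (rule allI, rule ex) simp
  from choice[OF this] obtain q where q: "\<And>k j. j < n \<Longrightarrow> q k j < Suc k"
    and rs: "\<And>k j. j < n \<Longrightarrow> \<exists>r s. adj (q k) r \<and> adj (q k) s \<and> f (P (Suc k) r) (e j) \<le> 0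
        \<and> f (P (Suc k) s) (e j) \<ge> 0"
    by metis
  have "Bseq (\<lambda>k. P (Suc k) (q k) i)" if "i \<in> I" for i
    using q that by (intro BseqI'[of _ R]) (auto intro!: Pin simp: less_imp_le)
  then obtain t x where t: "strict_mono t"
    and x: "\<And>i. i \<in> I \<Longrightarrow> (\<lambda>k. P (Suc (t k)) (q (t k)) i) \<longlonglongrightarrow> x i"
    using bounded_coords_subseq[OF fin, of "\<lambda>k. P (Suc k) (q k)"] by blast
  have xR: "\<bar>x i\<bar> \<le> R" if "i \<in> I" for i
    using tendsto_rabs[OF x[OF that]] q that
    by (intro Lim_bounded[where M = 0]) (auto intro!: Pin simp: less_imp_le)
  have near: "(\<lambda>k. P (Suc (t k)) (r k) i) \<longlonglongrightarrow> x i"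
    if "\<And>k. adj (q (t k)) (r k)" "i \<in> I" for r i
  proof -
    have d0: "(\<lambda>k. 2 * R * (1 / real (Suc (t k)))) \<longlonglongrightarrow> 2 * R * 0"
      using LIMSEQ_subseq_LIMSEQ[OF LIMSEQ_inverse_real_of_nat t]
      by (intro tendsto_mult tendsto_const) (simp add: o_def inverse_eq_divide)
    have le: "P (Suc (t k)) (r k) i \<le> P (Suc (t k)) (q (t k)) i + 2 * R * (1 / real (Suc (t k)))" for k
    proof -
      have "r k (h i) \<le> q (t k) (h i) + 1" using that(1)[of k, unfolded adj_def] hI[OF that(2)] by simp
      then have "real (r k (h i)) \<le> real (q (t k) (h i)) + 1" by linarith
      then have "real (r k (h i)) / real (Suc (t k)) \<le> real (q (t k) (h i)) / real (Suc (t k))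
          + 1 / real (Suc (t k))"
        by (simp add: divide_simps del: of_nat_Suc)
      then have "2 * R * (real (r k (h i)) / real (Suc (t k)))
          \<le> 2 * R * (real (q (t k) (h i)) / real (Suc (t k)) + 1 / real (Suc (t k)))"
        using R by (intro mult_left_mono) auto
      then show ?thesis by (simp only: P_def distrib_left)
    qed
    have ge: "P (Suc (t k)) (r k) i \<ge> P (Suc (t k)) (q (t k)) i" for k
      unfolding P_def using that(1)[of k, unfolded adj_def] hI[OF that(2)] R
      by (auto intro!: divide_right_mono)
    show ?thesis
      by (rule tendsto_sandwich[OF _ _ x[OF that(2)]])
        (use le ge tendsto_add[OF x[OF that(2)] d0] in auto)
  qed
  have "f x i = 0" if i: "i \<in> I" for i
  proof -
    have "\<forall>k. \<exists>rs. adj (q (t k)) (fst rs) \<and> adj (q (t k)) (snd rs)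
        \<and> f (P (Suc (t k)) (fst rs)) i \<le> 0 \<and> f (P (Suc (t k)) (snd rs)) i \<ge> 0"
      using rs[OF hI[OF i]] by (simp add: eh[OF i] split_paired_Ex)
    from choice[OF this] obtain rs where
      r: "\<And>k. adj (q (t k)) (fst (rs k))" and s: "\<And>k. adj (q (t k)) (snd (rs k))" and
      fr: "\<And>k. f (P (Suc (t k)) (fst (rs k))) i \<le> 0" and
      fs: "\<And>k. f (P (Suc (t k)) (snd (rs k))) i \<ge> 0" by metis
    have "(\<lambda>k. f (P (Suc (t k)) (fst (rs k))) i) \<longlonglongrightarrow> f x i"
      by (rule coord_continuousD[OF cont near[OF r] i])
    then have "f x i \<le> 0" by (rule LIMSEQ_le_const2) (use fr in auto)
    moreover have "(\<lambda>k. f (P (Suc (t k)) (snd (rs k))) i) \<longlonglongrightarrow> f x i"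
      by (rule coord_continuousD[OF cont near[OF s] i])
    then have "f x i \<ge> 0" by (rule LIMSEQ_le_const) (use fs in auto)
    ultimately show ?thesis by simp
  qed
  with xR show ?thesis by (rule that)
qed

text \<open>A zero of the difference between \<open>x\<close> and the projection of \<open>x - F x\<close> onto the cube is a
  solution of the variational inequality for \<open>F\<close>: each component of \<open>F\<close> vanishes or points inwards
  on a face. All products \<open>F\<^sub>i x\<^sub>i\<close> are then nonpositive, which excludes the boundary when \<open>F\<close>
  points outwards there.\<close>

lemma zero_of_outward_field:
  fixes F :: "('i \<Rightarrow> real) \<Rightarrow> 'i \<Rightarrow> real"
  assumes fin: "finite I" and R: "R > 0" and cont: "coord_continuous I F"
    and out: "\<And>x i. i \<in> I \<Longrightarrow> (\<And>j. j \<in> I \<Longrightarrow> \<bar>x j\<bar> \<le> R) \<Longrightarrow> \<bar>x i\<bar> = R \<Longrightarrow> (\<Sum>j\<in>I. F x j * x j) > 0"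
  obtains x where "\<And>i. i \<in> I \<Longrightarrow> F x i = 0"
proof -
  define f where "f x i = x i - max (- R) (min R (x i - F x i))" for x i
  have cf: "coord_continuous I f"
    unfolding coord_continuous_def f_def
    using coord_continuousD[OF cont] by (auto intro!: tendsto_intros)
  obtain x where x: "\<And>i. i \<in> I \<Longrightarrow> \<bar>x i\<bar> \<le> R" and f: "\<And>i. i \<in> I \<Longrightarrow> f x i = 0"
    using R by (rule_tac poincare_miranda[OF fin R cf]) (auto simp: f_def)
  have le: "F x j * x j \<le> 0" if "j \<in> I" for j
  proof -
    have "F x j = 0 \<or> (x j = R \<and> F x j \<le> 0) \<or> (x j = - R \<and> F x j \<ge> 0)"
      using f[OF that] x[OF that] R by (auto simp: f_def max_def min_def split: if_splits)
    then show ?thesis using R by (auto simp: mult_le_0_iff)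
  qed
  have "F x i = 0" if "i \<in> I" for i
  proof (rule ccontr)
    assume "F x i \<noteq> 0"
    then have "\<bar>x i\<bar> = R"
      using f[OF that] x[OF that] R by (auto simp: f_def max_def min_def split: if_splits)
    from out[of i x, OF that x this] sum_nonpos[of I "\<lambda>j. F x j * x j"] le show False by fastforce
  qed
  then show ?thesis by (rule that)
qed

section \<open>The logarithmic mean\<close>

lemma edge_conc_commute: "edge_conc a b = edge_conc b a"
proof -
  have "(a - b) / (ln a - ln b) = (b - a) / (ln b - ln a)" by (metis minus_diff_eq minus_divide_divide)
  then show ?thesis by (simp add: edge_conc_def min.commute)
qed

text \<open>The identity for which the logarithmic mean is chosen: it rewrites diffusion of \<open>c\<close> as
  transport by the gradient of \<open>ln c\<close>.\<close>

lemma edge_conc_mult_ln: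
  assumes "a > 0" "b > 0"
  shows "edge_conc a b * (ln a - ln b) = a - b"
  using assms by (auto simp: edge_conc_def)

lemma edge_conc_bounds:
  assumes "a > 0" "b > 0"
  shows "min a b \<le> edge_conc a b" "edge_conc a b \<le> max a b"
proof -
  have main: "a \<le> edge_conc a b \<and> edge_conc a b \<le> b" if "0 < a" "a < b" for a b :: real
  proof -
    have e: "edge_conc a b = (b - a) / ln (b / a)"
      using that by (simp add: edge_conc_commute[of a b]) (simp add: edge_conc_def ln_div)
    have l: "ln (b / a) \<le> b / a - 1" using that by (intro ln_le_minus_one) simp
    have "ln (a / b) \<le> a / b - 1" using that by (intro ln_le_minus_one) simp
    then have l2: "1 - a / b \<le> ln (b / a)" using that by (simp add: ln_div)
    have p: "ln (b / a) > 0" using that by simp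
    have "a * ln (b / a) \<le> a * (b / a - 1)" using l that by (intro mult_left_mono) auto
    also have "\<dots> = b - a" using that by (simp add: field_simps)
    finally have 1: "a \<le> (b - a) / ln (b / a)" using p by (simp add: pos_le_divide_eq)
    have "b * (1 - a / b) \<le> b * ln (b / a)" using l2 that by (intro mult_left_mono) auto
    moreover have "b * (1 - a / b) = b - a" using that by (simp add: field_simps)
    ultimately have "(b - a) / ln (b / a) \<le> b" using p by (simp add: pos_divide_le_eq)
    with 1 e show ?thesis by simp
  qed
  consider "a < b" | "b < a" | "a = b" by linarith
  then have "min a b \<le> edge_conc a b \<and> edge_conc a b \<le> max a b"
  proof cases
    case 1
    then show ?thesis using main[of a b] assms by simp
  next
    case 2
    then show ?thesis using main[of b a] assms edge_conc_commute[of a b] by simp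
  next
    case 3
    then show ?thesis using assms by (simp add: edge_conc_def)
  qed
  then show "min a b \<le> edge_conc a b" "edge_conc a b \<le> max a b" by auto
qed

lemma edge_conc_pos: "a > 0 \<Longrightarrow> b > 0 \<Longrightarrow> edge_conc a b > 0"
  using edge_conc_bounds(1)[of a b] by linarith

text \<open>When one argument tends to zero while the other stays away from it, the mean degenerates only
  logarithmically. Positivity of the scheme rests on this rate.\<close>

lemma edge_conc_ge_of_gap:
  assumes "0 < a" "b \<le> 1" "0 < d" "a + d \<le> b"
  shows "edge_conc a b \<ge> d / (- ln a)"
proof -
  have "ln a < ln b" "ln b \<le> 0" using assms by auto
  then have "d / (- ln a) \<le> (b - a) / (ln b - ln a)"
    using assms by (intro frac_le) auto
  also have "\<dots> = edge_conc b a" using assms by (simp add: edge_conc_def)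
  finally show ?thesis by (simp add: edge_conc_commute)
qed

text \<open>On the diagonal the defining quotient is \<open>0 / 0\<close>, and continuity follows from squeezing
  between the minimum and the maximum.\<close>

lemma tendsto_edge_conc:
  fixes a b :: real
  assumes f: "(f \<longlongrightarrow> a) F" and g: "(g \<longlongrightarrow> b) F" and pos: "a > 0" "b > 0"
  shows "((\<lambda>x. edge_conc (f x) (g x)) \<longlongrightarrow> edge_conc a b) F"
proof -
  have ev: "\<forall>\<^sub>F x in F. f x > 0" "\<forall>\<^sub>F x in F. g x > 0"
    using order_tendstoD(1)[OF f pos(1)] order_tendstoD(1)[OF g pos(2)] by auto
  show ?thesis
  proof (cases "a = b")
    case True
    have "((\<lambda>x. min (f x) (g x)) \<longlongrightarrow> min a b) F" "((\<lambda>x. max (f x) (g x)) \<longlongrightarrow> max a b) F"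
      by (intro tendsto_min tendsto_max f g)+
    moreover have "min a b = edge_conc a b" "max a b = edge_conc a b"
      using True pos by (auto simp: edge_conc_def)
    moreover have "\<forall>\<^sub>F x in F. min (f x) (g x) \<le> edge_conc (f x) (g x)"
      "\<forall>\<^sub>F x in F. edge_conc (f x) (g x) \<le> max (f x) (g x)"
      using ev by (eventually_elim; use edge_conc_bounds in simp)+
    ultimately show ?thesis by (auto intro: tendsto_sandwich)
  next
    case False
    then have "ln a - ln b \<noteq> 0" using pos by simp
    then have "((\<lambda>x. (f x - g x) / (ln (f x) - ln (g x))) \<longlongrightarrow> (a - b) / (ln a - ln b)) F"
      using pos by (intro tendsto_intros f g) auto
    moreover have "edge_conc a b = (a - b) / (ln a - ln b)" using False pos by (simp add: edge_conc_def)
    moreover have "((\<lambda>x. f x - g x) \<longlongrightarrow> a - b) F" by (intro tendsto_diff f g)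
    then have "\<forall>\<^sub>F x in F. f x - g x \<noteq> 0" using False by (intro tendsto_imp_eventually_ne) auto
    with ev have "\<forall>\<^sub>F x in F. (f x - g x) / (ln (f x) - ln (g x)) = edge_conc (f x) (g x)"
      by eventually_elim (simp add: edge_conc_def)
    ultimately show ?thesis by (simp add: tendsto_cong)
  qed
qed

section \<open>Laplacians of weighted graphs\<close>

definition laplacian :: "'v set \<Rightarrow> ('v \<Rightarrow> 'v \<Rightarrow> real) \<Rightarrow> ('v \<Rightarrow> real) \<Rightarrow> 'v \<Rightarrow> real" where
  "laplacian V a q K = (\<Sum>L\<in>V. a K L * (q K - q L))"

text \<open>Discrete integration by parts; every energy identity below is an instance.\<close>

lemma sum_laplacian_mult:
  assumes "\<And>K L. K \<in> V \<Longrightarrow> L \<in> V \<Longrightarrow> a K L = a L K"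
  shows "(\<Sum>K\<in>V. laplacian V a q K * v K) = (\<Sum>K\<in>V. \<Sum>L\<in>V. a K L * (q K - q L) * (v K - v L)) / 2"
proof -
  define S where "S = (\<Sum>K\<in>V. laplacian V a q K * v K)"
  have 1: "S = (\<Sum>K\<in>V. \<Sum>L\<in>V. a K L * (q K - q L) * v K)"
    by (simp add: S_def laplacian_def sum_distrib_right)
  have "S = (\<Sum>L\<in>V. \<Sum>K\<in>V. a K L * (q K - q L) * v K)" unfolding 1 by (rule sum.swap)
  also have "\<dots> = (\<Sum>K\<in>V. \<Sum>L\<in>V. - (a K L * (q K - q L) * v L))"
    by (intro sum.cong refl) (simp add: assms algebra_simps)
  finally have "S + S = (\<Sum>K\<in>V. \<Sum>L\<in>V. a K L * (q K - q L) * v K)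
      + (\<Sum>K\<in>V. \<Sum>L\<in>V. - (a K L * (q K - q L) * v L))" using 1 by simp
  also have "\<dots> = (\<Sum>K\<in>V. \<Sum>L\<in>V. a K L * (q K - q L) * (v K - v L))"
    unfolding sum.distrib[symmetric] by (intro sum.cong refl) (simp add: algebra_simps)
  finally show ?thesis by (simp add: S_def)
qed

lemma sum_laplacian:
  assumes "\<And>K L. K \<in> V \<Longrightarrow> L \<in> V \<Longrightarrow> a K L = a L K"
  shows "(\<Sum>K\<in>V. laplacian V a q K) = 0"
  using sum_laplacian_mult[of V a q "\<lambda>_. 1", OF assms] by simp

lemma tendsto_laplacian:
  assumes "\<And>L. L \<in> V \<Longrightarrow> (\<lambda>k. a k K L) \<longlonglongrightarrow> a' K L" "\<And>L. L \<in> V \<Longrightarrow> (\<lambda>k. q k L) \<longlonglongrightarrow> q' L" "K \<in> V"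
  shows "(\<lambda>k. laplacian V (a k) (q k) K) \<longlonglongrightarrow> laplacian V a' q' K"
  unfolding laplacian_def using assms by (intro tendsto_sum tendsto_mult tendsto_diff) auto

section \<open>The clamped logarithmic potential\<close>

definition clamp01 :: "real \<Rightarrow> real \<Rightarrow> real" where
  "clamp01 e s = max e (min (1 - e) s)"

lemma clamp01_bounds:
  assumes "0 < e" "e < 1/2"
  shows "0 < clamp01 e s" "clamp01 e s < 1" "e \<le> clamp01 e s" "clamp01 e s \<le> 1 - e"
  using assms by (auto simp: clamp01_def)

lemma tendsto_clamp01: "(f \<longlongrightarrow> l) F \<Longrightarrow> ((\<lambda>x. clamp01 e (f x)) \<longlongrightarrow> clamp01 e l) F"
  unfolding clamp01_def by (intro tendsto_max tendsto_min tendsto_const)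

lemma ln_ge_minus_one: "x \<ge> 1/2 \<Longrightarrow> ln x \<ge> - (1::real)"
proof -
  assume x: "x \<ge> 1/2"
  then have "ln (1 / x) \<le> 1 / x - 1" by (intro ln_le_minus_one) simp
  moreover have "1 / x \<le> 2" using x by (simp add: divide_simps)
  ultimately show ?thesis using x by (simp add: ln_div)
qed

text \<open>The product \<open>ln x (x - z)\<close> is bounded below by \<open>min x ln x\<close>, uniformly in the clamping
  parameter. The remaining factor \<open>s - x\<close> is negative below the clamping interval, where it only
  helps, and above it the logarithm is at least \<open>-1\<close>.\<close>

lemma log_test_lower_bound:
  assumes e: "0 < e" "e < 1/2" and z: "0 \<le> z" "z \<le> 1" and x: "x = clamp01 e s"
  shows "ln x * (s - z) \<ge> - \<bar>s - z\<bar> - 2"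
proof -
  have x01: "0 < x" "x < 1" using clamp01_bounds[OF e] x by auto
  have l0: "ln x \<le> 0" using x01 by simp
  have "x * ln x \<ge> - 1"
  proof -
    have "ln (1 / x) \<le> 1 / x - 1" using x01 by (intro ln_le_minus_one) simp
    then have "- ln x \<le> 1 / x - 1" using x01 by (simp add: ln_div)
    then have "x * (- ln x) \<le> x * (1 / x - 1)" using x01 by (intro mult_left_mono) auto
    then show ?thesis using x01 by (simp add: algebra_simps)
  qed
  moreover have "- z * ln x \<ge> 0" using z l0 by (simp add: mult_nonneg_nonpos)
  ultimately have 1: "ln x * (x - z) \<ge> - 1" by (simp add: algebra_simps)
  have 2: "ln x * (s - x) \<ge> - \<bar>s - x\<bar>"
  proof (cases "s \<le> x")
    case True
    then have "ln x * (s - x) \<ge> 0" using l0 by (simp add: mult_nonpos_nonpos)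
    then show ?thesis by linarith
  next
    case False
    then have "x \<ge> 1/2" using e by (auto simp: x clamp01_def)
    then have "ln x \<ge> - 1" by (rule ln_ge_minus_one)
    then have "(s - x) * ln x \<ge> (s - x) * (- 1)" using False by (intro mult_left_mono) auto
    then show ?thesis using False by (simp add: mult.commute)
  qed
  have "ln x * (s - z) = ln x * (x - z) + ln x * (s - x)" by (simp add: algebra_simps)
  moreover have "\<bar>s - x\<bar> \<le> \<bar>s - z\<bar> + 1" using x01 z by linarith
  ultimately show ?thesis using 1 2 by linarith
qed

text \<open>Outside the clamping interval the logarithms are frozen; the linear term replaces them there
  and makes the potential coercive on the whole line.\<close>

definition clamped_pot :: "real \<Rightarrow> real \<Rightarrow> real \<Rightarrow> real \<Rightarrow> real" where
  "clamped_pot \<beta>1 \<beta>2 e s = \<beta>1 * ln (clamp01 e s) - \<beta>2 * ln (1 - clamp01 e s) + (s - clamp01 e s)"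

lemma clamped_pot_coercive:
  assumes e: "0 < e" "e < 1/2" and z: "0 \<le> z" "z \<le> 1" and \<beta>: "\<beta>1 > 0" "\<beta>2 > 0" and b: "\<bar>b\<bar> \<le> B"
  shows "(b + clamped_pot \<beta>1 \<beta>2 e s) * (s - z) \<ge> (s - z)\<^sup>2 / 2 - ((1 + B + \<beta>1 + \<beta>2)\<^sup>2 / 2 + 2 * (\<beta>1
      + \<beta>2))"
proof -
  define x u where "x = clamp01 e s" and "u = s - z"
  have x01: "0 < x" "x < 1" using clamp01_bounds[OF e] x_def by auto
  have y: "1 - x = clamp01 e (1 - s)" using e by (auto simp: x_def clamp01_def max_def min_def)
  have "ln x * u \<ge> - \<bar>u\<bar> - 2" unfolding u_def by (rule log_test_lower_bound[OF e z x_def])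
  then have 1: "\<beta>1 * (ln x * u) \<ge> \<beta>1 * (- \<bar>u\<bar> - 2)" using \<beta> by (intro mult_left_mono) auto
  have "ln (1 - x) * ((1 - s) - (1 - z)) \<ge> - \<bar>(1 - s) - (1 - z)\<bar> - 2"
    by (rule log_test_lower_bound[OF e _ _ y]) (use z in auto)
  moreover have "(1 - s) - (1 - z) = - u" by (simp add: u_def)
  ultimately have "- ln (1 - x) * u \<ge> - \<bar>u\<bar> - 2" by simp
  then have 2: "\<beta>2 * (- ln (1 - x) * u) \<ge> \<beta>2 * (- \<bar>u\<bar> - 2)" using \<beta> by (intro mult_left_mono) auto
  have "\<bar>x - z\<bar> * \<bar>u\<bar> \<le> 1 * \<bar>u\<bar>"
    using x01 z by (intro mult_right_mono) auto
  then have "(x - z) * u \<le> \<bar>u\<bar>" using abs_ge_self[of "(x - z) * u"] by (simp add: abs_mult)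
  then have 3: "(s - x) * u \<ge> u\<^sup>2 - \<bar>u\<bar>" by (simp add: u_def power2_eq_square algebra_simps)
  have "\<bar>b\<bar> * \<bar>u\<bar> \<le> B * \<bar>u\<bar>" using b by (intro mult_right_mono) auto
  then have "- (b * u) \<le> B * \<bar>u\<bar>" using abs_ge_minus_self[of "b * u"] by (simp add: abs_mult)
  with 1 2 3 have "b * u + \<beta>1 * (ln x * u) + \<beta>2 * (- ln (1 - x) * u) + (s - x) * u
     \<ge> u\<^sup>2 - (1 + B + \<beta>1 + \<beta>2) * \<bar>u\<bar> - 2 * (\<beta>1 + \<beta>2)" by (simp add: algebra_simps)
  moreover have "(b + clamped_pot \<beta>1 \<beta>2 e s) * u = b * u + \<beta>1 * (ln x * u) + \<beta>2 * (- ln (1 - x) * u)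
      + (s - x) * u"
    by (simp add: clamped_pot_def x_def[symmetric] algebra_simps)
  moreover have "k * \<bar>u\<bar> \<le> u\<^sup>2 / 2 + k\<^sup>2 / 2" for k
    using zero_le_power2[of "\<bar>u\<bar> - k"] by (simp add: power2_diff mult.commute)
  from this[of "1 + B + \<beta>1 + \<beta>2"]
  have "(1 + B + \<beta>1 + \<beta>2) * \<bar>u\<bar> \<le> u\<^sup>2 / 2 + (1 + B + \<beta>1 + \<beta>2)\<^sup>2 / 2" .
  ultimately show ?thesis unfolding u_def[symmetric] by linarith
qed

section \<open>A regularised implicit step on a weighted graph\<close>

text \<open>The graph form of one step: \<open>V\<close>, \<open>m\<close> and \<open>w\<close> are cells, areas and transmissibilities, \<open>z\<close> is
  the old concentration of phase 1, \<open>b\<close> collects the explicit concave term and the difference of the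
  external potentials, and \<open>\<beta>\<^sub>i\<close> stands for \<open>\<theta>\<^sub>i \<eta>\<^sub>i\<close>. Phase 2 has concentration \<open>1 - c\<close>. The two
  mass conditions exclude that one phase is absent, in which case no strictly positive solution
  could exist.\<close>

locale implicit_step =
  fixes V :: "'v set" and m :: "'v \<Rightarrow> real" and w :: "'v \<Rightarrow> 'v \<Rightarrow> real"
    and z b :: "'v \<Rightarrow> real" and \<alpha> \<beta>1 \<beta>2 \<eta>1 \<eta>2 T :: real
  assumes finV: "finite V"
    and m_pos: "K \<in> V \<Longrightarrow> m K > 0"
    and w_nonneg: "K \<in> V \<Longrightarrow> L \<in> V \<Longrightarrow> w K L \<ge> 0"
    and w_sym: "K \<in> V \<Longrightarrow> L \<in> V \<Longrightarrow> w K L = w L K"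
    and w_conn: "S \<subseteq> V \<Longrightarrow> S \<noteq> {} \<Longrightarrow> S \<noteq> V \<Longrightarrow> \<exists>K\<in>S. \<exists>L\<in>V - S. w K L > 0"
    and z_bounds: "K \<in> V \<Longrightarrow> 0 \<le> z K \<and> z K \<le> 1"
    and mass1: "(\<Sum>K\<in>V. m K * z K) > 0"
    and mass2: "(\<Sum>K\<in>V. m K * (1 - z K)) > 0"
    and coeffs: "\<alpha> > 0" "\<beta>1 > 0" "\<beta>2 > 0" "\<eta>1 > 0" "\<eta>2 > 0" "T > 0"
begin

definition mob1 :: "real \<Rightarrow> ('v \<Rightarrow> real) \<Rightarrow> 'v \<Rightarrow> 'v \<Rightarrow> real" where
  "mob1 e c K L = w K L * (edge_conc (clamp01 e (c K)) (clamp01 e (c L)) / \<eta>1)"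

definition mob2 :: "real \<Rightarrow> ('v \<Rightarrow> real) \<Rightarrow> 'v \<Rightarrow> 'v \<Rightarrow> real" where
  "mob2 e c K L = w K L * (edge_conc (1 - clamp01 e (c K)) (1 - clamp01 e (c L)) / \<eta>2)"

definition pot_diff :: "real \<Rightarrow> ('v \<Rightarrow> real) \<Rightarrow> 'v \<Rightarrow> real" where
  "pot_diff e c K = \<alpha> / m K * laplacian V w c K + b K + clamped_pot \<beta>1 \<beta>2 e (c K)"

text \<open>The first two equations are the mass balances of the phases with clamped mobilities; the third
  is the relation between the potentials. The term with factor \<open>e\<close> fixes the constants up to which
  the Laplacians determine \<open>p1\<close> and \<open>p2\<close>.\<close>

definition reg_sol :: "real \<Rightarrow> ('v \<Rightarrow> real) \<Rightarrow> ('v \<Rightarrow> real) \<Rightarrow> ('v \<Rightarrow> real) \<Rightarrow> bool" where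
  "reg_sol e c p1 p2 \<longleftrightarrow> (\<forall>K\<in>V.
     m K * (c K - z K) + T * (laplacian V (mob1 e c) p1 K + e * m K * p1 K) = 0 \<and>
     - (m K * (c K - z K)) + T * (laplacian V (mob2 e c) p2 K + e * m K * p2 K) = 0 \<and>
     p1 K - p2 K = pot_diff e c K)"

lemma mob_sym:
  "K \<in> V \<Longrightarrow> L \<in> V \<Longrightarrow> mob1 e c K L = mob1 e c L K"
  "K \<in> V \<Longrightarrow> L \<in> V \<Longrightarrow> mob2 e c K L = mob2 e c L K"
  by (simp_all add: mob1_def mob2_def edge_conc_commute w_sym)

lemma mob_nonneg:
  assumes "0 < e" "e < 1/2" "K \<in> V" "L \<in> V"
  shows "mob1 e c K L \<ge> 0" "mob2 e c K L \<ge> 0"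
  using assms clamp01_bounds[OF assms(1,2)] coeffs w_nonneg
  by (auto simp: mob1_def mob2_def less_imp_le intro!: mult_nonneg_nonneg divide_nonneg_pos
      less_imp_le[OF edge_conc_pos])

definition dirichlet :: "('v \<Rightarrow> 'v \<Rightarrow> real) \<Rightarrow> ('v \<Rightarrow> real) \<Rightarrow> real" where
  "dirichlet a q = (\<Sum>K\<in>V. \<Sum>L\<in>V. a K L * (q K - q L)\<^sup>2) / 2"

lemma dirichlet_ge_edge:
  assumes "\<And>K L. K \<in> V \<Longrightarrow> L \<in> V \<Longrightarrow> a K L \<ge> 0" "K \<in> V" "L \<in> V"
  shows "a K L * (q K - q L)\<^sup>2 \<le> 2 * dirichlet a q"
proof -
  have "a K L * (q K - q L)\<^sup>2 \<le> (\<Sum>L\<in>V. a K L * (q K - q L)\<^sup>2)"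
    using assms finV by (intro member_le_sum) auto
  also have "\<dots> \<le> (\<Sum>K\<in>V. \<Sum>L\<in>V. a K L * (q K - q L)\<^sup>2)"
    using assms finV by (intro member_le_sum[of K V "\<lambda>K. \<Sum>L\<in>V. a K L * (q K - q L)\<^sup>2"]) (auto
        intro!: sum_nonneg)
  finally show ?thesis by (simp add: dirichlet_def)
qed

lemma dirichlet_nonneg:
  assumes "\<And>K L. K \<in> V \<Longrightarrow> L \<in> V \<Longrightarrow> a K L \<ge> 0"
  shows "dirichlet a q \<ge> 0"
  unfolding dirichlet_def using assms by (auto intro!: sum_nonneg)

lemma sum_laplacian_self:
  assumes "\<And>K L. K \<in> V \<Longrightarrow> L \<in> V \<Longrightarrow> a K L = a L K"
  shows "(\<Sum>K\<in>V. laplacian V a q K * q K) = dirichlet a q"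
  using sum_laplacian_mult[of V a q q, OF assms] by (simp add: dirichlet_def power2_eq_square mult.assoc)

text \<open>Testing the potential relation with the increment: the quadratic part of the energy and the
  potential of each cell are bounded below independently of the clamping parameter.\<close>

lemma potential_coercive:
  "\<exists>C\<ge>0. \<forall>e c. 0 < e \<longrightarrow> e < 1/2 \<longrightarrow>
     (\<Sum>K\<in>V. m K * pot_diff e c K * (c K - z K)) \<ge> (\<Sum>K\<in>V. m K * (c K - z K)\<^sup>2) / 2 - C"
proof -
  define B where "B = (\<Sum>K\<in>V. \<bar>b K\<bar>)"
  have bB: "\<bar>b K\<bar> \<le> B" if "K \<in> V" for K
    unfolding B_def using that finV by (intro member_le_sum) auto
  have B0: "B \<ge> 0" unfolding B_def by (simp add: sum_nonneg)
  define C0 where "C0 = (1 + B + \<beta>1 + \<beta>2)\<^sup>2 / 2 + 2 * (\<beta>1 + \<beta>2)"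
  have C00: "C0 \<ge> 0" using coeffs by (simp add: C0_def)
  define C where "C = \<alpha> * dirichlet w z / 4 + (\<Sum>K\<in>V. m K * C0)"
  have "C \<ge> 0" unfolding C_def
    using coeffs C00 m_pos dirichlet_nonneg[of w z] w_nonneg
    by (intro add_nonneg_nonneg sum_nonneg) (auto simp: less_imp_le)
  moreover have "(\<Sum>K\<in>V. m K * pot_diff e c K * (c K - z K)) \<ge> (\<Sum>K\<in>V. m K * (c K - z K)\<^sup>2) / 2 - C"
    if e: "0 < e" "e < 1/2" for e c
  proof -
    have l: "(\<Sum>K\<in>V. laplacian V w c K * (c K - z K)) \<ge> - (dirichlet w z / 4)"
    proof -
      have "- ((z K - z L)\<^sup>2 / 4) \<le> (c K - c L) * ((c K - z K) - (c L - z L))" for K L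
        using zero_le_power2[of "(c K - c L) - (z K - z L) / 2"]
        by (simp add: power2_eq_square algebra_simps)
      then have "w K L * (- ((z K - z L)\<^sup>2 / 4)) \<le> w K L * ((c K - c L) * ((c K - z K) - (c L - z L)))"
        if "K \<in> V" "L \<in> V" for K L using w_nonneg[OF that] by (intro mult_left_mono) auto
      then have "(\<Sum>K\<in>V. \<Sum>L\<in>V. w K L * (- ((z K - z L)\<^sup>2 / 4)))
          \<le> (\<Sum>K\<in>V. \<Sum>L\<in>V. w K L * (c K - c L) * ((c K - z K) - (c L - z L)))"
        by (intro sum_mono) (auto simp: mult.assoc)
      moreover have "(\<Sum>K\<in>V. \<Sum>L\<in>V. w K L * (- ((z K - z L)\<^sup>2 / 4))) / 2 = - (dirichlet w z / 4)"
        by (simp add: dirichlet_def sum_negf sum_divide_distrib[symmetric])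
      ultimately show ?thesis
        using sum_laplacian_mult[of V w c "\<lambda>K. c K - z K", OF w_sym] by simp
    qed
    have s: "(\<Sum>K\<in>V. m K * ((b K + clamped_pot \<beta>1 \<beta>2 e (c K)) * (c K - z K)))
        \<ge> (\<Sum>K\<in>V. m K * ((c K - z K)\<^sup>2 / 2 - C0))"
      unfolding C0_def using z_bounds bB coeffs m_pos
      by (intro sum_mono mult_left_mono clamped_pot_coercive[OF e]) (auto simp: less_imp_le)
    have "(\<Sum>K\<in>V. m K * pot_diff e c K * (c K - z K)) = (\<Sum>K\<in>V. \<alpha> * (laplacian V w c K * (c K - z K))
        + m K * ((b K + clamped_pot \<beta>1 \<beta>2 e (c K)) * (c K - z K)))"
    proof (intro sum.cong refl)
      fix K assume "K \<in> V"
      then have "m K \<noteq> 0" using m_pos[of K] by simp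
      then show "m K * pot_diff e c K * (c K - z K) = \<alpha> * (laplacian V w c K * (c K - z K))
        + m K * ((b K + clamped_pot \<beta>1 \<beta>2 e (c K)) * (c K - z K))"
        by (simp add: pot_diff_def field_simps)
    qed
    also have "\<dots> = \<alpha> * (\<Sum>K\<in>V. laplacian V w c K * (c K - z K))
        + (\<Sum>K\<in>V. m K * ((b K + clamped_pot \<beta>1 \<beta>2 e (c K)) * (c K - z K)))"
      by (simp add: sum.distrib sum_distrib_left)
    also have "\<dots> \<ge> \<alpha> * (- (dirichlet w z / 4)) + (\<Sum>K\<in>V. m K * ((c K - z K)\<^sup>2 / 2 - C0))"
      using s l coeffs by (intro add_mono mult_left_mono) auto
    also have "\<alpha> * (- (dirichlet w z / 4)) + (\<Sum>K\<in>V. m K * ((c K - z K)\<^sup>2 / 2 - C0))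
        = (\<Sum>K\<in>V. m K * (c K - z K)\<^sup>2) / 2 - C"
      by (simp add: C_def right_diff_distrib sum_subtractf sum_divide_distrib)
    finally show ?thesis .
  qed
  ultimately show ?thesis by blast
qed

lemma tendsto_pot_diff:
  assumes "0 < e" "e < 1/2" "\<And>L. L \<in> V \<Longrightarrow> (\<lambda>k. c k L) \<longlonglongrightarrow> c' L" "K \<in> V"
  shows "(\<lambda>k. pot_diff e (c k) K) \<longlonglongrightarrow> pot_diff e c' K"
  unfolding pot_diff_def clamped_pot_def
  using assms(3)[OF assms(4)] clamp01_bounds[OF assms(1,2), of "c' K"]
  by (intro tendsto_intros tendsto_laplacian tendsto_clamp01 assms) auto

lemma tendsto_mob:
  assumes "0 < e" "e < 1/2" "\<And>L. L \<in> V \<Longrightarrow> (\<lambda>k. c k L) \<longlonglongrightarrow> c' L" "K \<in> V" "L \<in> V"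
  shows "(\<lambda>k. mob1 e (c k) K L) \<longlonglongrightarrow> mob1 e c' K L" "(\<lambda>k. mob2 e (c k) K L) \<longlonglongrightarrow> mob2 e c' K L"
  unfolding mob1_def mob2_def
  using clamp01_bounds[OF assms(1,2)] coeffs
  by (intro tendsto_intros tendsto_edge_conc tendsto_clamp01 assms; simp)+

text \<open>With the increment \<open>c - z\<close> as unknown, the coupling terms cancel in the scalar product of
  the field with its argument. What remains is coercive in all components, the potentials being
  controlled by the terms with factor \<open>e\<close>, so the field points outwards on a large cube.\<close>

lemma reg_sol_exists:
  assumes e: "0 < e" "e < 1/2"
  obtains c p1 p2 where "reg_sol e c p1 p2"
proof -
  define I where "I = V \<times> {0, 1, 2::nat}"
  define cc where "cc x K = z K + x (K, 0::nat)" for x :: "'v \<times> nat \<Rightarrow> real" and K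
  \<comment> \<open>Component 0 is the increment, components 1 and 2 are the two potentials.\<close>
  define F where "F x i = (case i of (K, j) \<Rightarrow>
     if j = 0 then m K * (pot_diff e (cc x) K - (x (K, 1) - x (K, 2)))
     else if j = 1 then m K * x (K, 0) + T * (laplacian V (mob1 e (cc x)) (\<lambda>L. x (L, 1)) K
         + e * m K * x (K, 1))
     else - (m K * x (K, 0)) + T * (laplacian V (mob2 e (cc x)) (\<lambda>L. x (L, 2)) K + e * m K * x (K, 2)))"
    for x and i :: "'v \<times> nat"
  have finI: "finite I" using finV by (simp add: I_def)
  have cont: "coord_continuous I F"
    unfolding coord_continuous_def
  proof (intro allI impI ballI)
    fix X :: "nat \<Rightarrow> 'v \<times> nat \<Rightarrow> real" and x and i :: "'v \<times> nat"
    assume "\<forall>i\<in>I. (\<lambda>k. X k i) \<longlonglongrightarrow> x i" and i: "i \<in> I"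
    then have X: "(\<lambda>k. X k (K, 0)) \<longlonglongrightarrow> x (K, 0)" "(\<lambda>k. X k (K, 1)) \<longlonglongrightarrow> x (K, 1)" "(\<lambda>k. X k (K, 2))
        \<longlonglongrightarrow> x (K, 2)"
      if "K \<in> V" for K using that by (auto simp: I_def)
    have c: "(\<lambda>k. cc (X k) K) \<longlonglongrightarrow> cc x K" if "K \<in> V" for K
      unfolding cc_def by (intro tendsto_intros X that)
    obtain K j where ij: "i = (K, j)" and K: "K \<in> V" and j: "j \<in> {0,1,2}" using i by (auto simp: I_def)
    have "(\<lambda>k. F (X k) (K, 0)) \<longlonglongrightarrow> F x (K, 0)"
      using tendsto_mult[OF tendsto_const[of "m K"]
          tendsto_diff[OF tendsto_pot_diff[OF e c K] tendsto_diff[OF X(2,3)[OF K]]]]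
      by (simp add: F_def)
    moreover have "(\<lambda>k. F (X k) (K, 1)) \<longlonglongrightarrow> F x (K, 1)"
      using tendsto_add[OF tendsto_mult[OF tendsto_const[of "m K"] X(1)[OF K]]
          tendsto_mult[OF tendsto_const[of T] tendsto_add[OF
            tendsto_laplacian[of V "\<lambda>k. mob1 e (cc (X k))" K "mob1 e (cc x)" "\<lambda>k L. X k (L, 1)" "\<lambda>L.
                x (L, 1)", OF tendsto_mob(1)[OF e c K] X(2) K]
            tendsto_mult[OF tendsto_const[of "e * m K"] X(2)[OF K]]]]]
      by (simp add: F_def)
    moreover have "(\<lambda>k. F (X k) (K, 2)) \<longlonglongrightarrow> F x (K, 2)"
      using tendsto_add[OF tendsto_minus[OF tendsto_mult[OF tendsto_const[of "m K"] X(1)[OF K]]]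
          tendsto_mult[OF tendsto_const[of T] tendsto_add[OF
            tendsto_laplacian[of V "\<lambda>k. mob2 e (cc (X k))" K "mob2 e (cc x)" "\<lambda>k L. X k (L, 2)" "\<lambda>L.
                x (L, 2)", OF tendsto_mob(2)[OF e c K] X(3) K]
            tendsto_mult[OF tendsto_const[of "e * m K"] X(3)[OF K]]]]]
      by (simp add: F_def)
    ultimately show "(\<lambda>k. F (X k) i) \<longlonglongrightarrow> F x i" using j by (auto simp: ij)
  qed
  from potential_coercive obtain C where C: "C \<ge> 0"
    and pot: "\<And>c. (\<Sum>K\<in>V. m K * pot_diff e c K * (c K - z K)) \<ge> (\<Sum>K\<in>V. m K * (c K - z K)\<^sup>2) / 2 - C"
    using e by blast
  have key: "(\<Sum>i\<in>I. F x i * x i) \<ge> (\<Sum>K\<in>V. m K * (x (K, 0))\<^sup>2) / 2 - C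
      + T * e * (\<Sum>K\<in>V. m K * (x (K, 1))\<^sup>2) + T * e * (\<Sum>K\<in>V. m K * (x (K, 2))\<^sup>2)" for x
  proof -
    have "(\<Sum>i\<in>I. F x i * x i) = (\<Sum>K\<in>V. F x (K, 0) * x (K, 0) + F x (K, 1) * x (K, 1)
        + F x (K, 2) * x (K, 2))"
    proof -
      have "(\<Sum>i\<in>I. F x i * x i) = (\<Sum>K\<in>V. \<Sum>j\<in>{0, 1, 2}. F x (K, j) * x (K, j))"
        unfolding I_def by (subst sum.Sigma) (auto simp: finV split_def)
      then show ?thesis by (simp add: add.assoc)
    qed
    also have "\<dots> = (\<Sum>K\<in>V. m K * pot_diff e (cc x) K * (cc x K - z K)
        + T * (laplacian V (mob1 e (cc x)) (\<lambda>L. x (L, 1)) K * x (K, 1))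
            + T * (laplacian V (mob2 e (cc x)) (\<lambda>L. x (L, 2)) K * x (K, 2))
        + T * e * (m K * (x (K, 1))\<^sup>2) + T * e * (m K * (x (K, 2))\<^sup>2))"
      by (intro sum.cong refl) (simp add: F_def cc_def power2_eq_square algebra_simps)
    also have "\<dots> = (\<Sum>K\<in>V. m K * pot_diff e (cc x) K * (cc x K - z K))
        + T * dirichlet (mob1 e (cc x)) (\<lambda>L. x (L, 1)) + T * dirichlet (mob2 e (cc x)) (\<lambda>L. x (L, 2))
        + T * e * (\<Sum>K\<in>V. m K * (x (K, 1))\<^sup>2) + T * e * (\<Sum>K\<in>V. m K * (x (K, 2))\<^sup>2)"
      by (simp add: sum.distrib sum_distrib_left[symmetric] sum_laplacian_self mob_sym)
    finally show ?thesis
      using pot[of "cc x"] coeffs mob_nonneg[OF e]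
        mult_nonneg_nonneg[OF less_imp_le[OF coeffs(6)] dirichlet_nonneg[of "mob1 e (cc x)" "\<lambda>L. x
            (L, 1)"]]
        mult_nonneg_nonneg[OF less_imp_le[OF coeffs(6)] dirichlet_nonneg[of "mob2 e (cc x)" "\<lambda>L. x
            (L, 2)"]]
      by (simp add: cc_def)
  qed
  have Vne: "V \<noteq> {}" using mass1 by auto
  define m0 where "m0 = Min (m ` V)"
  have m0: "m0 > 0" "\<And>K. K \<in> V \<Longrightarrow> m0 \<le> m K"
    using Vne finV m_pos by (auto simp: m0_def)
  \<comment> \<open>A lower bound for the coefficients of the squared unknowns in \<open>key\<close>.\<close>
  define k where "k = m0 * min (1/2) (T * e)"
  have k: "k > 0" using m0 e coeffs by (simp add: k_def)
  define R where "R = sqrt ((C + 1) / k)"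
  have R: "R > 0" using C k by (simp add: R_def)
  have "(\<Sum>i\<in>I. F x i * x i) > 0" if i: "i \<in> I" and xR: "\<bar>x i\<bar> = R" for x i
  proof -
    obtain K j where ij: "i = (K, j)" and K: "K \<in> V" and j: "j \<in> {0,1,2}" using i by (auto simp: I_def)
    have "(x i)\<^sup>2 = (C + 1) / k" using C k unfolding power2_abs[of "x i", symmetric] xR
        by (simp add: R_def)
    then have C1: "k * (x i)\<^sup>2 = C + 1" using k by simp
    have mem: "m0 * (x (K, j))\<^sup>2 \<le> (\<Sum>K\<in>V. m K * (x (K, j))\<^sup>2)" for j
    proof -
      have "m0 * (x (K, j))\<^sup>2 \<le> m K * (x (K, j))\<^sup>2" using m0 K by (intro mult_right_mono) auto
      also have "\<dots> \<le> (\<Sum>K\<in>V. m K * (x (K, j))\<^sup>2)"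
        using K finV m_pos by (intro member_le_sum) (auto simp: less_imp_le)
      finally show ?thesis .
    qed
    have nn: "(\<Sum>K\<in>V. m K * (x (K, j))\<^sup>2) \<ge> 0" for j
      using m_pos by (intro sum_nonneg mult_nonneg_nonneg) (auto simp: less_imp_le)
    have Te: "T * e > 0" using e coeffs by simp
    have k1: "k * s \<le> m0 * s / 2" "k * s \<le> T * e * (m0 * s)" if "s \<ge> 0" for s
    proof -
      have "m0 * s * min (1/2) (T * e) \<le> m0 * s * (1/2)" "m0 * s * min (1/2) (T * e) \<le> m0 * s * (T * e)"
        using m0 that by (intro mult_left_mono; simp)+
      then show "k * s \<le> m0 * s / 2" "k * s \<le> T * e * (m0 * s)" by (simp_all add: k_def mult_ac)
    qed
    define S where "S j = (\<Sum>K\<in>V. m K * (x (K, j))\<^sup>2)" for j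
    have S: "S j \<ge> 0" "T * e * S j \<ge> 0" for j using nn[of j] Te by (auto simp: S_def)
    have memS: "m0 * (x i)\<^sup>2 \<le> S j" using mem[of j] by (simp add: S_def ij)
    have k0: "C + 1 \<le> S j / 2" using C1 k1(1)[of "(x i)\<^sup>2"] memS by simp
    have "k * (x i)\<^sup>2 \<le> T * e * (m0 * (x i)\<^sup>2)" by (rule k1) simp
    also have "\<dots> \<le> T * e * S j" using memS Te by (intro mult_left_mono) auto
    finally have k2: "C + 1 \<le> T * e * S j" using C1 by simp
    have "C + 1 \<le> S 0 / 2 \<or> C + 1 \<le> T * e * S 1 \<or> C + 1 \<le> T * e * S 2"
      using j k0 k2 by auto
    then have "C + 1 \<le> S 0 / 2 + T * e * S 1 + T * e * S 2"
      using S(1)[of 0] S(2)[of 1] S(2)[of 2] by linarith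
    then show ?thesis using key[of x] unfolding S_def by linarith
  qed
  then obtain x where x: "\<And>i. i \<in> I \<Longrightarrow> F x i = 0"
    by (rule_tac zero_of_outward_field[OF finI R cont]) auto
  have "reg_sol e (cc x) (\<lambda>K. x (K, 1)) (\<lambda>K. x (K, 2))"
    unfolding reg_sol_def
  proof (intro ballI conjI)
    fix K assume K: "K \<in> V"
    have c: "cc x K - z K = x (K, 0)" by (simp add: cc_def)
    have "F x (K, 0) = 0" "F x (K, 1) = 0" "F x (K, 2) = 0" using x K by (auto simp: I_def)
    then show "m K * (cc x K - z K) + T * (laplacian V (mob1 e (cc x)) (\<lambda>K. x (K, 1)) K
        + e * m K * x (K, 1)) = 0"
      "- (m K * (cc x K - z K)) + T * (laplacian V (mob2 e (cc x)) (\<lambda>K. x (K, 2)) K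
          + e * m K * x (K, 2)) = 0"
      "x (K, 1) - x (K, 2) = pot_diff e (cc x) K"
      using m_pos[OF K] unfolding c by (auto simp: F_def)
  qed
  then show ?thesis by (rule that)
qed

end

section \<open>Uniform estimates\<close>

lemma abs_le_one_plus_square: "\<bar>t\<bar> \<le> 1 + t\<^sup>2" for t :: real
  using zero_le_power2[of "\<bar>t\<bar> - 1"] zero_le_power2[of t] unfolding power2_diff by simp

text \<open>Young's inequality: a jump of the order of \<open>sqrt X\<close> is absorbed by half of a linear term
  \<open>k X\<close>.\<close>

lemma abs_le_of_square_le_mult:
  fixes t A X k :: real
  assumes "t\<^sup>2 \<le> A * X" "k > 0" "X \<ge> 0" "A \<ge> 0"
  shows "\<bar>t\<bar> \<le> k * X / 2 + A / (2 * k)"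
proof -
  have eq: "(k * X / 2 + A / (2 * k))\<^sup>2 - (k * X / 2 - A / (2 * k))\<^sup>2 = A * X"
    using assms by (simp add: power2_eq_square field_simps)
  then have "t\<^sup>2 \<le> (k * X / 2 + A / (2 * k))\<^sup>2"
    using assms(1) zero_le_power2[of "k * X / 2 - A / (2 * k)"] by linarith
  then have "\<bar>t\<bar> \<le> \<bar>k * X / 2 + A / (2 * k)\<bar>" by (simp add: abs_le_square_iff)
  moreover have "k * X / 2 + A / (2 * k) \<ge> 0" using assms by simp
  ultimately show ?thesis by simp
qed

context implicit_step
begin

text \<open>The same test as in the existence proof, now at a zero of the field; the constant does not
  depend on the regularisation.\<close>

lemma reg_sol_apriori:
  "\<exists>C\<ge>0. \<forall>e c p1 p2. 0 < e \<longrightarrow> e < 1/2 \<longrightarrow> reg_sol e c p1 p2 \<longrightarrow>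
     (\<Sum>K\<in>V. m K * (c K - z K)\<^sup>2) \<le> C \<and>
     dirichlet (mob1 e c) p1 \<le> C \<and> dirichlet (mob2 e c) p2 \<le> C \<and>
     e * (\<Sum>K\<in>V. m K * (p1 K)\<^sup>2) \<le> C"
proof -
  from potential_coercive obtain C where C: "C \<ge> 0"
    and pot: "\<And>e c. 0 < e \<Longrightarrow> e < 1/2 \<Longrightarrow>
      (\<Sum>K\<in>V. m K * pot_diff e c K * (c K - z K)) \<ge> (\<Sum>K\<in>V. m K * (c K - z K)\<^sup>2) / 2 - C"
    by blast
  have "(\<Sum>K\<in>V. m K * (c K - z K)\<^sup>2) \<le> 2 * C + C / T \<and>
     dirichlet (mob1 e c) p1 \<le> 2 * C + C / T \<and> dirichlet (mob2 e c) p2 \<le> 2 * C + C / T \<and>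
     e * (\<Sum>K\<in>V. m K * (p1 K)\<^sup>2) \<le> 2 * C + C / T"
    if e: "0 < e" "e < 1/2" and sol: "reg_sol e c p1 p2" for e c p1 p2
  proof -
    define S1 S2 where "S1 = (\<Sum>K\<in>V. m K * (p1 K)\<^sup>2)" and "S2 = (\<Sum>K\<in>V. m K * (p2 K)\<^sup>2)"
    have S: "S1 \<ge> 0" "S2 \<ge> 0" "(\<Sum>K\<in>V. m K * (c K - z K)\<^sup>2) \<ge> 0"
      unfolding S1_def S2_def using m_pos by (auto intro!: sum_nonneg mult_nonneg_nonneg simp:
          less_imp_le)
    have "0 = (\<Sum>K\<in>V. (m K * (c K - z K) + T * (laplacian V (mob1 e c) p1 K + e * m K * p1 K)) * p1 K
        + (- (m K * (c K - z K)) + T * (laplacian V (mob2 e c) p2 K + e * m K * p2 K)) * p2 K)"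
      using sol by (simp add: reg_sol_def)
    also have "\<dots> = (\<Sum>K\<in>V. m K * (p1 K - p2 K) * (c K - z K)
        + T * (laplacian V (mob1 e c) p1 K * p1 K) + T * (laplacian V (mob2 e c) p2 K * p2 K)
        + T * (e * (m K * (p1 K)\<^sup>2)) + T * (e * (m K * (p2 K)\<^sup>2)))"
      by (intro sum.cong refl) (simp add: power2_eq_square algebra_simps)
    also have "\<dots> = (\<Sum>K\<in>V. m K * (p1 K - p2 K) * (c K - z K))
        + T * dirichlet (mob1 e c) p1 + T * dirichlet (mob2 e c) p2 + T * (e * S1) + T * (e * S2)"
      by (simp add: sum.distrib sum_distrib_left[symmetric] sum_laplacian_self mob_sym S1_def S2_def)
    also have "(\<Sum>K\<in>V. m K * (p1 K - p2 K) * (c K - z K)) = (\<Sum>K\<in>V. m K * pot_diff e c K * (c K - z K))"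
      using sol by (intro sum.cong refl) (simp add: reg_sol_def)
    finally have eq: "(\<Sum>K\<in>V. m K * pot_diff e c K * (c K - z K))
        + T * (dirichlet (mob1 e c) p1 + dirichlet (mob2 e c) p2 + e * S1 + e * S2) = 0"
      by (simp add: distrib_left)
    have D: "dirichlet (mob1 e c) p1 \<ge> 0" "dirichlet (mob2 e c) p2 \<ge> 0"
      using mob_nonneg[OF e] by (auto intro!: dirichlet_nonneg)
    have eS: "e * S1 \<ge> 0" "e * S2 \<ge> 0" using S e by auto
    have CT: "C / T \<ge> 0" using C coeffs by simp
    have "T * (dirichlet (mob1 e c) p1 + dirichlet (mob2 e c) p2 + e * S1 + e * S2) \<le> C"
      using eq pot[OF e, of c] S(3) by linarith
    then have "dirichlet (mob1 e c) p1 + dirichlet (mob2 e c) p2 + e * S1 + e * S2 \<le> C / T"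
      using coeffs by (simp add: pos_le_divide_eq mult.commute)
    moreover have "T * (dirichlet (mob1 e c) p1 + dirichlet (mob2 e c) p2 + e * S1 + e * S2) \<ge> 0"
      using D eS coeffs by (intro mult_nonneg_nonneg) auto
    then have "(\<Sum>K\<in>V. m K * (c K - z K)\<^sup>2) \<le> 2 * C"
      using eq pot[OF e, of c] by linarith
    ultimately show ?thesis unfolding S1_def[symmetric] using D eS CT C by linarith
  qed
  moreover have "2 * C + C / T \<ge> 0" using C coeffs by simp
  ultimately show ?thesis by blast
qed

lemma reg_sol_bounded:
  "\<exists>B\<ge>0. \<forall>e c p1 p2. 0 < e \<longrightarrow> e < 1/2 \<longrightarrow> reg_sol e c p1 p2 \<longrightarrow> (\<forall>K\<in>V. \<bar>c K\<bar> \<le> B)"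
proof -
  obtain C where C: "C \<ge> 0" and ap: "\<And>e c p1 p2. 0 < e \<Longrightarrow> e < 1/2 \<Longrightarrow> reg_sol e c p1 p2 \<Longrightarrow>
     (\<Sum>K\<in>V. m K * (c K - z K)\<^sup>2) \<le> C" using reg_sol_apriori by blast
  define B where "B = (\<Sum>K\<in>V. 2 + C / m K)"
  have nn: "2 + C / m K \<ge> 0" if "K \<in> V" for K using m_pos[OF that] C by simp
  have "\<bar>c K\<bar> \<le> B" if e: "0 < e" "e < 1/2" "reg_sol e c p1 p2" and K: "K \<in> V" for e c p1 p2 K
  proof -
    have "m K * (c K - z K)\<^sup>2 \<le> (\<Sum>K\<in>V. m K * (c K - z K)\<^sup>2)"
      using K finV m_pos by (intro member_le_sum) (auto simp: less_imp_le)
    with ap[OF e] have "(c K - z K)\<^sup>2 \<le> C / m K"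
      using m_pos[OF K] by (simp add: pos_le_divide_eq mult.commute)
    moreover have "\<bar>c K - z K\<bar> \<le> 1 + (c K - z K)\<^sup>2" by (rule abs_le_one_plus_square)
    ultimately have "\<bar>c K\<bar> \<le> 2 + C / m K" using z_bounds[OF K] by linarith
    also have "\<dots> \<le> B" unfolding B_def
      using nn K finV by (intro member_le_sum[of K V "\<lambda>K. 2 + C / m K"]) auto
    finally show ?thesis .
  qed
  moreover have "B \<ge> 0" unfolding B_def using nn by (rule sum_nonneg)
  ultimately show ?thesis by blast
qed

text \<open>Let \<open>X\<close> and \<open>Y\<close> be the absolute values of the logarithms of the first concentration at \<open>K\<close> and
  of the second one at \<open>L\<close>. Because of the gap, the mobilities are at least of order \<open>1 / X\<close> and
  \<open>1 / Y\<close>, so the dissipation bound gives jumps of \<open>p1\<close> and \<open>p2\<close> of order \<open>sqrt X\<close> and \<open>sqrt Y\<close>.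
  Their difference is the jump of the potential relation, which is \<open>\<beta>1 X + \<beta>2 Y\<close> up to a bounded
  error, since the other two logarithms are bounded by the gap.\<close>

lemma gap_controls_logs:
  assumes KL: "K \<in> V" "L \<in> V" "w K L > 0" and d: "d > 0"
  shows "\<exists>C. \<forall>e c p1 p2. 0 < e \<longrightarrow> e < 1/2 \<longrightarrow> reg_sol e c p1 p2 \<longrightarrow>
     clamp01 e (c K) + d \<le> clamp01 e (c L) \<longrightarrow>
     - ln (clamp01 e (c K)) \<le> C \<and> - ln (1 - clamp01 e (c L)) \<le> C"
proof -
  obtain C where C: "C \<ge> 0" and ap: "\<And>e c p1 p2. 0 < e \<Longrightarrow> e < 1/2 \<Longrightarrow> reg_sol e c p1 p2 \<Longrightarrow>
     dirichlet (mob1 e c) p1 \<le> C \<and> dirichlet (mob2 e c) p2 \<le> C" using reg_sol_apriori by blast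
  obtain B where B: "B \<ge> 0" and bd: "\<And>e c p1 p2 K. 0 < e \<Longrightarrow> e < 1/2 \<Longrightarrow> reg_sol e c p1 p2 \<Longrightarrow> K \<in> V \<Longrightarrow>
     \<bar>c K\<bar> \<le> B" using reg_sol_bounded by blast
  define A1 A2 where "A1 = 2 * C * \<eta>1 / (w K L * d)" and "A2 = 2 * C * \<eta>2 / (w K L * d)"
  have A: "A1 \<ge> 0" "A2 \<ge> 0" using C coeffs KL d by (auto simp: A1_def A2_def)
  \<comment> \<open>A bound for the part of the potential difference without logarithms.\<close>
  define lb where "lb K = \<alpha> / m K * (\<Sum>L\<in>V. w K L * (2 * B)) + \<bar>b K\<bar> + B + 1" for K
  define D where "D = lb K + lb L + (\<beta>1 + \<beta>2) * (- ln d)"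
  define R where "R = 2 * D + A1 / \<beta>1 + A2 / \<beta>2"
  have "- ln (clamp01 e (c K)) \<le> R / \<beta>1 + R / \<beta>2 \<and> - ln (1 - clamp01 e (c L)) \<le> R / \<beta>1 + R / \<beta>2"
    if e: "0 < e" "e < 1/2" and sol: "reg_sol e c p1 p2" and gap: "clamp01 e (c K) + d \<le> clamp01 e (c L)"
    for e c p1 p2
  proof -
    define x y where "x = clamp01 e (c K)" and "y = clamp01 e (c L)"
    have xy: "0 < x" "x < 1" "0 < y" "y < 1" "x + d \<le> y"
      using clamp01_bounds[OF e] gap by (auto simp: x_def y_def)
    define X Y where "X = - ln x" and "Y = - ln (1 - y)"
    have XY: "X > 0" "Y > 0" using xy by (auto simp: X_def Y_def)
    have "edge_conc x y \<ge> d / X" unfolding X_def using xy d by (intro edge_conc_ge_of_gap) auto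
    then have "w K L * (d / X / \<eta>1) \<le> mob1 e c K L"
      unfolding mob1_def x_def[symmetric] y_def[symmetric] using KL coeffs
      by (intro mult_left_mono divide_right_mono) auto
    then have "w K L * (d / X / \<eta>1) * (p1 K - p1 L)\<^sup>2 \<le> mob1 e c K L * (p1 K - p1 L)\<^sup>2"
      by (intro mult_right_mono) auto
    also have "\<dots> \<le> 2 * dirichlet (mob1 e c) p1"
      using mob_nonneg[OF e] KL by (intro dirichlet_ge_edge) auto
    also have "\<dots> \<le> 2 * C" using ap[OF e sol] by simp
    finally have p1: "(p1 K - p1 L)\<^sup>2 \<le> A1 * X"
      using KL d XY coeffs by (simp add: A1_def field_simps)
    have "edge_conc (1 - y) (1 - x) \<ge> d / Y" unfolding Y_def using xy d
        by (intro edge_conc_ge_of_gap) auto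
    then have "w K L * (d / Y / \<eta>2) \<le> mob2 e c K L"
      unfolding mob2_def x_def[symmetric] y_def[symmetric] using KL coeffs
      by (intro mult_left_mono divide_right_mono) (auto simp: edge_conc_commute)
    then have "w K L * (d / Y / \<eta>2) * (p2 K - p2 L)\<^sup>2 \<le> mob2 e c K L * (p2 K - p2 L)\<^sup>2"
      by (intro mult_right_mono) auto
    also have "\<dots> \<le> 2 * dirichlet (mob2 e c) p2"
      using mob_nonneg[OF e] KL by (intro dirichlet_ge_edge) auto
    also have "\<dots> \<le> 2 * C" using ap[OF e sol] by simp
    finally have p2: "(p2 K - p2 L)\<^sup>2 \<le> A2 * Y"
      using KL d XY coeffs by (simp add: A2_def field_simps)
    have t1: "\<bar>p1 K - p1 L\<bar> \<le> \<beta>1 * X / 2 + A1 / (2 * \<beta>1)"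
      using p1 XY A coeffs by (intro abs_le_of_square_le_mult) auto
    have t2: "\<bar>p2 K - p2 L\<bar> \<le> \<beta>2 * Y / 2 + A2 / (2 * \<beta>2)"
      using p2 XY A coeffs by (intro abs_le_of_square_le_mult) auto
    have low: "\<bar>\<alpha> / m J * laplacian V w c J + b J + (c J - clamp01 e (c J))\<bar> \<le> lb J" if J: "J \<in> V" for J
    proof -
      have "\<bar>laplacian V w c J\<bar> \<le> (\<Sum>L\<in>V. \<bar>w J L * (c J - c L)\<bar>)" unfolding laplacian_def
          by (rule sum_abs)
      also have "\<dots> \<le> (\<Sum>L\<in>V. w J L * (2 * B))"
      proof (rule sum_mono)
        fix I assume I: "I \<in> V"
        have "\<bar>c J - c I\<bar> \<le> 2 * B" using bd[OF e sol J] bd[OF e sol I] by linarith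
        then show "\<bar>w J I * (c J - c I)\<bar> \<le> w J I * (2 * B)"
          using w_nonneg[OF J I] by (simp add: abs_mult mult_left_mono)
      qed
      finally have "\<alpha> / m J * \<bar>laplacian V w c J\<bar> \<le> \<alpha> / m J * (\<Sum>L\<in>V. w J L * (2 * B))"
        using coeffs m_pos[OF J] by (intro mult_left_mono) auto
      moreover have "\<bar>\<alpha> / m J * laplacian V w c J\<bar> = \<alpha> / m J * \<bar>laplacian V w c J\<bar>"
        using coeffs m_pos[OF J] by (simp add: abs_mult)
      moreover have "\<bar>c J - clamp01 e (c J)\<bar> \<le> B + 1"
        using bd[OF e sol J] clamp01_bounds[OF e, of "c J"] by linarith
      ultimately show ?thesis unfolding lb_def by linarith
    qed
    have GKL: "pot_diff e c K - pot_diff e c L = (p1 K - p1 L) - (p2 K - p2 L)"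
    proof -
      have "pot_diff e c K = p1 K - p2 K" "pot_diff e c L = p1 L - p2 L" using sol KL
          by (auto simp: reg_sol_def)
      then show ?thesis by linarith
    qed
    have "\<beta>1 * (- ln y) \<le> \<beta>1 * (- ln d)" "\<beta>2 * (- ln (1 - x)) \<le> \<beta>2 * (- ln d)"
      using xy d coeffs by (auto intro!: mult_left_mono)
    moreover have "pot_diff e c K = (\<alpha> / m K * laplacian V w c K + b K
        + (c K - clamp01 e (c K))) - \<beta>1 * X + \<beta>2 * (- ln (1 - x))"
      "pot_diff e c L = (\<alpha> / m L * laplacian V w c L + b L
          + (c L - clamp01 e (c L))) - \<beta>1 * (- ln y) + \<beta>2 * Y"
      by (simp_all add: pot_diff_def clamped_pot_def X_def Y_def x_def y_def)
    moreover have "D = lb K + lb L + \<beta>1 * (- ln d) + \<beta>2 * (- ln d)"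
      unfolding D_def by (simp add: distrib_right)
    ultimately have "\<beta>1 * X + \<beta>2 * Y \<le> D + (pot_diff e c L - pot_diff e c K)"
      using low[OF KL(1)] low[OF KL(2)] by linarith
    then have "\<beta>1 * X + \<beta>2 * Y \<le> D + \<bar>p1 K - p1 L\<bar> + \<bar>p2 K - p2 L\<bar>" using GKL by linarith
    moreover have "A1 / (2 * \<beta>1) = A1 / \<beta>1 / 2" "A2 / (2 * \<beta>2) = A2 / \<beta>2 / 2" by simp_all
    ultimately have bR: "\<beta>1 * X + \<beta>2 * Y \<le> R" using t1 t2 unfolding R_def by linarith
    have b0: "\<beta>1 * X \<ge> 0" "\<beta>2 * Y \<ge> 0" using XY coeffs by auto
    have "X \<le> R / \<beta>1" "Y \<le> R / \<beta>2" "R \<ge> 0" using bR b0 coeffs by (auto simp: field_simps)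
    moreover have "R / \<beta>1 \<ge> 0" "R / \<beta>2 \<ge> 0" using \<open>R \<ge> 0\<close> coeffs by auto
    ultimately show ?thesis unfolding X_def Y_def x_def y_def by linarith
  qed
  then show ?thesis by blast
qed

end

section \<open>Passing to the limit\<close>

lemma tendsto_clamp01_varying:
  assumes "\<And>k. 0 < e k" "e \<longlonglongrightarrow> (0::real)" "f \<longlonglongrightarrow> l"
  shows "(\<lambda>k. clamp01 (e k) (f k)) \<longlonglongrightarrow> max 0 (min 1 l)"
proof -
  have "(\<lambda>k. max (e k) (min (1 - e k) (f k))) \<longlonglongrightarrow> max 0 (min (1 - 0) l)"
    by (intro tendsto_max tendsto_min tendsto_diff tendsto_const assms)
  then show ?thesis by (simp add: clamp01_def)
qed

lemma eventually_neg_ln_gt: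
  assumes "\<And>k. 0 < f k" "f \<longlonglongrightarrow> (0::real)"
  shows "\<forall>\<^sub>F k in sequentially. - ln (f k) > C"
proof -
  have "\<forall>\<^sub>F k in sequentially. f k < exp (- C)" using assms(2) by (rule order_tendstoD(2)) simp
  then show ?thesis
  proof eventually_elim
    case (elim k)
    then have "ln (f k) < - C" using assms(1)[of k] by (metis exp_gt_zero ln_exp ln_less_cancel_iff)
    then show ?case by simp
  qed
qed

lemma Bseq_plus: "Bseq f \<Longrightarrow> Bseq g \<Longrightarrow> Bseq (\<lambda>k. f k + g k :: real)"
proof -
  assume "Bseq f" "Bseq g"
  then obtain A B where "\<forall>k. norm (f k) \<le> A" "\<forall>k. norm (g k) \<le> B" by (auto elim!: BseqE)
  then show ?thesis by (intro BseqI'[of _ "A + B"]) (metis add_mono norm_triangle_le)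
qed

lemma Bseq_diff: "Bseq f \<Longrightarrow> Bseq g \<Longrightarrow> Bseq (\<lambda>k. f k - g k :: real)"
  using Bseq_plus[of f "\<lambda>k. - g k"] by (simp add: Bseq_minus_iff)

lemma Bseq_sum: "finite A \<Longrightarrow> (\<And>i. i \<in> A \<Longrightarrow> Bseq (f i)) \<Longrightarrow> Bseq (\<lambda>k. \<Sum>i\<in>A. f i k :: real)"
proof (induction A rule: finite_induct)
  case empty
  show ?case by (simp add: Bfun_const)
next
  case (insert x F)
  then have "Bseq (\<lambda>k. f x k + (\<Sum>i\<in>F. f i k))" by (intro Bseq_plus) auto
  then show ?case using insert.hyps by simp
qed

context implicit_step
begin

text \<open>The terms with factor \<open>e\<close> vanish in the limit, so the limit has the mass of \<open>z\<close> and is neither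
  nonpositive everywhere nor at least one everywhere. By connectedness, the set where it is
  nonpositive (or at least one), if nonempty, has an outgoing edge, and across this edge there is a
  gap to which \<open>gap_controls_logs\<close> applies.\<close>

lemma limit_positive:
  assumes e: "\<And>k. 0 < e k" "\<And>k. e k < 1/2" "e \<longlonglongrightarrow> 0"
    and sol: "\<And>k. reg_sol (e k) (c k) (p1 k) (p2 k)"
    and lim: "\<And>K. K \<in> V \<Longrightarrow> (\<lambda>k. c k K) \<longlonglongrightarrow> c' K"
    and K: "K \<in> V"
  shows "0 < c' K \<and> c' K < 1"
proof -
  obtain C where C: "C \<ge> 0" and ap: "\<And>k. e k * (\<Sum>K\<in>V. m K * (p1 k K)\<^sup>2) \<le> C"
    using reg_sol_apriori sol e(1,2) by metis
  have ep: "(\<lambda>k. e k * p1 k K) \<longlonglongrightarrow> 0" if K: "K \<in> V" for K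
  proof -
    have bound: "(e k * p1 k K)\<^sup>2 \<le> e k * (C / m K)" for k
    proof -
      have "m K * (p1 k K)\<^sup>2 \<le> (\<Sum>K\<in>V. m K * (p1 k K)\<^sup>2)"
        using K finV m_pos by (intro member_le_sum) (auto simp: less_imp_le)
      then have "e k * (m K * (p1 k K)\<^sup>2) \<le> C"
        using ap[of k] mult_left_mono[of _ _ "e k"] e(1)[of k] by (smt (verit))
      then have "e k * (p1 k K)\<^sup>2 \<le> C / m K" using m_pos[OF K] by (simp add: pos_le_divide_eq mult_ac)
      then have "e k * (e k * (p1 k K)\<^sup>2) \<le> e k * (C / m K)" using e(1)[of k]
          by (intro mult_left_mono) auto
      then show ?thesis by (simp add: power2_eq_square mult_ac)
    qed
    have "(\<lambda>k. e k * (C / m K)) \<longlonglongrightarrow> 0 * (C / m K)" by (intro tendsto_mult e tendsto_const)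
    then have u: "(\<lambda>k. e k * (C / m K)) \<longlonglongrightarrow> 0" by simp
    have "(\<lambda>k. (e k * p1 k K)\<^sup>2) \<longlonglongrightarrow> 0"
      by (rule tendsto_sandwich[OF _ _ tendsto_const u]) (use bound in auto)
    then have "(\<lambda>k. sqrt ((e k * p1 k K)\<^sup>2)) \<longlonglongrightarrow> sqrt 0" by (rule tendsto_real_sqrt)
    then show ?thesis by (simp add: tendsto_rabs_zero_iff)
  qed
  have mass_k: "(\<Sum>K\<in>V. m K * (c k K - z K)) = - T * (\<Sum>K\<in>V. m K * (e k * p1 k K))" for k
  proof -
    have "0 = (\<Sum>K\<in>V. m K * (c k K - z K) + T * (laplacian V (mob1 (e k) (c k)) (p1 k) K
        + e k * m K * p1 k K))"
      using sol[of k] by (simp add: reg_sol_def)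
    also have "\<dots> = (\<Sum>K\<in>V. m K * (c k K - z K)) + T * ((\<Sum>K\<in>V. laplacian V (mob1 (e k) (c k)) (p1 k) K)
        + (\<Sum>K\<in>V. m K * (e k * p1 k K)))"
      by (simp add: sum.distrib sum_distrib_left distrib_left mult_ac)
    finally show ?thesis by (simp add: sum_laplacian mob_sym)
  qed
  have "(\<lambda>k. \<Sum>K\<in>V. m K * (c k K - z K)) \<longlonglongrightarrow> (\<Sum>K\<in>V. m K * (c' K - z K))"
    by (intro tendsto_intros lim)
  moreover have "(\<lambda>k. - T * (\<Sum>K\<in>V. m K * (e k * p1 k K))) \<longlonglongrightarrow> - T * (\<Sum>K\<in>V. m K * 0)"
    by (intro tendsto_intros ep)
  ultimately have "(\<Sum>K\<in>V. m K * (c' K - z K)) = 0"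
    unfolding mass_k by (auto dest: LIMSEQ_unique)
  then have mass: "(\<Sum>K\<in>V. m K * c' K) = (\<Sum>K\<in>V. m K * z K)"
    by (simp add: right_diff_distrib sum_subtractf)
  define x where "x k K = clamp01 (e k) (c k K)" for k K
  have x01: "0 < x k K" "x k K < 1" for k K unfolding x_def using clamp01_bounds e(1,2) by auto
  have xlim: "(\<lambda>k. x k K) \<longlonglongrightarrow> max 0 (min 1 (c' K))" if "K \<in> V" for K
    unfolding x_def by (intro tendsto_clamp01_varying e lim that)
  have gap: "\<exists>C. \<forall>\<^sub>F k in sequentially. - ln (x k K) \<le> C \<and> - ln (1 - x k L) \<le> C"
    if KL: "K \<in> V" "L \<in> V" "w K L > 0" and lt: "max 0 (min 1 (c' K)) < max 0 (min 1 (c' L))" for K L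
  proof -
    define d where "d = (max 0 (min 1 (c' L)) - max 0 (min 1 (c' K))) / 2"
    have d: "d > 0" using lt by (simp add: d_def)
    from gap_controls_logs[OF KL d] obtain C where C: "\<And>k. x k K + d \<le> x k L \<Longrightarrow>
      - ln (x k K) \<le> C \<and> - ln (1 - x k L) \<le> C"
      unfolding x_def using e(1,2) sol by metis
    have "(\<lambda>k. x k L - x k K) \<longlonglongrightarrow> 2 * d"
    proof -
      have "2 * d = max 0 (min 1 (c' L)) - max 0 (min 1 (c' K))" by (simp add: d_def)
      then show ?thesis using tendsto_diff[OF xlim[OF KL(2)] xlim[OF KL(1)]] by simp
    qed
    then have "\<forall>\<^sub>F k in sequentially. x k L - x k K > d" by (rule order_tendstoD(1)) (use d in simp)
    then have "\<forall>\<^sub>F k in sequentially. - ln (x k K) \<le> C \<and> - ln (1 - x k L) \<le> C"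
      by eventually_elim (rule C, simp)
    then show ?thesis by blast
  qed
  have "c' K > 0"
  proof (rule ccontr)
    assume "\<not> c' K > 0"
    define S where "S = {K \<in> V. c' K \<le> 0}"
    have "S \<noteq> {}" using K \<open>\<not> c' K > 0\<close> by (auto simp: S_def)
    moreover have "S \<noteq> V"
    proof
      assume "S = V"
      then have "(\<Sum>K\<in>V. m K * c' K) \<le> 0"
        using m_pos by (intro sum_nonpos mult_nonneg_nonpos) (auto simp: S_def less_imp_le)
      then show False using mass mass1 by simp
    qed
    ultimately obtain K L where KL: "K \<in> S" "L \<in> V - S" "w K L > 0" using w_conn[of S]
        by (auto simp: S_def)
    then have KL': "K \<in> V" "L \<in> V" "c' K \<le> 0" "c' L > 0" by (auto simp: S_def)
    then obtain C where "\<forall>\<^sub>F k in sequentially. - ln (x k K) \<le> C \<and> - ln (1 - x k L) \<le> C"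
      using gap[OF KL'(1,2) KL(3)] by auto
    moreover have "(\<lambda>k. x k K) \<longlonglongrightarrow> 0" using xlim[OF KL'(1)] KL'(3) by (simp add: max_absorb1)
    then have "\<forall>\<^sub>F k in sequentially. - ln (x k K) > C" by (rule eventually_neg_ln_gt[OF x01(1)])
    ultimately have "\<forall>\<^sub>F k in sequentially. False" by eventually_elim simp
    then show False by simp
  qed
  moreover have "c' K < 1"
  proof (rule ccontr)
    assume "\<not> c' K < 1"
    define S where "S = {K \<in> V. c' K \<ge> 1}"
    have "S \<noteq> {}" using K \<open>\<not> c' K < 1\<close> by (auto simp: S_def)
    moreover have "S \<noteq> V"
    proof
      assume "S = V"
      then have "(\<Sum>K\<in>V. m K * (1 - c' K)) \<le> 0"
        using m_pos by (intro sum_nonpos mult_nonneg_nonpos) (auto simp: S_def less_imp_le)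
      then show False using mass mass2 by (simp add: right_diff_distrib sum_subtractf)
    qed
    ultimately obtain K L where KL: "K \<in> S" "L \<in> V - S" "w K L > 0" using w_conn[of S]
        by (auto simp: S_def)
    then have KL': "K \<in> V" "L \<in> V" "c' K \<ge> 1" "c' L < 1" by (auto simp: S_def)
    have "w L K > 0" using KL(3) w_sym[OF KL'(1,2)] by simp
    then obtain C where "\<forall>\<^sub>F k in sequentially. - ln (x k L) \<le> C \<and> - ln (1 - x k K) \<le> C"
      using gap[OF KL'(2,1)] KL' by auto
    moreover have "(\<lambda>k. x k K) \<longlonglongrightarrow> 1" using xlim[OF KL'(1)] KL'(3) by (simp add: min_absorb1)
    then have "(\<lambda>k. 1 - x k K) \<longlonglongrightarrow> 0" using tendsto_diff[OF tendsto_const[of 1]] by fastforce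
    then have "\<forall>\<^sub>F k in sequentially. - ln (1 - x k K) > C"
      by (rule eventually_neg_ln_gt[rotated]) (use x01 in simp)
    ultimately have "\<forall>\<^sub>F k in sequentially. False" by eventually_elim simp
    then show False by simp
  qed
  ultimately show ?thesis by simp
qed

text \<open>Once the limit of the concentrations is known to lie strictly between 0 and 1, clamping
  disappears in the limit and the mobilities stay bounded below. The jumps of \<open>p1\<close> across edges are
  then bounded and, by connectedness, so are all differences of values of \<open>p1\<close>. The remaining
  constant is fixed because the sum of the two balances forces the mean of \<open>p1 + p2\<close> to vanish.\<close>

lemma step_exists:
  "\<exists>c p1 p2. \<forall>K\<in>V. 0 < c K \<and> c K < 1 \<and>
     m K * (c K - z K) + T * laplacian V (\<lambda>K L. w K L * (edge_conc (c K) (c L) / \<eta>1)) p1 K = 0 \<and>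
     - (m K * (c K - z K)) + T * laplacian V (\<lambda>K L. w K L * (edge_conc (1 - c K) (1 - c L) / \<eta>2)) p2
         K = 0 \<and>
     p1 K - p2 K = \<alpha> / m K * laplacian V w c K + b K + \<beta>1 * ln (c K) - \<beta>2 * ln (1 - c K)"
proof -
  \<comment> \<open>Clamping requires a parameter below 1/2.\<close>
  define e0 where "e0 k = 1 / (real k + 3)" for k :: nat
  have "\<exists>s. reg_sol (e0 k) (fst s) (fst (snd s)) (snd (snd s))" for k
    using reg_sol_exists[of "e0 k"] by (fastforce simp: e0_def)
  then obtain s where s: "\<And>k. reg_sol (e0 k) (fst (s k)) (fst (snd (s k))) (snd (snd (s k)))"
    by metis
  have e0: "0 < e0 k" "e0 k < 1/2" for k by (auto simp: e0_def divide_simps)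
  have e0lim: "e0 \<longlonglongrightarrow> 0" unfolding e0_def by real_asymp
  obtain B where B: "\<And>k K. K \<in> V \<Longrightarrow> \<bar>fst (s k) K\<bar> \<le> B" using reg_sol_bounded s e0 by metis
  have "Bseq (\<lambda>k. fst (s k) K)" if "K \<in> V" for K using B[OF that] by (intro BseqI'[of _ B]) auto
  then obtain r c' where r: "strict_mono r" and lim0: "\<And>K. K \<in> V \<Longrightarrow> (\<lambda>k. fst (s (r k)) K) \<longlonglongrightarrow> c' K"
    using bounded_coords_subseq[OF finV, of "\<lambda>k. fst (s k)"] by blast
  define e c p1 p2 where "e k = e0 (r k)" and "c k = fst (s (r k))" and "p1 k = fst (snd (s (r k)))"
    and "p2 k = snd (snd (s (r k)))" for k
  have e: "\<And>k. 0 < e k" "\<And>k. e k < 1/2" "e \<longlonglongrightarrow> 0"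
    using e0 LIMSEQ_subseq_LIMSEQ[OF e0lim r] by (auto simp: e_def[abs_def] o_def)
  have sol: "reg_sol (e k) (c k) (p1 k) (p2 k)" for k
    using s[of "r k"] by (simp add: e_def c_def p1_def p2_def)
  have lim: "(\<lambda>k. c k K) \<longlonglongrightarrow> c' K" if "K \<in> V" for K using lim0[OF that] by (simp add: c_def)
  have c01: "0 < c' K" "c' K < 1" if "K \<in> V" for K
    using limit_positive[OF e sol lim that] by auto
  define x where "x k K = clamp01 (e k) (c k K)" for k K
  have x01: "0 < x k K" "x k K < 1" for k K unfolding x_def using clamp01_bounds e(1,2) by auto
  have xlim: "(\<lambda>k. x k K) \<longlonglongrightarrow> c' K" if "K \<in> V" for K
    using tendsto_clamp01_varying[OF e(1,3) lim[OF that]] c01[OF that]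
        by (simp add: x_def max_def min_def)
  define G' where "G' K = \<alpha> / m K * laplacian V w c' K + b K + \<beta>1 * ln (c' K) - \<beta>2 * ln (1 - c' K)" for K
  have Glim: "(\<lambda>k. pot_diff (e k) (c k) K) \<longlonglongrightarrow> G' K" if K: "K \<in> V" for K
  proof -
    have "(\<lambda>k. laplacian V w (c k) K) \<longlonglongrightarrow> laplacian V w c' K"
      by (rule tendsto_laplacian[where a = "\<lambda>_. w"]) (use lim K in auto)
    then have "(\<lambda>k. \<alpha> / m K * laplacian V w (c k) K + b K + (\<beta>1 * ln (x k K) - \<beta>2 * ln (1 - x k K)
        + (c k K - x k K)))
      \<longlonglongrightarrow> \<alpha> / m K * laplacian V w c' K + b K + (\<beta>1 * ln (c' K) - \<beta>2 * ln (1 - c' K) + (c' K - c' K))"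
      using c01[OF K] by (intro tendsto_intros xlim lim K) auto
    then show ?thesis by (simp add: pot_diff_def clamped_pot_def x_def G'_def algebra_simps)
  qed
  define M1 M2 where "M1 K L = w K L * (edge_conc (c' K) (c' L) / \<eta>1)"
    and "M2 K L = w K L * (edge_conc (1 - c' K) (1 - c' L) / \<eta>2)" for K L
  have Mlim: "(\<lambda>k. mob1 (e k) (c k) K L) \<longlonglongrightarrow> M1 K L" "(\<lambda>k. mob2 (e k) (c k) K L) \<longlonglongrightarrow> M2 K L"
    if "K \<in> V" "L \<in> V" for K L
    unfolding mob1_def mob2_def M1_def M2_def x_def[symmetric]
    using c01[OF that(1)] c01[OF that(2)] coeffs
    by (intro tendsto_intros tendsto_edge_conc xlim that; simp)+
  obtain C where C: "\<And>k. dirichlet (mob1 (e k) (c k)) (p1 k) \<le> C"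
    using reg_sol_apriori sol e(1,2) by metis
  have edgeB: "Bseq (\<lambda>k. p1 k K - p1 k L)" if KL: "K \<in> V" "L \<in> V" "w K L > 0" for K L
  proof -
    have M: "M1 K L > 0" unfolding M1_def using KL c01 coeffs by (simp add: edge_conc_pos)
    have "\<forall>\<^sub>F k in sequentially. mob1 (e k) (c k) K L > M1 K L / 2"
      by (rule order_tendstoD(1)[OF Mlim(1)[OF KL(1,2)]]) (use M in simp)
    then have "\<forall>\<^sub>F k in sequentially. norm (p1 k K - p1 k L) \<le> 1 + 2 * C / (M1 K L / 2)"
    proof eventually_elim
      case (elim k)
      have "M1 K L / 2 * (p1 k K - p1 k L)\<^sup>2 \<le> mob1 (e k) (c k) K L * (p1 k K - p1 k L)\<^sup>2"
        using elim by (intro mult_right_mono) auto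
      also have "\<dots> \<le> 2 * dirichlet (mob1 (e k) (c k)) (p1 k)"
        using mob_nonneg[OF e(1,2)] KL by (intro dirichlet_ge_edge) auto
      also have "\<dots> \<le> 2 * C" using C by simp
      finally have "(p1 k K - p1 k L)\<^sup>2 \<le> 2 * C / (M1 K L / 2)"
        using M by (simp add: field_simps)
      moreover have "\<bar>p1 k K - p1 k L\<bar> \<le> 1 + (p1 k K - p1 k L)\<^sup>2" by (rule abs_le_one_plus_square)
      ultimately show ?case by simp
    qed
    then show ?thesis by (rule BfunI)
  qed
  have "V \<noteq> {}" using mass1 by auto
  then obtain K0 where K0: "K0 \<in> V" by auto
  define S where "S = {K \<in> V. Bseq (\<lambda>k. p1 k K - p1 k K0)}"
  have "S = V"
  proof (rule ccontr)
    assume "S \<noteq> V"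
    moreover have "S \<noteq> {}" using K0 by (auto simp: S_def Bfun_const)
    moreover have "S \<subseteq> V" by (auto simp: S_def)
    ultimately obtain K L where KL: "K \<in> S" "L \<in> V - S" "w K L > 0"
      using w_conn[of S] by blast
    then have "Bseq (\<lambda>k. p1 k K - p1 k K0)" "Bseq (\<lambda>k. p1 k K - p1 k L)"
      using edgeB[of K L] by (auto simp: S_def)
    then have "Bseq (\<lambda>k. (p1 k K - p1 k K0) - (p1 k K - p1 k L))" by (rule Bseq_diff)
    then have "Bseq (\<lambda>k. p1 k L - p1 k K0)" by simp
    then show False using KL by (auto simp: S_def)
  qed
  then have B0: "Bseq (\<lambda>k. p1 k K - p1 k K0)" if "K \<in> V" for K using that by (auto simp: S_def)
  have GB: "Bseq (\<lambda>k. pot_diff (e k) (c k) K)" if "K \<in> V" for K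
    using Glim[OF that] by (intro convergent_imp_Bseq convergentI)
  have psum: "(\<Sum>K\<in>V. m K * (p1 k K + p2 k K)) = 0" for k
  proof -
    have "0 = (\<Sum>K\<in>V. (m K * (c k K - z K) + T * (laplacian V (mob1 (e k) (c k)) (p1 k) K
        + e k * m K * p1 k K))
       + (- (m K * (c k K - z K)) + T * (laplacian V (mob2 (e k) (c k)) (p2 k) K + e k * m K * p2 k K)))"
      using sol[of k] by (simp add: reg_sol_def)
    also have "\<dots> = (\<Sum>K\<in>V. T * laplacian V (mob1 (e k) (c k)) (p1 k) K
        + T * laplacian V (mob2 (e k) (c k)) (p2 k) K
       + T * e k * (m K * (p1 k K + p2 k K)))"
      by (intro sum.cong refl) (simp add: algebra_simps)
    also have "\<dots> = T * e k * (\<Sum>K\<in>V. m K * (p1 k K + p2 k K))"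
      by (simp add: sum.distrib sum_distrib_left[symmetric] sum_laplacian mob_sym)
    finally show ?thesis using e(1)[of k] coeffs by simp
  qed
  define W where "W = (\<Sum>K\<in>V. m K)"
  have W: "W > 0" unfolding W_def using m_pos finV K0 by (intro sum_pos) auto
  \<comment> \<open>Solving the mean condition and the potential relation for the value at \<open>K0\<close>.\<close>
  have p0: "p1 k K0 = ((\<Sum>K\<in>V. m K * pot_diff (e k) (c k) K) - 2 * (\<Sum>K\<in>V. m K * (p1 k K - p1 k K0)))
      * (1 / (2 * W))" for k
  proof -
    have "0 = (\<Sum>K\<in>V. m K * (p1 k K + p2 k K))" using psum by simp
    also have "\<dots> = (\<Sum>K\<in>V. 2 * (m K * (p1 k K - p1 k K0))
        + m K * (2 * p1 k K0) - m K * pot_diff (e k) (c k) K)"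
    proof (intro sum.cong refl)
      fix K assume "K \<in> V"
      then have g: "pot_diff (e k) (c k) K = p1 k K - p2 k K" using sol[of k] by (simp add: reg_sol_def)
      show "m K * (p1 k K + p2 k K) = 2 * (m K * (p1 k K - p1 k K0))
          + m K * (2 * p1 k K0) - m K * pot_diff (e k) (c k) K"
        unfolding g by (simp add: algebra_simps)
    qed
    also have "\<dots> = 2 * (\<Sum>K\<in>V. m K * (p1 k K - p1 k K0))
        + W * (2 * p1 k K0) - (\<Sum>K\<in>V. m K * pot_diff (e k) (c k) K)"
      by (simp add: sum.distrib sum_subtractf sum_distrib_left sum_distrib_right W_def)
    finally show ?thesis using W by (simp add: field_simps)
  qed
  have cm: "Bseq (\<lambda>k. a * f k)" if "Bseq f" for a :: real and f
    using Bseq_mult[OF Bfun_const that] .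
  have "Bseq (\<lambda>k. (1 / (2 * W)) * ((\<Sum>K\<in>V. m K * pot_diff (e k) (c k) K) - 2 * (\<Sum>K\<in>V. m K * (p1 k K -
      p1 k K0))))"
    by (intro cm Bseq_diff Bseq_sum finV GB B0)
  then have "Bseq (\<lambda>k. p1 k K0)" by (simp only: mult.commute[of "1 / (2 * W)"] p0[symmetric])
  then have "Bseq (\<lambda>k. (p1 k K - p1 k K0) + p1 k K0)" if "K \<in> V" for K
    using B0[OF that] by (intro Bseq_plus)
  then have "Bseq (\<lambda>k. p1 k K)" if "K \<in> V" for K using that by simp
  then obtain t q1 where t: "strict_mono t" and q1: "\<And>K. K \<in> V \<Longrightarrow> (\<lambda>k. p1 (t k) K) \<longlonglongrightarrow> q1 K"
    using bounded_coords_subseq[OF finV, of p1] by blast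
  define q2 where "q2 K = q1 K - G' K" for K
  have q2: "(\<lambda>k. p2 (t k) K) \<longlonglongrightarrow> q2 K" if "K \<in> V" for K
  proof -
    have "p1 k K - p2 k K = pot_diff (e k) (c k) K" for k using sol[of k] that by (simp add: reg_sol_def)
    then have "p2 k K = p1 k K - pot_diff (e k) (c k) K" for k
        by (metis diff_diff_eq2 add_diff_cancel_left')
    then show ?thesis
      using tendsto_diff[OF q1[OF that] LIMSEQ_subseq_LIMSEQ[OF Glim[OF that] t]]
      by (simp add: q2_def o_def)
  qed
  have et: "(\<lambda>k. e (t k)) \<longlonglongrightarrow> 0" using LIMSEQ_subseq_LIMSEQ[OF e(3) t] by (simp add: o_def)
  have "0 < c' K \<and> c' K < 1 \<and> m K * (c' K - z K) + T * laplacian V M1 q1 K = 0 \<and>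
     - (m K * (c' K - z K)) + T * laplacian V M2 q2 K = 0 \<and> q1 K - q2 K = G' K" if K: "K \<in> V" for K
  proof -
    have ct: "(\<lambda>k. c (t k) K) \<longlonglongrightarrow> c' K" using LIMSEQ_subseq_LIMSEQ[OF lim[OF K] t] by (simp add: o_def)
    have l1: "(\<lambda>k. laplacian V (mob1 (e (t k)) (c (t k))) (p1 (t k)) K) \<longlonglongrightarrow> laplacian V M1 q1 K"
      using LIMSEQ_subseq_LIMSEQ[OF Mlim(1)[OF K] t] by (intro tendsto_laplacian q1 K) (simp add: o_def)
    have l2: "(\<lambda>k. laplacian V (mob2 (e (t k)) (c (t k))) (p2 (t k)) K) \<longlonglongrightarrow> laplacian V M2 q2 K"
      using LIMSEQ_subseq_LIMSEQ[OF Mlim(2)[OF K] t] by (intro tendsto_laplacian q2 K) (simp add: o_def)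
    have "(\<lambda>k. m K * (c (t k) K - z K) + T * (laplacian V (mob1 (e (t k)) (c (t k))) (p1 (t k)) K
        + e (t k) * m K * p1 (t k) K))
      \<longlonglongrightarrow> m K * (c' K - z K) + T * (laplacian V M1 q1 K + 0 * m K * q1 K)"
      by (intro tendsto_intros ct l1 et q1 K)
    moreover have "m K * (c k K - z K) + T * (laplacian V (mob1 (e k) (c k)) (p1 k) K
        + e k * m K * p1 k K) = 0" for k
      using sol[of k] K by (simp add: reg_sol_def)
    ultimately have 1: "m K * (c' K - z K) + T * laplacian V M1 q1 K = 0"
      by (simp add: LIMSEQ_const_iff)
    have "(\<lambda>k. - (m K * (c (t k) K - z K)) + T * (laplacian V (mob2 (e (t k)) (c (t k))) (p2 (t k))
        K + e (t k) * m K * p2 (t k) K))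
      \<longlonglongrightarrow> - (m K * (c' K - z K)) + T * (laplacian V M2 q2 K + 0 * m K * q2 K)"
      by (intro tendsto_intros ct l2 et q2 K)
    moreover have "- (m K * (c k K - z K)) + T * (laplacian V (mob2 (e k) (c k)) (p2 k) K
        + e k * m K * p2 k K) = 0" for k
      using sol[of k] K by (simp add: reg_sol_def)
    ultimately have 2: "- (m K * (c' K - z K)) + T * laplacian V M2 q2 K = 0"
      by (simp only: LIMSEQ_const_iff) simp
    show ?thesis using c01[OF K] 1 2 by (simp add: q2_def)
  qed
  then show ?thesis unfolding M1_def M2_def G'_def by blast
qed

end

section \<open>Interior edges of an admissible mesh\<close>

lemma hausdorff1_singleton:
  assumes "A \<subseteq> {p}"
  shows "hausdorff1 A = 0"
proof -
  have "(INF U\<in>{U :: nat \<Rightarrow> pt set. A \<subseteq> (\<Union>j. U j) \<and> (\<forall>j. bounded (U j) \<and> diameter (U j) \<le> \<delta>)}.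
       (\<Sum>j. ennreal (diameter (U j)))) = 0" if "\<delta> \<in> {0<..}" for \<delta> :: real
  proof -
    have "(\<lambda>_. {p}) \<in> {U :: nat \<Rightarrow> pt set. A \<subseteq> (\<Union>j. U j) \<and> (\<forall>j. bounded (U j) \<and> diameter (U j) \<le> \<delta>)}"
      using assms that by auto
    from INF_lower[OF this, of "\<lambda>U. \<Sum>j. ennreal (diameter (U j))"] show ?thesis by simp
  qed
  then have "hausdorff1 A \<le> 0" unfolding hausdorff1_def by (intro SUP_least) simp
  then show ?thesis by simp
qed

text \<open>A cover by sets of small total diameter projects to a cover by intervals of comparable total
  length. This reduces statements about sets of one-dimensional measure zero to Lebesgue null sets
  of the line.\<close>

lemma negligible_projection:
  assumes "hausdorff1 A = 0" "norm u \<le> 1"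
  shows "negligible ((\<lambda>x. x \<bullet> u) ` A)"
  unfolding negligible_outer
proof (intro allI impI)
  fix e :: real assume e: "e > 0"
  let ?C = "{U :: nat \<Rightarrow> pt set. A \<subseteq> (\<Union>j. U j) \<and> (\<forall>j. bounded (U j) \<and> diameter (U j) \<le> 1)}"
  have "(INF U\<in>?C. (\<Sum>j. ennreal (diameter (U j)))) \<le> hausdorff1 A"
    unfolding hausdorff1_def by (rule SUP_upper) simp
  also have "\<dots> < ennreal (e / 2)" using assms e by simp
  finally obtain U where U: "A \<subseteq> (\<Union>j. U j)" "\<And>j. bounded (U j)"
    and s: "(\<Sum>j. ennreal (diameter (U j))) < ennreal (e / 2)"
    by (auto simp: INF_less_iff)
  define d where "d j = diameter (U j)" for j
  define p where "p j = (SOME x. x \<in> U j)" for j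
  define J where "J j = {p j \<bullet> u - d j .. p j \<bullet> u + d j}" for j
  define T where "T = (\<Union>j. J j)"
  have d0: "d j \<ge> 0" for j using U(2) by (simp add: d_def diameter_ge_0)
  have sub: "(\<lambda>x. x \<bullet> u) ` A \<subseteq> T"
  proof
    fix y assume "y \<in> (\<lambda>x. x \<bullet> u) ` A"
    then obtain x j where x: "y = x \<bullet> u" "x \<in> U j" using U by auto
    have "p j \<in> U j" unfolding p_def using x(2) by (rule someI)
    then have "norm (x - p j) \<le> d j"
      using diameter_bounded_bound[OF U(2) x(2)] by (simp add: d_def dist_norm)
    then have "\<bar>(x - p j) \<bullet> u\<bar> \<le> d j * 1"
      using assms(2) d0 by (intro order_trans[OF Cauchy_Schwarz_ineq2] mult_mono) auto
    then have "y \<in> J j" by (auto simp: J_def x(1) inner_diff_left)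
    then show "y \<in> T" by (auto simp: T_def)
  qed
  have meas: "T \<in> sets lebesgue" unfolding T_def J_def by auto
  have "emeasure lebesgue T \<le> (\<Sum>j. emeasure lebesgue (J j))"
    unfolding T_def by (intro emeasure_subadditive_countably) (auto simp: J_def)
  also have "\<dots> = (\<Sum>j. 2 * ennreal (d j))"
  proof (intro suminf_cong)
    fix j
    have "emeasure lebesgue (J j) = ennreal (2 * d j)" unfolding J_def using d0[of j] by simp
    then show "emeasure lebesgue (J j) = 2 * ennreal (d j)" using d0[of j] by (simp add: ennreal_mult)
  qed
  also have "\<dots> = 2 * (\<Sum>j. ennreal (d j))" by simp
  also have "\<dots> < 2 * ennreal (e / 2)"
    using s by (intro ennreal_mult_strict_left_mono) (auto simp: d_def)
  also have "\<dots> = ennreal e" using e by (metis ennreal_mult ennreal_numeral field_sum_of_halves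
      less_eq_real_def mult_2 zero_le_numeral half_gt_zero)
  finally have lt: "emeasure lebesgue T < ennreal e" .
  then have "T \<in> lmeasurable" using meas by (intro fmeasurableI) (auto intro: less_trans)
  moreover have "measure lebesgue T < e"
    using lt e unfolding measure_def by (metis enn2real_less_iff ennreal_less_top less_trans)
  ultimately show "\<exists>T. (\<lambda>x. x \<bullet> u) ` A \<subseteq> T \<and> T \<in> lmeasurable \<and> measure lebesgue T < e"
    using sub by blast
qed

lemma segment_projection_not_negligible:
  fixes a b :: pt
  assumes "a \<noteq> b"
  shows "\<exists>u. norm u \<le> 1 \<and> \<not> negligible ((\<lambda>x. x \<bullet> u) ` closed_segment a b)"
proof -
  define u where "u = (b - a) /\<^sub>R norm (b - a)"
  have nu: "norm u = 1" using assms by (simp add: u_def)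
  have "(b - a) \<bullet> u = norm (b - a)" using assms by (simp add: u_def dot_square_norm power2_eq_square)
  moreover have "norm (b - a) > 0" using assms by simp
  ultimately have lt: "a \<bullet> u < b \<bullet> u" unfolding inner_diff_left by linarith
  have "(\<lambda>x. x \<bullet> u) ` closed_segment a b = closed_segment (a \<bullet> u) (b \<bullet> u)"
    by (rule closed_segment_linear_image[symmetric]) (simp add: linear_iff inner_add_left)
  also have "\<dots> = cbox (a \<bullet> u) (b \<bullet> u)" using lt by (simp add: closed_segment_eq_real_ivl)
  finally have "\<not> negligible ((\<lambda>x. x \<bullet> u) ` closed_segment a b)"
    using lt negligible_interval(1)[of "a \<bullet> u" "b \<bullet> u"] by simp
  with nu show ?thesis by (intro exI[of _ u]) auto
qed

lemma convex_hausdorff1_null: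
  assumes "convex A" "hausdorff1 A = 0" "a \<in> A" "b \<in> A"
  shows "a = b"
proof (rule ccontr)
  assume "a \<noteq> b"
  then obtain u where u: "norm u \<le> 1" "\<not> negligible ((\<lambda>x. x \<bullet> u) ` closed_segment a b)"
    using segment_projection_not_negligible by blast
  have "closed_segment a b \<subseteq> A" using assms by (simp add: closed_segment_subset)
  with u negligible_projection[OF assms(2) u(1)] show False
    using negligible_subset image_mono by metis
qed

locale fv_mesh =
  fixes \<Omega> :: "pt set" and M :: mesh
  assumes adm: "admissible_mesh \<Omega> M"
begin

lemma fin_cells: "finite (cells M)" and fin_edges: "finite (edges M)"
  and cell: "K \<in> cells M \<Longrightarrow> K \<noteq> {}" "K \<in> cells M \<Longrightarrow> open K" "K \<in> cells M \<Longrightarrow> polygonal K"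
    "K \<in> cells M \<Longrightarrow> convex K"
  and disj: "pairwise disjnt (cells M)"
  and cover: "(\<Union>K\<in>cells M. closure K) = closure \<Omega>"
  and edge: "\<sigma> \<in> edges M \<Longrightarrow> edge_length \<sigma> > 0"
  and edges_null: "\<sigma> \<in> edges M \<Longrightarrow> \<sigma>' \<in> edges M \<Longrightarrow> \<sigma> \<noteq> \<sigma>' \<Longrightarrow> hausdorff1 (\<sigma> \<inter> \<sigma>') = 0"
  and cell_edges: "K \<in> cells M \<Longrightarrow> cell_edges M K \<subseteq> edges M"
    "K \<in> cells M \<Longrightarrow> frontier K = \<Union>(cell_edges M K)"
  and common: "K \<in> cells M \<Longrightarrow> L \<in> cells M \<Longrightarrow> K \<noteq> L \<Longrightarrow>
        common_edge K L \<in> edges M \<or> hausdorff1 (common_edge K L) = 0"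
  and centre_in: "K \<in> cells M \<Longrightarrow> centre M K \<in> K"
  and centre_line: "share_edge M K L \<Longrightarrow> affine hull {centre M K, centre M L} \<inter> common_edge K L
          = {edge_midpoint (common_edge K L)}"
  using adm unfolding admissible_mesh_def common_edge_def by auto

lemma cell_disjoint: "K \<in> cells M \<Longrightarrow> L \<in> cells M \<Longrightarrow> K \<noteq> L \<Longrightarrow> K \<inter> L = {}"
  using disj by (auto simp: pairwise_def disjnt_def)

lemma cell_Int_closure: "K \<in> cells M \<Longrightarrow> L \<in> cells M \<Longrightarrow> K \<noteq> L \<Longrightarrow> K \<inter> closure L = {}"
  using cell_disjoint open_Int_closure_eq_empty cell(2) by metis

lemma common_edge_commute: "common_edge K L = common_edge L K"
  by (auto simp: common_edge_def)

lemma share_edge_commute: "share_edge M K L = share_edge M L K"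
  by (auto simp: share_edge_def common_edge_commute)

lemma convex_common: "K \<in> cells M \<Longrightarrow> L \<in> cells M \<Longrightarrow> convex (common_edge K L)"
  by (simp add: common_edge_def convex_Int convex_closure cell)

lemma edge_two_points:
  assumes "\<sigma> \<in> edges M"
  obtains a b where "a \<in> \<sigma>" "b \<in> \<sigma>" "a \<noteq> b"
proof -
  have "hausdorff1 \<sigma> \<noteq> 0" using edge[OF assms] by (auto simp: edge_length_def)
  then have "\<not> \<sigma> \<subseteq> {p}" for p using hausdorff1_singleton by blast
  then show ?thesis using that by (metis insertI1 subsetI subset_singletonD)
qed

text \<open>The definition of a mesh places the common set of two closures among the edges of the mesh,
  not among those of the two cells. But the edges of \<open>K\<close> cover the boundary of \<open>K\<close>, and if the
  common edge were none of them, they would meet it in finitely many null sets, which cannot cover a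
  segment.\<close>

lemma common_edge_in_cell_edges:
  assumes "share_edge M K L"
  shows "common_edge K L \<in> cell_edges M K"
proof (rule ccontr)
  assume n: "common_edge K L \<notin> cell_edges M K"
  have KL: "K \<in> cells M" "L \<in> cells M" "K \<noteq> L" "common_edge K L \<in> edges M"
    using assms by (auto simp: share_edge_def)
  define \<sigma> where "\<sigma> = common_edge K L"
  obtain a b where ab: "a \<in> \<sigma>" "b \<in> \<sigma>" "a \<noteq> b" using edge_two_points KL(4) \<sigma>_def by blast
  then have seg: "closed_segment a b \<subseteq> \<sigma>"
    using convex_common[OF KL(1,2)] by (simp add: closed_segment_subset \<sigma>_def)
  obtain u where u: "norm u \<le> 1" "\<not> negligible ((\<lambda>x. x \<bullet> u) ` closed_segment a b)"
    using segment_projection_not_negligible ab(3) by blast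
  have "\<sigma> \<subseteq> frontier K"
    using cell_Int_closure[OF KL(1-3)] cell(2)[OF KL(1)]
    by (auto simp: \<sigma>_def common_edge_def frontier_def interior_open)
  then have "\<sigma> \<subseteq> (\<Union>\<sigma>'\<in>cell_edges M K. \<sigma> \<inter> \<sigma>')" using cell_edges(2)[OF KL(1)] by auto
  then have "(\<lambda>x. x \<bullet> u) ` closed_segment a b \<subseteq> (\<Union>\<sigma>'\<in>cell_edges M K. (\<lambda>x. x \<bullet> u) ` (\<sigma> \<inter> \<sigma>'))"
    using seg by blast
  moreover have "negligible (\<Union>\<sigma>'\<in>cell_edges M K. (\<lambda>x. x \<bullet> u) ` (\<sigma> \<inter> \<sigma>'))"
  proof (rule negligible_Union, goal_cases)
    case 1
    then show ?case using finite_subset[OF cell_edges(1)[OF KL(1)] fin_edges] by simp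
  next
    case (2 t)
    then obtain \<sigma>' where \<sigma>': "\<sigma>' \<in> cell_edges M K" "t = (\<lambda>x. x \<bullet> u) ` (\<sigma> \<inter> \<sigma>')" by auto
    then have "hausdorff1 (\<sigma> \<inter> \<sigma>') = 0"
      using n KL cell_edges(1)[OF KL(1)] by (intro edges_null) (auto simp: \<sigma>_def)
    then show ?case using \<sigma>'(2) u(1) negligible_projection by simp
  qed
  ultimately show False using u(2) negligible_subset by blast
qed

lemma int_edges_of_eq:
  assumes "K \<in> cells M"
  shows "int_edges_of M K = common_edge K ` {L. share_edge M K L}"
proof -
  have "share_edge M K L" if "L \<in> cells M" "L \<noteq> K" "common_edge K L \<in> cell_edges M K" for L
    using that assms cell_edges(1)[OF assms] by (auto simp: share_edge_def)
  then show ?thesis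
    unfolding int_edges_of_def using common_edge_in_cell_edges[of K]
    by (auto simp: share_edge_def) 
qed

lemma common_edge_of_shared:
  assumes "\<sigma> \<in> edges M" "K \<in> cells M" "L \<in> cells M" "K \<noteq> L" "\<sigma> \<subseteq> closure K" "\<sigma> \<subseteq> closure L"
  shows "share_edge M K L" "common_edge K L = \<sigma>"
proof -
  have sub: "\<sigma> \<subseteq> common_edge K L" using assms by (auto simp: common_edge_def)
  obtain a b where ab: "a \<in> \<sigma>" "b \<in> \<sigma>" "a \<noteq> b" using edge_two_points assms(1) by blast
  have "hausdorff1 (common_edge K L) \<noteq> 0"
    using convex_hausdorff1_null[OF convex_common[OF assms(2,3)]] ab sub by blast
  then have e: "common_edge K L \<in> edges M" using common assms by blast
  then show "share_edge M K L" using assms by (simp add: share_edge_def)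
  show "common_edge K L = \<sigma>"
  proof (rule ccontr)
    assume "common_edge K L \<noteq> \<sigma>"
    then have "hausdorff1 (\<sigma> \<inter> common_edge K L) = 0" using edges_null[OF assms(1) e] by auto
    moreover have "\<sigma> \<inter> common_edge K L = \<sigma>" using sub by auto
    ultimately show False using edge[OF assms(1)] by (simp add: edge_length_def)
  qed
qed

text \<open>If two centres lie on the same ray from a point \<open>p\<close> of both closures, the nearer one is on the
  open segment from \<open>p\<close> to the other centre, hence inside the cell of the latter by convexity; the
  centres cannot coincide either.\<close>

lemma centres_not_same_side:
  assumes K: "K \<in> cells M" "p \<in> closure K" and L: "L \<in> cells M" "p \<in> closure L" and "K \<noteq> L"
    and t: "t > 0" "centre M L - p = t *\<^sub>R (centre M K - p)"
  shows False
proof -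
  have main: False if K: "K \<in> cells M" "p \<in> closure K" and L: "L \<in> cells M" and ne: "K \<noteq> L"
    and t: "0 < t" "t \<le> 1" "centre M L - p = t *\<^sub>R (centre M K - p)" for K L t
  proof -
    have "centre M L = centre M K - (1 - t) *\<^sub>R (centre M K - p)"
      using t(3) by (simp add: algebra_simps)
    moreover have "centre M K - (1 - t) *\<^sub>R (centre M K - p) \<in> interior K"
    proof (cases "t = 1")
      case True
      then show ?thesis using centre_in[OF K(1)] cell(2)[OF K(1)] by (simp add: interior_open)
    next
      case False
      have e: "centre M K - (1 - t) *\<^sub>R (centre M K - p) = p - t *\<^sub>R (p - centre M K)"
        by (simp add: algebra_simps)
      show ?thesis unfolding e
        using cell(4)[OF K(1)] K(2) centre_in[OF K(1)] cell(2)[OF K(1)] t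
        by (intro mem_interior_closure_convex_shrink) (auto simp: interior_open)
    qed
    ultimately have "centre M L \<in> K" using interior_subset by auto
    then show False using centre_in[OF L] cell_disjoint[OF K(1) L ne] by auto
  qed
  show False
  proof (cases "t \<le> 1")
    case True
    then show False using main[OF K L(1) \<open>K \<noteq> L\<close> t(1) _ t(2)] by simp
  next
    case False
    have "centre M K - p = (1 / t) *\<^sub>R (centre M L - p)" using t by simp
    then show False using main[OF L K(1), of "1 / t"] False \<open>K \<noteq> L\<close> by simp
  qed
qed

text \<open>The lines joining the centres of the cells all pass through the midpoint of the edge, so the
  three centres lie on one line. Two of them are on the same side of the midpoint.\<close>

lemma no_three_cells_on_edge:
  assumes \<sigma>: "\<sigma> \<in> edges M" and c: "K \<in> cells M" "L \<in> cells M" "L' \<in> cells M"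
    and s: "\<sigma> \<subseteq> closure K" "\<sigma> \<subseteq> closure L" "\<sigma> \<subseteq> closure L'"
    and ne: "K \<noteq> L" "K \<noteq> L'"
  shows "L = L'"
proof (rule ccontr)
  assume "L \<noteq> L'"
  define p where "p = edge_midpoint \<sigma>"
  have KL: "share_edge M K L" "common_edge K L = \<sigma>" and KL': "share_edge M K L'" "common_edge K L' = \<sigma>"
    using common_edge_of_shared \<sigma> c s ne by auto
  have p1: "p \<in> affine hull {centre M K, centre M L}" "p \<in> \<sigma>"
      using centre_line[OF KL(1)] KL(2) p_def by auto
  have p2: "p \<in> affine hull {centre M K, centre M L'}" using centre_line[OF KL'(1)] KL'(2) p_def by auto
  have pcl: "p \<in> closure K" "p \<in> closure L" "p \<in> closure L'" using p1 s by auto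
  have pn: "p \<noteq> centre M J" if J: "J \<in> {L, L'}" for J
  proof -
    have "centre M J \<in> J" "J \<in> cells M" "J \<noteq> K" using J c ne centre_in by auto
    then show ?thesis using cell_Int_closure[of J K] c(1) pcl(1) by auto
  qed
  have line: "\<exists>t. centre M J - p = t *\<^sub>R (centre M K - p) \<and> t \<noteq> 0"
    if J: "J \<in> {L, L'}" and pa: "p \<in> affine hull {centre M K, centre M J}" for J
  proof -
    from pa obtain r v where "p = r *\<^sub>R centre M K + v *\<^sub>R centre M J" "r + v = 1"
      by (auto simp: affine_hull_2)
    moreover from this(2) have "r = 1 - v" by simp
    ultimately have p: "p = (1 - v) *\<^sub>R centre M K + v *\<^sub>R centre M J" by simp
    have "v \<noteq> 0"
    proof
      assume "v = 0"
      then have "p = centre M K" using p by simp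
      moreover have "centre M K \<notin> closure L" using cell_Int_closure[OF c(1,2) ne(1)] centre_in[OF
          c(1)] by auto
      ultimately show False using pcl by simp
    qed
    then have "centre M J - p = (1 / v) *\<^sub>R (v *\<^sub>R (centre M J - p))" by simp
    also have "v *\<^sub>R (centre M J - p) = (v - 1) *\<^sub>R (centre M K - p)"
      unfolding p by (simp add: algebra_simps)
    finally have "centre M J - p = ((v - 1) / v) *\<^sub>R (centre M K - p)" by simp
    moreover from this pn[OF J] have "(v - 1) / v \<noteq> 0" by auto
    ultimately show ?thesis by blast
  qed
  obtain s where s: "centre M L - p = s *\<^sub>R (centre M K - p)" "s \<noteq> 0" using line[OF _ p1(1)] by auto
  obtain t where t: "centre M L' - p = t *\<^sub>R (centre M K - p)" "t \<noteq> 0" using line[OF _ p2] by auto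
  have "s < 0" using centres_not_same_side[OF c(1) pcl(1) c(2) pcl(2) ne(1) _ s(1)] s(2)
      by (meson linorder_neqE)
  moreover have "t < 0" using centres_not_same_side[OF c(1) pcl(1) c(3) pcl(3) ne(2) _ t(1)] t(2)
      by (meson linorder_neqE)
  moreover have "centre M L' - p = (t / s) *\<^sub>R (centre M L - p)" using s t by simp
  ultimately show False
    using centres_not_same_side[OF c(2) pcl(2) c(3) pcl(3) \<open>L \<noteq> L'\<close>, of "t / s"]
        by (simp add: divide_neg_neg)
qed

lemma opposite_eq:
  assumes "share_edge M K L"
  shows "opposite M K (common_edge K L) = L"
  unfolding opposite_def
proof (rule the_equality)
  show "L \<in> cells M \<and> L \<noteq> K \<and> common_edge K L = common_edge K L" using assms
      by (auto simp: share_edge_def)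
  fix L' assume "L' \<in> cells M \<and> L' \<noteq> K \<and> common_edge K L = common_edge K L'"
  then show "L' = L"
    using assms no_three_cells_on_edge[of "common_edge K L" K L' L]
    by (auto simp: share_edge_def common_edge_def)
qed

end

section \<open>Sums and integrals over the mesh\<close>

lemma negligible_frontier_polygonal:
  assumes "polygonal S"
  shows "negligible (frontier S)"
proof -
  obtain F where F: "finite F" "frontier S = (\<Union>(a, b)\<in>F. closed_segment a b)"
    using assms by (auto simp: polygonal_def)
  have "negligible (closed_segment a b)" for a b :: pt
    by (simp add: negligible_convex_interior interior_closed_segment_ge2)
  then show ?thesis unfolding F(2) using F(1) by (intro negligible_Union) auto
qed

lemma sum_Sigma_rel:
  assumes "finite A" "finite B"
  shows "(\<Sum>x\<in>A. \<Sum>y\<in>B. if P x y then g x y else 0) = (\<Sum>(x, y)\<in>{(x, y). x \<in> A \<and> y \<in> B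
      \<and> P x y}. g x y :: real)"
proof -
  have "(\<Sum>x\<in>A. \<Sum>y\<in>B. if P x y then g x y else 0) = (\<Sum>(x, y)\<in>A \<times> B. if P x y then g x y else 0)"
    by (simp add: sum.cartesian_product)
  also have "\<dots> = (\<Sum>(x, y)\<in>{(x, y). x \<in> A \<and> y \<in> B \<and> P x y}. g x y)"
    using assms by (intro sum.mono_neutral_cong_right) (auto split: if_splits)
  finally show ?thesis .
qed

context fv_mesh
begin

definition edge_weight :: "pt set \<Rightarrow> pt set \<Rightarrow> real" where
  "edge_weight K L = (if share_edge M K L then transmissibility M (common_edge K L) else 0)"

lemma edge_weight_sym: "edge_weight K L = edge_weight L K"
  by (simp add: edge_weight_def share_edge_commute common_edge_commute)

lemma sum_cell_edges_eq:
  assumes K: "K \<in> cells M"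
  shows "sum_cell_edges M K f = (\<Sum>L\<in>cells M. edge_weight K L * f K L)"
proof -
  have inj: "inj_on (common_edge K) {L. share_edge M K L}"
    by (rule inj_onI) (metis mem_Collect_eq opposite_eq)
  have "sum_cell_edges M K f = (\<Sum>L\<in>{L. share_edge M K L}. transmissibility M (common_edge K L) * f K
      (opposite M K (common_edge K L)))"
    unfolding sum_cell_edges_def int_edges_of_eq[OF K] by (simp add: sum.reindex[OF inj])
  also have "\<dots> = (\<Sum>L\<in>{L. share_edge M K L}. edge_weight K L * f K L)"
    by (intro sum.cong refl) (simp add: opposite_eq edge_weight_def)
  also have "\<dots> = (\<Sum>L\<in>cells M. edge_weight K L * f K L)"
    using fin_cells by (intro sum.mono_neutral_left) (auto simp: share_edge_def edge_weight_def)
  finally show ?thesis .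
qed

text \<open>Every interior edge is the common edge of exactly two ordered pairs of cells, which are
  exchanged by symmetry; the arbitrary choice of the first cell is then immaterial.\<close>

lemma sum_int_edges_eq:
  assumes sym: "\<And>K L. f K L = f L K"
  shows "sum_int_edges M f = (\<Sum>K\<in>cells M. \<Sum>L\<in>cells M. edge_weight K L * f K L) / 2"
proof -
  define P where "P = {(K, L). share_edge M K L}"
  have "P \<subseteq> cells M \<times> cells M" by (auto simp: P_def share_edge_def)
  then have finP: "finite P" using fin_cells finite_subset by blast
  define g where "g = (\<lambda>(K, L). transmissibility M (common_edge K L) * f K L)"
  define ce where "ce = (\<lambda>(K, L). common_edge K L)"
  have "(\<Sum>K\<in>cells M. \<Sum>L\<in>cells M. edge_weight K L * f K L)
      = (\<Sum>K\<in>cells M. \<Sum>L\<in>cells M. if share_edge M K L then g (K, L) else 0)"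
    by (intro sum.cong refl) (simp add: edge_weight_def g_def)
  also have "\<dots> = sum g P"
    unfolding sum_Sigma_rel[OF fin_cells fin_cells]
    by (intro sum.cong) (auto simp: P_def share_edge_def)
  also have "\<dots> = (\<Sum>\<sigma>\<in>ce ` P. sum g {x \<in> P. ce x = \<sigma>})" by (rule sum.image_gen[OF finP])
  also have "ce ` P = int_edges M"
    unfolding int_edges_def by (force simp: int_edges_of_eq ce_def P_def share_edge_def)
  also have "(\<Sum>\<sigma>\<in>int_edges M. sum g {x \<in> P. ce x = \<sigma>}) = 2 * sum_int_edges M f"
    unfolding sum_int_edges_def sum_distrib_left
  proof (intro sum.cong refl)
    fix \<sigma> assume "\<sigma> \<in> int_edges M"
    then have "\<exists>K. K \<in> cells M \<and> \<sigma> \<in> int_edges_of M K" by (auto simp: int_edges_def)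
    then have "side_cell M \<sigma> \<in> cells M \<and> \<sigma> \<in> int_edges_of M (side_cell M \<sigma>)"
      unfolding side_cell_def by (rule someI_ex)
    then obtain L where L: "share_edge M (side_cell M \<sigma>) L" "\<sigma> = common_edge (side_cell M \<sigma>) L"
      using int_edges_of_eq by auto
    define s where "s = side_cell M \<sigma>"
    have sL: "share_edge M s L" "\<sigma> = common_edge s L" using L by (simp_all add: s_def)
    have opp: "opposite M s \<sigma> = L" using opposite_eq[OF sL(1)] sL(2) by simp
    have c: "s \<in> cells M" "L \<in> cells M" "s \<noteq> L" "\<sigma> \<in> edges M" "\<sigma> \<subseteq> closure s" "\<sigma> \<subseteq> closure L"
      using sL by (auto simp: share_edge_def common_edge_def)
    have in2: "J \<in> {s, L}" if "J \<in> cells M" "\<sigma> \<subseteq> closure J" for J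
      using no_three_cells_on_edge[OF c(4) that(1) c(1,2) that(2) c(5,6)] c(3) by auto
    have "{x \<in> P. ce x = \<sigma>} = {(s, L), (L, s)}"
    proof
      show "{(s, L), (L, s)} \<subseteq> {x \<in> P. ce x = \<sigma>}"
        using sL by (auto simp: P_def ce_def share_edge_commute common_edge_commute)
      show "{x \<in> P. ce x = \<sigma>} \<subseteq> {(s, L), (L, s)}"
      proof
        fix x assume "x \<in> {x \<in> P. ce x = \<sigma>}"
        then obtain K' L' where x: "x = (K', L')" "share_edge M K' L'" "common_edge K' L' = \<sigma>"
          by (auto simp: P_def ce_def)
        then have "K' \<in> {s, L}" "L' \<in> {s, L}" "K' \<noteq> L'"
          using in2[of K'] in2[of L'] by (auto simp: share_edge_def common_edge_def)
        then show "x \<in> {(s, L), (L, s)}" using x(1) by auto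
      qed
    qed
    then have "sum g {x \<in> P. ce x = \<sigma>} = g (s, L) + g (L, s)" using c(3) by simp
    also have "\<dots> = 2 * (transmissibility M \<sigma> * f s L)"
      unfolding g_def using sL(2) sym[of L s] by (simp add: common_edge_commute[of L s])
    finally show "sum g {x \<in> P. ce x = \<sigma>} = 2 * (transmissibility M \<sigma> * f (side_cell M \<sigma>) (opposite
        M (side_cell M \<sigma>) \<sigma>))"
      using opp by (simp add: s_def)
  qed
  finally show ?thesis by simp
qed

lemma cell_meets_domain:
  assumes "open \<Omega>" "K \<in> cells M" "finite F"
  shows "K \<inter> (\<Omega> - F) \<noteq> {}"
proof
  assume e: "K \<inter> (\<Omega> - F) = {}"
  have "K \<subseteq> closure \<Omega>" using cover assms(2) closure_subset by blast
  then have "K \<inter> closure \<Omega> \<noteq> {}" using cell(1)[OF assms(2)] by auto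
  then have "K \<inter> \<Omega> \<noteq> {}" using open_Int_closure_eq_empty[OF cell(2)[OF assms(2)]] by auto
  moreover have "open (K \<inter> \<Omega>)" using cell(2)[OF assms(2)] assms(1) by auto
  moreover have "finite (K \<inter> \<Omega>)" using e assms(3) by (metis Diff_eq_empty_iff Int_Diff finite_subset)
  ultimately show False using finite_imp_not_open by blast
qed

text \<open>Without a shared edge between \<open>S\<close> and its complement, the closures of the two groups of cells
  meet in finitely many points. Removing these points does not disconnect the domain, yet the two
  groups would separate it.\<close>

lemma mesh_connected:
  assumes \<Omega>: "open \<Omega>" "connected \<Omega>" and S: "S \<subseteq> cells M" "S \<noteq> {}" "S \<noteq> cells M"
  shows "\<exists>K\<in>S. \<exists>L\<in>cells M - S. share_edge M K L"
proof (rule ccontr)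
  assume no: "\<not> ?thesis"
  define A B where "A = (\<Union>K\<in>S. closure K)" and "B = (\<Union>K\<in>cells M - S. closure K)"
  define F where "F = (\<Union>K\<in>S. \<Union>L\<in>cells M - S. common_edge K L)"
  have finS: "finite S" using S(1) fin_cells finite_subset by blast
  have fin1: "finite (common_edge K L)" if "K \<in> S" "L \<in> cells M - S" for K L
  proof -
    have KL: "K \<in> cells M" "L \<in> cells M" "K \<noteq> L" using that S by auto
    have "\<not> share_edge M K L" using no that by auto
    then have "hausdorff1 (common_edge K L) = 0" using common[OF KL] KL by (auto simp: share_edge_def)
    then have "a = b" if "a \<in> common_edge K L" "b \<in> common_edge K L" for a b
      using convex_hausdorff1_null[OF convex_common[OF KL(1,2)]] that by blast
    then have "common_edge K L \<subseteq> {SOME a. a \<in> common_edge K L}" by (metis insertI1 someI subsetI)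
    then show ?thesis using finite_subset by blast
  qed
  then have finF: "finite F" unfolding F_def using finS fin_cells by auto
  have AB: "A \<inter> B \<subseteq> F" by (auto simp: A_def B_def F_def common_edge_def)
  have cl: "closed A" "closed B" unfolding A_def B_def using finS fin_cells by auto
  have cov: "\<Omega> - F \<subseteq> A \<union> B"
    using cover closure_subset[of \<Omega>] S(1) by (fastforce simp: A_def B_def)
  have "connected (\<Omega> - F)" using \<Omega> finF by (intro connected_open_delete_finite) auto
  then have "A \<inter> (\<Omega> - F) = {} \<or> B \<inter> (\<Omega> - F) = {}"
    using cl cov AB unfolding connected_closed by blast
  moreover obtain K where "K \<in> S" using S by auto
  then have "A \<inter> (\<Omega> - F) \<noteq> {}"
    using cell_meets_domain[OF \<Omega>(1) _ finF, of K] S(1) closure_subset[of K] by (auto simp: A_def)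
  moreover obtain L where "L \<in> cells M - S" using S by auto
  then have "B \<inter> (\<Omega> - F) \<noteq> {}"
    using cell_meets_domain[OF \<Omega>(1) _ finF, of L] closure_subset[of L] by (auto simp: B_def)
  ultimately show False by blast
qed

lemma cell_lmeasurable: "K \<in> cells M \<Longrightarrow> K \<in> lmeasurable"
  using cell(2,3) by (simp add: polygonal_def lmeasurable_open)

lemma area_pos: "K \<in> cells M \<Longrightarrow> area K > 0"
  using negligible_iff_measure0[OF cell_lmeasurable] open_not_negligible[OF cell(2) cell(1)]
  by (simp add: less_le)

lemma mesh_size_pos:
  assumes "cells M \<noteq> {}"
  shows "mesh_size M > 0"
proof -
  obtain K where K: "K \<in> cells M" using assms by auto
  have "infinite K" using finite_imp_not_open cell(1,2)[OF K] by blast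
  then obtain x y where xy: "x \<in> K" "y \<in> K" "x \<noteq> y"
    by (metis finite.emptyI finite.insertI finite_subset insertI1 subsetI)
  have "bounded K" using cell(3)[OF K] by (simp add: polygonal_def)
  then have "dist x y \<le> diameter K" using xy diameter_bounded_bound by blast
  then have "0 < diameter K" using xy(3) by (metis less_le_trans zero_less_dist_iff)
  also have "\<dots> \<le> mesh_size M" unfolding mesh_size_def using K fin_cells by (intro Max_ge) auto
  finally show ?thesis .
qed

lemma cell_inside_ae:
  assumes "open \<Omega>" "polygonal \<Omega>" "K \<in> cells M"
  shows "negligible (K - \<Omega>)"
proof -
  have "K - \<Omega> \<subseteq> frontier \<Omega>"
    using cover assms(3) closure_subset[of K] assms(1) by (fastforce simp: frontier_def interior_open)
  then show ?thesis using negligible_frontier_polygonal[OF assms(2)] negligible_subset by blast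
qed

text \<open>Cells and domain differ by null sets only, namely parts of the boundary of the polygonal
  domain and of the boundaries of convex cells.\<close>

lemma integral_cells:
  assumes \<Omega>: "open \<Omega>" "polygonal \<Omega>" and f: "set_integrable lebesgue \<Omega> (f :: pt \<Rightarrow> real)"
  shows "K \<in> cells M \<Longrightarrow> set_integrable lebesgue K f"
    and "(\<Sum>K\<in>cells M. LINT x:K|lebesgue. f x) = (LINT x:\<Omega>|lebesgue. f x)"
proof -
  have int: "set_integrable lebesgue K f" if K: "K \<in> cells M" for K
  proof -
    have "set_integrable lebesgue (K \<inter> \<Omega>) f"
      using f cell(2)[OF K] \<Omega> by (intro set_integrable_subset[OF f]) auto
    moreover have "{x \<in> (K \<inter> \<Omega>) - K. f x \<noteq> 0} = {}" by auto
    then have "negligible {x \<in> (K \<inter> \<Omega>) - K. f x \<noteq> 0}" by (simp only: negligible_empty)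
    moreover have "negligible {x \<in> K - (K \<inter> \<Omega>). f x \<noteq> 0}"
      using cell_inside_ae[OF \<Omega> K] by (rule negligible_subset) auto
    ultimately show ?thesis using absolutely_integrable_spike_set by blast
  qed
  then show "K \<in> cells M \<Longrightarrow> set_integrable lebesgue K f" by blast
  have "(f has_integral (\<Sum>K\<in>cells M. integral K f)) (\<Union>(cells M))"
  proof (rule has_integral_Union[OF fin_cells])
    fix K assume "K \<in> cells M"
    then show "(f has_integral integral K f) K"
      using set_lebesgue_integral_eq_integral(1)[OF int] by (simp add: integrable_integral)
  next
    show "pairwise (\<lambda>S S'. negligible (S \<inter> S')) (cells M)"
      using cell_disjoint by (auto simp: pairwise_def)
  qed
  then have "integral (\<Union>(cells M)) f = (\<Sum>K\<in>cells M. integral K f)" by (rule integral_unique)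
  moreover have "integral (\<Union>(cells M)) f = integral \<Omega> f"
  proof (rule integral_spike_set)
    have "negligible (\<Union>K\<in>cells M. K - \<Omega>)"
      using fin_cells cell_inside_ae[OF \<Omega>] by (intro negligible_Union) auto
    then show "negligible {x \<in> \<Union>(cells M) - \<Omega>. f x \<noteq> 0}" by (rule negligible_subset) auto
    have neg: "negligible (\<Union>K\<in>cells M. frontier K)"
      using fin_cells cell(4) by (intro negligible_Union) (auto intro: negligible_convex_frontier)
    have sub: "\<Omega> - \<Union>(cells M) \<subseteq> (\<Union>K\<in>cells M. frontier K)"
    proof
      fix x assume x: "x \<in> \<Omega> - \<Union>(cells M)"
      then obtain K where "K \<in> cells M" "x \<in> closure K" using cover closure_subset[of \<Omega>] by blast
      then show "x \<in> (\<Union>K\<in>cells M. frontier K)"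
        using x cell(2) by (auto simp: frontier_def interior_open)
    qed
    show "negligible {x \<in> \<Omega> - \<Union>(cells M). f x \<noteq> 0}"
      by (rule negligible_subset[OF neg]) (use sub in auto)
  qed
  ultimately show "(\<Sum>K\<in>cells M. LINT x:K|lebesgue. f x) = (LINT x:\<Omega>|lebesgue. f x)"
    using set_lebesgue_integral_eq_integral(2)[OF int] set_lebesgue_integral_eq_integral(2)[OF f] by simp
qed

lemma AE_cell:
  assumes "open \<Omega>" "polygonal \<Omega>" "K \<in> cells M" "AE x\<in>\<Omega> in lebesgue. P x"
  shows "AE x\<in>K in lebesgue. P x"
proof -
  have "AE x in lebesgue. x \<notin> K - \<Omega>"
    using cell_inside_ae[OF assms(1-3)] by (intro AE_not_in) (simp add: negligible_iff_null_sets)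
  with assms(4) show ?thesis by eventually_elim auto
qed

end

lemma L2_on_imp_set_integrable:
  assumes "L2_on S (f :: pt \<Rightarrow> real)" "S \<in> lmeasurable"
  shows "set_integrable lebesgue S f"
proof -
  have "integrable lebesgue (indicat_real S)"
    using assms(2) by (intro integrable_real_indicator) (auto simp: fmeasurable_def)
  then have 1: "set_integrable lebesgue S (\<lambda>x. 1 + (norm (f x))\<^sup>2)"
    using assms by (intro set_integral_add) (auto simp: L2_on_def set_integrable_def)
  show ?thesis
    unfolding set_integrable_def using abs_le_one_plus_square 1[unfolded set_integrable_def] assms(1)
    by (rule_tac Bochner_Integration.integrable_bound)
      (auto simp: L2_on_def set_borel_measurable_def indicator_def)
qed

section \<open>Time stepping and energy decay\<close>

text \<open>The tangent inequality, including \<open>r = 0\<close>: the initial concentrations may vanish in a cell.\<close>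

lemma H_ent_convex:
  assumes "0 < s" "0 \<le> r"
  shows "H_ent s - H_ent r \<le> ln s * (s - r)"
proof (cases "r = 0")
  case True
  then show ?thesis using assms by (simp add: H_ent_def algebra_simps)
next
  case False
  then have r: "r > 0" using assms by simp
  have "ln (s / r) \<le> s / r - 1" using assms r by (intro ln_le_minus_one) simp
  then have "r * ln (s / r) \<le> r * (s / r - 1)" using r by (intro mult_left_mono) auto
  also have "\<dots> = s - r" using r by (simp add: field_simps)
  finally have "r * (ln s - ln r) \<le> s - r" using assms r by (simp add: ln_div)
  then show ?thesis by (simp add: H_ent_def algebra_simps)
qed

locale ch_scheme = fv_mesh "dom D" M for D :: ch_data and M :: mesh +
  fixes N :: nat
  assumes valid: "valid_data D" and N1: "N \<ge> 1"
    and trans_pos: "\<sigma> \<in> int_edges M \<Longrightarrow> transmissibility M \<sigma> > 0"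
begin

lemma dom_facts: "open (dom D)" "bounded (dom D)" "connected (dom D)" "polygonal (dom D)"
  and param_pos: "alpha D > 0" "kappa D > 0" "rho D > 0" "time_step D N > 0"
  and eta_pos: "i \<in> {1, 2} \<Longrightarrow> eta D i > 0"
  using valid N1 by (auto simp: valid_data_def time_step_def)

lemma cinit_facts:
  assumes "i \<in> {1, 2}"
  shows "set_integrable lebesgue (dom D) (cinit D i)"
    "AE x\<in>dom D in lebesgue. cinit D i x \<ge> 0" "(LINT x:dom D|lebesgue. cinit D i x) > 0"
proof -
  have "L2_on (dom D) (cinit D i)" using valid assms by (auto simp: valid_data_def H1_def)
  then show "set_integrable lebesgue (dom D) (cinit D i)"
    using dom_facts by (intro L2_on_imp_set_integrable lmeasurable_open)
  show "AE x\<in>dom D in lebesgue. cinit D i x \<ge> 0" "(LINT x:dom D|lebesgue. cinit D i x) > 0"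
    using valid assms by (auto simp: valid_data_def)
qed

abbreviation c_init :: "nat \<Rightarrow> pt set \<Rightarrow> real" where
  "c_init i K \<equiv> cell_average (cinit D i) K"

lemma c_init_mass:
  assumes "i \<in> {1, 2}"
  shows "(\<Sum>K\<in>cells M. area K * c_init i K) = (LINT x:dom D|lebesgue. cinit D i x)"
proof -
  have "(\<Sum>K\<in>cells M. area K * c_init i K) = (\<Sum>K\<in>cells M. LINT x:K|lebesgue. cinit D i x)"
  proof (intro sum.cong refl)
    fix K assume "K \<in> cells M"
    then show "area K * c_init i K = (LINT x:K|lebesgue. cinit D i x)"
      using area_pos[of K] by (simp add: cell_average_def)
  qed
  then show ?thesis using integral_cells(2)[OF dom_facts(1,4) cinit_facts(1)[OF assms]] by simp
qed

lemma cells_nonempty: "cells M \<noteq> {}"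
proof
  assume e: "cells M = {}"
  have i: "1 \<in> {1, 2::nat}" by simp
  have "0 = (LINT x:dom D|lebesgue. cinit D 1 x)"
    using c_init_mass[OF i] unfolding e by (simp only: sum.empty)
  then show False using cinit_facts(3)[OF i] by linarith
qed

lemma c_init_bounds:
  assumes K: "K \<in> cells M"
  shows "i \<in> {1, 2} \<Longrightarrow> 0 \<le> c_init i K" "c_init 1 K + c_init 2 K = 1"
proof -
  show "0 \<le> c_init i K" if i: "i \<in> {1, 2}"
  proof -
    have "AE x\<in>K in lebesgue. cinit D i x \<ge> 0"
      by (rule AE_cell[OF dom_facts(1,4) K cinit_facts(2)[OF i]])
    then have "(LINT x:K|lebesgue. cinit D i x) \<ge> 0"
      unfolding set_lebesgue_integral_def
      by (intro integral_nonneg_AE) (auto simp: indicator_def elim: eventually_mono)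
    then show ?thesis by (simp add: cell_average_def)
  qed
  have int: "set_integrable lebesgue K (cinit D i)" if "i \<in> {1, 2}" for i
    using integral_cells(1)[OF dom_facts(1,4) cinit_facts(1)[OF that] K] .
  have "AE x\<in>dom D in lebesgue. cinit D 1 x + cinit D 2 x = 1" using valid by (simp only: valid_data_def)
  then have ae: "AE x\<in>K in lebesgue. cinit D 1 x + cinit D 2 x = 1"
    by (rule AE_cell[OF dom_facts(1,4) K])
  have "(LINT x:K|lebesgue. cinit D 1 x) + (LINT x:K|lebesgue. cinit D 2 x)
      = (LINT x:K|lebesgue. cinit D 1 x + cinit D 2 x)"
    using int by (simp add: set_integral_add)
  also have "\<dots> = (LINT x:K|lebesgue. 1)"
    unfolding set_lebesgue_integral_def
  proof (rule integral_cong_AE)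
    show "(\<lambda>x. indicat_real K x *\<^sub>R (cinit D 1 x + cinit D 2 x)) \<in> borel_measurable lebesgue"
      using set_integral_add(1)[OF int[of 1] int[of 2]] unfolding set_integrable_def by simp
    show "(\<lambda>x. indicat_real K x *\<^sub>R (1::real)) \<in> borel_measurable lebesgue"
      by (intro borel_measurable_scaleR borel_measurable_indicator borel_measurable_const)
        (use cell_lmeasurable[OF K] in \<open>simp add: fmeasurable_def\<close>)
    show "AE x in lebesgue. indicat_real K x *\<^sub>R (cinit D 1 x + cinit D 2 x)
        = indicat_real K x *\<^sub>R (1::real)"
      using ae by eventually_elim (simp add: indicator_def)
  qed
  also have "\<dots> = area K" using cell_lmeasurable[OF K]
      by (simp add: set_lebesgue_integral_def fmeasurable_def)
  finally show "c_init 1 K + c_init 2 K = 1"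
    using area_pos[OF K] by (simp add: cell_average_def add_divide_distrib[symmetric])
qed

definition conc_state :: "(nat \<Rightarrow> pt set \<Rightarrow> real) \<Rightarrow> bool" where
  "conc_state c \<longleftrightarrow> (\<forall>K\<in>cells M. (\<forall>i\<in>{1, 2}. 0 \<le> c i K) \<and> c 1 K + c 2 K = 1) \<and>
     (\<forall>i\<in>{1, 2}. (\<Sum>K\<in>cells M. area K * c i K) = (LINT x:dom D|lebesgue. cinit D i x))"

definition time_advance ::
  "(nat \<Rightarrow> pt set \<Rightarrow> real) \<Rightarrow> (nat \<Rightarrow> pt set \<Rightarrow> real) \<Rightarrow> (nat \<Rightarrow> pt set \<Rightarrow> real) \<Rightarrow> bool" where
  "time_advance c' c \<mu> \<longleftrightarrow>
     (\<forall>K\<in>cells M. \<forall>i\<in>{1, 2}.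
        area K * ((c i K - c' i K) / time_step D N)
        + sum_cell_edges M K (\<lambda>K L.
            edge_conc (c i K) (c i L) / eta D i
              * (\<mu> i K + Psi_cell D i K - \<mu> i L - Psi_cell D i L)
            + theta_mesh D M i * (c i K - c i L)) = 0) \<and>
     (\<forall>K\<in>cells M.
        \<mu> 1 K - \<mu> 2 K
          = alpha D / area K * sum_cell_edges M K (\<lambda>K L. c 1 K - c 1 L)
            + kappa D * (1 - 2 * c' 1 K)) \<and>
     (\<Sum>K\<in>cells M. area K * (c 1 K * \<mu> 1 K + c 2 K * \<mu> 2 K)) = 0 \<and>
     (\<forall>i\<in>{1, 2}. \<forall>K\<in>cells M. 0 < c i K \<and> c i K < 1) \<and>
     (energy D M c - energy D M c') / time_step D N + dissipation D M c \<mu> \<le> 0"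

text \<open>The graph problem is solved with generalised potentials; subtracting the external and
  logarithmic parts yields chemical potentials, and a common constant added to both of them achieves
  the normalisation of their weighted mean without changing any other equation. For the energy, the
  gradient term and the entropies are convex and the mixing term is concave but linearised at the
  old concentration, so the energy increment is at most the increment of \<open>c\<close> tested with
  \<open>p1 - p2\<close>, which equals minus the time step times the dissipation.\<close>

lemma time_advance_exists:
  assumes st: "conc_state c'"
  shows "\<exists>c \<mu>. conc_state c \<and> time_advance c' c \<mu>"
proof -
  define z where "z = c' 1"
  define \<beta> where "\<beta> i = theta_mesh D M i * eta D i" for i
  have \<theta>: "theta_mesh D M i > 0" for i
    using mult_pos_pos[OF param_pos(3) mesh_size_pos[OF cells_nonempty]]
    by (simp add: theta_mesh_def less_max_iff_disj)
  have \<beta>: "\<beta> 1 > 0" "\<beta> 2 > 0" using \<theta> eta_pos by (auto simp: \<beta>_def)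
  have z2: "c' 2 K = 1 - z K" if "K \<in> cells M" for K using st that by (force simp: conc_state_def z_def)
  have z01: "0 \<le> z K \<and> z K \<le> 1" if "K \<in> cells M" for K
    using st that z2[OF that] by (force simp: conc_state_def z_def)
  have mass: "(\<Sum>K\<in>cells M. area K * z K) = (LINT x:dom D|lebesgue. cinit D 1 x)"
    "(\<Sum>K\<in>cells M. area K * (1 - z K)) = (LINT x:dom D|lebesgue. cinit D 2 x)"
    using st z2 by (auto simp: conc_state_def z_def cong: sum.cong)
  define b where "b K = kappa D * (1 - 2 * z K) + Psi_cell D 1 K - Psi_cell D 2 K" for K
  define T where "T = time_step D N"
  have T: "T > 0" using param_pos by (simp add: T_def)
  interpret implicit_step "cells M" area edge_weight z b "alpha D" "\<beta> 1" "\<beta> 2" "eta D 1" "eta D 2" T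
  proof
    have wpos: "edge_weight K L > 0" if "share_edge M K L" for K L
    proof -
      have "common_edge K L \<in> int_edges M"
        using that int_edges_of_eq[of K] by (auto simp: int_edges_def share_edge_def)
      then show ?thesis using trans_pos that by (simp add: edge_weight_def)
    qed
    then show "0 \<le> edge_weight K L" for K L by (cases "share_edge M K L") (auto simp:
        edge_weight_def less_imp_le)
    show "\<exists>K\<in>S. \<exists>L\<in>cells M - S. edge_weight K L > 0" if "S \<subseteq> cells M" "S \<noteq> {}" "S \<noteq> cells M" for S
      using mesh_connected[OF dom_facts(1,3) that] wpos by blast
  qed (use fin_cells area_pos edge_weight_sym z01 mass cinit_facts(3) param_pos eta_pos \<beta> T in auto)
  obtain c1 p1 p2 where sol: "\<And>K. K \<in> cells M \<Longrightarrow> 0 < c1 K \<and> c1 K < 1 \<and>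
     area K * (c1 K - z K) + T * laplacian (cells M) (\<lambda>K L. edge_weight K L * (edge_conc (c1 K) (c1
         L) / eta D 1)) p1 K = 0 \<and>
     - (area K * (c1 K - z K)) + T * laplacian (cells M) (\<lambda>K L. edge_weight K L * (edge_conc (1 - c1
         K) (1 - c1 L) / eta D 2)) p2 K = 0 \<and>
     p1 K - p2 K = alpha D / area K * laplacian (cells M) edge_weight c1 K + b K
         + \<beta> 1 * ln (c1 K) - \<beta> 2 * ln (1 - c1 K)"
    using step_exists by blast
  define c where "c i K = (if i = 1 then c1 K else 1 - c1 K)" for i :: nat and K
  define p where "p i K = (if i = 1 then p1 K else p2 K)" for i :: nat and K
  define \<mu>0 where "\<mu>0 i K = p i K - Psi_cell D i K - \<beta> i * ln (c i K)" for i K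
  define sh where "sh = - (\<Sum>K\<in>cells M. area K * (c 1 K * \<mu>0 1 K
      + c 2 K * \<mu>0 2 K)) / (\<Sum>K\<in>cells M. area K)"
  define \<mu> where "\<mu> i K = \<mu>0 i K + sh" for i K
  have c01: "0 < c i K \<and> c i K < 1" if "K \<in> cells M" for i K using sol[OF that] by (simp add: c_def)
  have csum: "c 1 K + c 2 K = 1" for K by (simp add: c_def)
  define a where "a i K L = edge_weight K L * (edge_conc (c i K) (c i L) / eta D i)" for i K L
  have asym: "a i K L = a i L K" for i K L by (simp add: a_def edge_conc_commute edge_weight_sym)
  have bal: "area K * (c i K - c' i K) + T * laplacian (cells M) (a i) (p i) K = 0"
    if "K \<in> cells M" "i \<in> {1, 2}" for i K
  proof -
    have "laplacian (cells M) (a 1) (p 1) K = laplacian (cells M) (\<lambda>K L. edge_weight K L *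
        (edge_conc (c1 K) (c1 L) / eta D 1)) p1 K"
      "laplacian (cells M) (a 2) (p 2) K = laplacian (cells M) (\<lambda>K L. edge_weight K L * (edge_conc
          (1 - c1 K) (1 - c1 L) / eta D 2)) p2 K"
      by (simp_all add: laplacian_def a_def c_def p_def)
    moreover have "area K * (c 2 K - c' 2 K) = - (area K * (c1 K - z K))"
      unfolding z2[OF that(1)] by (simp add: c_def algebra_simps)
    ultimately show ?thesis using sol[OF that(1)] that(2) by (auto simp: c_def z_def)
  qed
  have pdiff: "\<mu> i K + Psi_cell D i K - \<mu> i L - Psi_cell D i L + \<beta> i * (ln (c i K) - ln (c i L))
      = p i K - p i L" for i K L
    by (simp add: \<mu>_def \<mu>0_def algebra_simps)
  have flux: "edge_conc (c i K) (c i L) / eta D i * (\<mu> i K + Psi_cell D i K - \<mu> i L - Psi_cell D i L)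
      + theta_mesh D M i * (c i K - c i L) = edge_conc (c i K) (c i L) / eta D i * (p i K - p i L)"
    if "K \<in> cells M" "L \<in> cells M" "i \<in> {1, 2}" for i K L
  proof -
    have "edge_conc (c i K) (c i L) / eta D i * (\<beta> i * (ln (c i K) - ln (c i L)))
      = theta_mesh D M i * (edge_conc (c i K) (c i L) * (ln (c i K) - ln (c i L)))"
      using eta_pos[OF that(3)] by (simp add: \<beta>_def)
    also have "\<dots> = theta_mesh D M i * (c i K - c i L)"
      using c01[OF that(1)] c01[OF that(2)] by (simp add: edge_conc_mult_ln)
    finally show ?thesis unfolding pdiff[symmetric] by (simp only: distrib_left)
  qed
  have S1: "area K * ((c i K - c' i K) / time_step D N)
        + sum_cell_edges M K (\<lambda>K L.
            edge_conc (c i K) (c i L) / eta D i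
              * (\<mu> i K + Psi_cell D i K - \<mu> i L - Psi_cell D i L)
            + theta_mesh D M i * (c i K - c i L)) = 0"
    if K: "K \<in> cells M" and i: "i \<in> {1, 2}" for K i
  proof -
    have "sum_cell_edges M K (\<lambda>K L.
            edge_conc (c i K) (c i L) / eta D i
              * (\<mu> i K + Psi_cell D i K - \<mu> i L - Psi_cell D i L)
            + theta_mesh D M i * (c i K - c i L)) = laplacian (cells M) (a i) (p i) K"
      unfolding sum_cell_edges_eq[OF K] laplacian_def a_def
      using flux[OF K _ i] by (intro sum.cong refl) (simp add: mult.assoc)
    moreover have "area K * ((c i K - c' i K) / T) + laplacian (cells M) (a i) (p i) K = 0"
      using bal[OF K i] T by (simp add: field_simps)
    ultimately show ?thesis by (simp add: T_def)
  qed
  have S2: "\<mu> 1 K - \<mu> 2 K = alpha D / area K * sum_cell_edges M K (\<lambda>K L. c 1 K - c 1 L)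
      + kappa D * (1 - 2 * c' 1 K)"
    if K: "K \<in> cells M" for K
  proof -
    have "sum_cell_edges M K (\<lambda>K L. c 1 K - c 1 L) = laplacian (cells M) edge_weight c1 K"
      unfolding sum_cell_edges_eq[OF K] laplacian_def by (simp add: c_def)
    moreover have "p1 K - p2 K = alpha D / area K * laplacian (cells M) edge_weight c1 K + b K
        + \<beta> 1 * ln (c1 K) - \<beta> 2 * ln (1 - c1 K)"
      using sol[OF K] by blast
    ultimately show ?thesis by (simp add: \<mu>_def \<mu>0_def p_def c_def b_def z_def)
  qed
  have "(\<Sum>K\<in>cells M. area K) > 0" using area_pos fin_cells cells_nonempty by (intro sum_pos) auto
  moreover have "(\<Sum>K\<in>cells M. area K * (c 1 K * \<mu> 1 K + c 2 K * \<mu> 2 K))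
      = (\<Sum>K\<in>cells M. area K * (c 1 K * \<mu>0 1 K + c 2 K * \<mu>0 2 K)) + (\<Sum>K\<in>cells M. area K) * sh"
    unfolding sum_distrib_right sum.distrib[symmetric]
  proof (intro sum.cong refl)
    fix K
    have "area K * (c 1 K * \<mu> 1 K + c 2 K * \<mu> 2 K)
        = area K * (c 1 K * \<mu>0 1 K + c 2 K * \<mu>0 2 K) + area K * ((c 1 K + c 2 K) * sh)"
      unfolding \<mu>_def by (simp only: distrib_left distrib_right add_ac)
    then show "area K * (c 1 K * \<mu> 1 K + c 2 K * \<mu> 2 K)
        = area K * (c 1 K * \<mu>0 1 K + c 2 K * \<mu>0 2 K) + area K * sh"
      by (simp only: csum mult_1)
  qed
  ultimately have S4: "(\<Sum>K\<in>cells M. area K * (c 1 K * \<mu> 1 K + c 2 K * \<mu> 2 K)) = 0"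
    unfolding sh_def by (simp only: nonzero_mult_div_cancel_left times_divide_eq_right
        less_numeral_extra)
  have st': "conc_state c"
    unfolding conc_state_def
  proof (intro conjI ballI)
    fix K i assume "K \<in> cells M" then show "0 \<le> c i K" using c01[of K i] by simp
  next
    fix K show "c 1 K + c 2 K = 1" by (rule csum)
  next
    fix i :: nat assume i: "i \<in> {1, 2}"
    have "0 = (\<Sum>K\<in>cells M. area K * (c i K - c' i K) + T * laplacian (cells M) (a i) (p i) K)"
      using bal i by simp
    also have "\<dots> = (\<Sum>K\<in>cells M. area K * c i K) - (\<Sum>K\<in>cells M. area K * c' i K)"
      by (simp add: sum.distrib sum_subtractf right_diff_distrib sum_distrib_left[symmetric]
          sum_laplacian asym)
    finally have "(\<Sum>K\<in>cells M. area K * c i K) = (\<Sum>K\<in>cells M. area K * c' i K)" by simp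
    also have "\<dots> = (LINT x:dom D|lebesgue. cinit D i x)" using st i unfolding conc_state_def by blast
    finally show "(\<Sum>K\<in>cells M. area K * c i K) = (LINT x:dom D|lebesgue. cinit D i x)" .
  qed
  have diss: "dissipation D M c \<mu> = dirichlet (a 1) (p 1) + dirichlet (a 2) (p 2)"
  proof -
    have "sum_int_edges M (\<lambda>K L. edge_conc (c i K) (c i L) / eta D i *
          (\<mu> i K + Psi_cell D i K - \<mu> i L - Psi_cell D i L
           + theta_mesh D M i * eta D i * (ln (c i K) - ln (c i L)))\<^sup>2) = dirichlet (a i) (p i)" for i
      unfolding pdiff[of i, unfolded \<beta>_def]
      by (subst sum_int_edges_eq) (simp_all add: dirichlet_def a_def mult.assoc edge_conc_commute
          power2_commute)
    then show ?thesis by (simp add: dissipation_def)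
  qed
  \<comment> \<open>Convexity of the gradient energy.\<close>
  have grad: "alpha D / 2 * sum_int_edges M (\<lambda>K L. (c 1 K - c 1 L)\<^sup>2) - alpha D / 2 * sum_int_edges
      M (\<lambda>K L. (c' 1 K - c' 1 L)\<^sup>2)
      \<le> alpha D * (\<Sum>K\<in>cells M. laplacian (cells M) edge_weight c1 K * (c1 K - z K))"
  proof -
    have "(c1 K - c1 L)\<^sup>2 - (z K - z L)\<^sup>2 \<le> 2 * ((c1 K - c1 L) * ((c1 K - z K) - (c1 L - z L)))" for K L
      using zero_le_power2[of "(c1 K - c1 L) - (z K - z L)"]
          by (simp add: power2_eq_square algebra_simps)
    then have "edge_weight K L * ((c1 K - c1 L)\<^sup>2 - (z K - z L)\<^sup>2)
        \<le> edge_weight K L * (2 * ((c1 K - c1 L) * ((c1 K - z K) - (c1 L - z L))))"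
      if "K \<in> cells M" "L \<in> cells M" for K L using w_nonneg[OF that] by (intro mult_left_mono) auto
    then have "(\<Sum>K\<in>cells M. \<Sum>L\<in>cells M. edge_weight K L * ((c1 K - c1 L)\<^sup>2 - (z K - z L)\<^sup>2))
       \<le> (\<Sum>K\<in>cells M. \<Sum>L\<in>cells M. edge_weight K L * (2 * ((c1 K - c1 L) * ((c1 K - z K) - (c1 L - z
           L)))))"
      by (intro sum_mono) auto
    also have "\<dots> = 4 * (\<Sum>K\<in>cells M. laplacian (cells M) edge_weight c1 K * (c1 K - z K))"
      unfolding sum_laplacian_mult[of "cells M" edge_weight, OF edge_weight_sym]
          by (simp add: sum_distrib_left mult_ac)
    finally have "sum_int_edges M (\<lambda>K L. (c 1 K - c 1 L)\<^sup>2) - sum_int_edges M (\<lambda>K L. (c' 1 K - c' 1 L)\<^sup>2)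
      \<le> 2 * (\<Sum>K\<in>cells M. laplacian (cells M) edge_weight c1 K * (c1 K - z K))"
      by (subst (1 2) sum_int_edges_eq)
        (simp_all add: power2_commute c_def z_def right_diff_distrib sum_subtractf
            diff_divide_distrib[symmetric])
    from mult_left_mono[OF this, of "alpha D / 2"] show ?thesis using param_pos
        by (simp add: right_diff_distrib)
  qed
  \<comment> \<open>Convexity of the entropies and concavity of the mixing energy, cell by cell.\<close>
  have bulk: "(kappa D * c 1 K * c 2 K + (\<Sum>i\<in>{1, 2}. c i K * Psi_cell D i K
      + theta_mesh D M i * eta D i * H_ent (c i K)))
      - (kappa D * c' 1 K * c' 2 K + (\<Sum>i\<in>{1, 2}. c' i K * Psi_cell D i K
          + theta_mesh D M i * eta D i * H_ent (c' i K)))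
      \<le> (b K + \<beta> 1 * ln (c1 K) - \<beta> 2 * ln (1 - c1 K)) * (c1 K - z K)" if K: "K \<in> cells M" for K
  proof -
    have 1: "\<beta> 1 * (H_ent (c1 K) - H_ent (z K)) \<le> \<beta> 1 * (ln (c1 K) * (c1 K - z K))"
      using sol[OF K] z01[OF K] \<beta> by (intro mult_left_mono H_ent_convex) auto
    have 2: "\<beta> 2 * (H_ent (1 - c1 K) - H_ent (1 - z K))
        \<le> \<beta> 2 * (ln (1 - c1 K) * ((1 - c1 K) - (1 - z K)))"
      using sol[OF K] z01[OF K] \<beta> by (intro mult_left_mono H_ent_convex) auto
    have 3: "kappa D * (c1 K * (1 - c1 K) - z K * (1 - z K)) \<le> kappa D * ((1 - 2 * z K) * (c1 K - z K))"
    proof (rule mult_left_mono)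
      show "c1 K * (1 - c1 K) - z K * (1 - z K) \<le> (1 - 2 * z K) * (c1 K - z K)"
        using zero_le_power2[of "c1 K - z K"] by (simp add: power2_eq_square algebra_simps)
    qed (use param_pos in simp)
    have e: "c 1 K = c1 K" "c 2 K = 1 - c1 K" "c' 1 K = z K" "c' 2 K = 1 - z K"
      using z2[OF K] by (simp_all add: c_def z_def)
    have s: "(\<Sum>i\<in>{1, 2::nat}. f i) = f 1 + f 2" for f :: "nat \<Rightarrow> real" by simp
    show ?thesis
      using 1 2 3 unfolding s e \<beta>_def b_def by (simp add: algebra_simps)
  qed
  have "energy D M c - energy D M c' \<le> alpha D * (\<Sum>K\<in>cells M. laplacian (cells M) edge_weight c1 K *
      (c1 K - z K))
      + (\<Sum>K\<in>cells M. area K * ((b K + \<beta> 1 * ln (c1 K) - \<beta> 2 * ln (1 - c1 K)) * (c1 K - z K)))"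
  proof -
    have "(\<Sum>K\<in>cells M. area K * ((kappa D * c 1 K * c 2 K + (\<Sum>i\<in>{1, 2}. c i K * Psi_cell D i K
        + theta_mesh D M i * eta D i * H_ent (c i K)))
      - (kappa D * c' 1 K * c' 2 K + (\<Sum>i\<in>{1, 2}. c' i K * Psi_cell D i K
          + theta_mesh D M i * eta D i * H_ent (c' i K)))))
      \<le> (\<Sum>K\<in>cells M. area K * ((b K + \<beta> 1 * ln (c1 K) - \<beta> 2 * ln (1 - c1 K)) * (c1 K - z K)))"
      using bulk area_pos by (intro sum_mono mult_left_mono) (auto simp: less_imp_le simp del:
          sum.insert)
    then show ?thesis using grad unfolding energy_def right_diff_distrib sum_subtractf by linarith
  qed
  also have "\<dots> = (\<Sum>K\<in>cells M. area K * (c1 K - z K) * (p1 K - p2 K))"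
    unfolding sum_distrib_left sum.distrib[symmetric]
  proof (intro sum.cong refl)
    fix K assume K: "K \<in> cells M"
    have "p1 K - p2 K = alpha D / area K * laplacian (cells M) edge_weight c1 K + b K
        + \<beta> 1 * ln (c1 K) - \<beta> 2 * ln (1 - c1 K)"
      using sol[OF K] by blast
    then have pq: "p1 K - p2 K = alpha D / area K * laplacian (cells M) edge_weight c1 K + (b K
        + \<beta> 1 * ln (c1 K) - \<beta> 2 * ln (1 - c1 K))"
      by linarith
    have "area K \<noteq> 0" using area_pos[OF K] by simp
    then have "area K * (\<alpha>' / area K * l + P) * u = \<alpha>' * (l * u) + area K * (P * u)" for \<alpha>' l P u
      by (simp add: distrib_left distrib_right)
    from this[of "alpha D" "laplacian (cells M) edge_weight c1 K" "b K
        + \<beta> 1 * ln (c1 K) - \<beta> 2 * ln (1 - c1 K)" "c1 K - z K"]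
    show "alpha D * (laplacian (cells M) edge_weight c1 K * (c1 K - z K))
        + area K * ((b K + \<beta> 1 * ln (c1 K) - \<beta> 2 * ln (1 - c1 K)) * (c1 K - z K))
            = area K * (c1 K - z K) * (p1 K - p2 K)"
      unfolding pq[symmetric] by (simp only: mult_ac)
  qed
  also have "\<dots> = (\<Sum>K\<in>cells M. - T * (laplacian (cells M) (a 1) (p 1) K * p 1 K)
      + - T * (laplacian (cells M) (a 2) (p 2) K * p 2 K))"
  proof (intro sum.cong refl)
    fix K assume K: "K \<in> cells M"
    have 1: "area K * (c1 K - z K) = - T * laplacian (cells M) (a 1) (p 1) K"
      using bal[OF K, of 1] by (simp add: c_def z_def)
    have "area K * (c 2 K - c' 2 K) = - (area K * (c1 K - z K))"
      unfolding z2[OF K] by (simp add: c_def algebra_simps)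
    then have 2: "area K * (c1 K - z K) = T * laplacian (cells M) (a 2) (p 2) K"
      using bal[OF K, of 2] by simp
    have "area K * (c1 K - z K) * (p1 K - p2 K)
        = area K * (c1 K - z K) * p1 K - area K * (c1 K - z K) * p2 K"
      by (rule right_diff_distrib)
    also have "\<dots> = - T * laplacian (cells M) (a 1) (p 1) K * p1 K - T * laplacian (cells M) (a 2) (p
        2) K * p2 K"
      using 1 2 by simp
    finally show "area K * (c1 K - z K) * (p1 K - p2 K)
       = - T * (laplacian (cells M) (a 1) (p 1) K * p 1 K)
           + - T * (laplacian (cells M) (a 2) (p 2) K * p 2 K)"
      by (simp add: p_def mult.assoc)
  qed
  also have "\<dots> = - T * dissipation D M c \<mu>"
    unfolding sum.distrib sum_distrib_left[symmetric] diss
    by (simp only: sum_laplacian_self[of "a 1", OF asym] sum_laplacian_self[of "a 2", OF asym]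
        distrib_left)
  finally have "energy D M c - energy D M c' \<le> - T * dissipation D M c \<mu>" .
  then have "(energy D M c - energy D M c') / T \<le> - dissipation D M c \<mu>"
    using T by (simp add: pos_divide_le_eq mult.commute)
  then have en: "(energy D M c - energy D M c') / time_step D N + dissipation D M c \<mu> \<le> 0"
      by (simp add: T_def)
  have "time_advance c' c \<mu>"
    unfolding time_advance_def using S1 S2 S4 c01 en by blast
  with st' show ?thesis by blast
qed

lemma conc_state_init: "conc_state (\<lambda>i. c_init i)"
  unfolding conc_state_def using c_init_bounds c_init_mass by blast

end

theorem theorem2p3:
  fixes D :: ch_data and M :: mesh and N l :: nat
    and \<zeta> \<tau>lo \<tau>hi C_FI \<gamma> :: real
  assumes "valid_data D"
    and "\<zeta> > 1" and "l \<ge> 3" and "0 < \<tau>lo" and "\<tau>lo \<le> \<tau>hi"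
    and "admissible_mesh (dom D) M"
    and "regular_mesh \<zeta> l \<tau>lo \<tau>hi M"
    and "N \<ge> 1"
    and "entropy_constant D \<zeta> l \<tau>lo \<tau>hi C_FI"
    and "\<gamma> > 1"
    and "\<forall>K\<in>cells M. time_step D N / area K \<ge> \<gamma> * (C_FI / \<tau>lo\<^sup>2)"
  shows "\<exists>c \<mu> :: unknown. is_solution D M N c \<mu> \<and>
     (\<forall>n\<in>{0..N}. \<forall>i\<in>{1, 2}.
        (\<Sum>K\<in>cells M. area K * c n i K) = (LINT x:dom D|lebesgue. cinit D i x)) \<and>
     (\<forall>n\<in>{1..N}. \<forall>i\<in>{1, 2}. \<forall>K\<in>cells M. 0 < c n i K \<and> c n i K < 1) \<and>
     (\<forall>n\<in>{1..N}.
        (energy D M (c n) - energy D M (c (n - 1))) / time_step D N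
          + dissipation D M (c n) (\<mu> n) \<le> 0)"
proof -
  interpret ch_scheme D M N
  proof
    fix \<sigma> assume "\<sigma> \<in> int_edges M"
    then have "\<tau>lo \<le> transmissibility M \<sigma>" using assms(7) by (simp add: regular_mesh_def)
    then show "transmissibility M \<sigma> > 0" using assms(4) by simp
  qed (use assms in auto)
  define c0 where "c0 = (\<lambda>i. cell_average (cinit D i))"
  have "\<exists>f. \<forall>n. (conc_state (fst (f n)) \<and> (n = 0 \<longrightarrow> fst (f n) = c0)) \<and>
      time_advance (fst (f n)) (fst (f (Suc n))) (snd (f (Suc n)))"
  proof (rule dependent_nat_choice)
    show "\<exists>x :: (nat \<Rightarrow> pt set \<Rightarrow> real) \<times> (nat \<Rightarrow> pt set \<Rightarrow> real). conc_state (fst x) \<and> (0 = (0::nat)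
        \<longrightarrow> fst x = c0)"
      using conc_state_init by (intro exI[of _ "(c0, c0)"]) (simp add: c0_def)
    fix x :: "(nat \<Rightarrow> pt set \<Rightarrow> real) \<times> (nat \<Rightarrow> pt set \<Rightarrow> real)" and n :: nat
    assume "conc_state (fst x) \<and> (n = 0 \<longrightarrow> fst x = c0)"
    then obtain c \<mu> where "conc_state c" "time_advance (fst x) c \<mu>" using time_advance_exists by blast
    then show "\<exists>y. (conc_state (fst y) \<and> (Suc n = 0 \<longrightarrow> fst y = c0))
        \<and> time_advance (fst x) (fst y) (snd y)"
      by (intro exI[of _ "(c, \<mu>)"]) simp
  qed
  then obtain f where f: "\<And>n. conc_state (fst (f n))" "fst (f 0) = c0"
      "\<And>n. time_advance (fst (f n)) (fst (f (Suc n))) (snd (f (Suc n)))" by blast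
  define c \<mu> where "c n = fst (f n)" and "\<mu> n = snd (f n)" for n
  have st: "conc_state (c n)" for n using f(1) by (simp add: c_def)
  have adv: "time_advance (c (n - 1)) (c n) (\<mu> n)" if "n \<in> {1..N}" for n
    using f(3)[of "n - 1"] that by (simp add: c_def \<mu>_def)
  have "is_solution D M N c \<mu>"
    unfolding is_solution_def
  proof (intro conjI)
    show "\<forall>i\<in>{1, 2}. \<forall>K\<in>cells M. c 0 i K = cell_average (cinit D i) K"
      using f(2) by (simp add: c_def c0_def)
    show "\<forall>n\<in>{1..N}. \<forall>K\<in>cells M. c n 1 K + c n 2 K = 1" using st unfolding conc_state_def by blast
  qed (use adv in \<open>unfold time_advance_def, blast\<close>)+
  moreover have "\<forall>n\<in>{0..N}. \<forall>i\<in>{1, 2}.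
      (\<Sum>K\<in>cells M. area K * c n i K) = (LINT x:dom D|lebesgue. cinit D i x)"
    using st unfolding conc_state_def by blast
  moreover have "\<forall>n\<in>{1..N}. \<forall>i\<in>{1, 2}. \<forall>K\<in>cells M. 0 < c n i K \<and> c n i K < 1"
    using adv unfolding time_advance_def by blast
  moreover have "\<forall>n\<in>{1..N}. (energy D M (c n) - energy D M (c (n - 1))) / time_step D N
          + dissipation D M (c n) (\<mu> n) \<le> 0"
    using adv unfolding time_advance_def by blast
  ultimately show ?thesis by blast
qed

end
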